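(* Fix an integer $r\ge1$. For every $c\in(0,1]$ there is a positive constant $C_r(c)$ depending only on $r$ and $c$, and for every $c\in(0,1]$ and $C>0$ there is a positive constant $C_r(c,C)$ depending only on $r$, $c$ and $C$, such that the following holds for every $n\ge 2r$, $\sigma>0$, $V\ge 0$ and $\theta^*\in\mathbb{R}^n$, with $Y\sim N_n(\theta^*,\sigma^2I_n)$ and $k := \|D^{(r)}\theta^*\|_0$. If $\theta^*$ satisfies the minimum length condition with constant $c$ (at order $r$), then $$R(\hat{\theta}^{(r)}_V, \theta^* ) \leq \left(V - V^{(r)}(\theta^* ) \right)^2 + C_r(c)\, \frac{\sigma^2 (k+1)}{n} \log \frac{en}{k+1}.$$ Further, if $V$ is chosen so that $$\left(V - V^{(r)}(\theta^* )\right)^2 \leq C\, \frac{\sigma^2 (k + 1)}{n} \log \frac{en}{k + 1},$$ then $$R(\hat{\theta}^{(r)}_V, \theta^* ) \leq C_r(c, C)\, \frac{\sigma^2 (k+1)}{n} \log \frac{en}{k+1}.$$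
   Context: For $\theta\in\mathbb{R}^n$, $D^{(0)}\theta := \theta$, $D^{(1)}\theta := (\theta_2-\theta_1,\dots,\theta_n-\theta_{n-1})$, $D^{(r)}\theta := D^{(1)}(D^{(r-1)}\theta)\in\mathbb{R}^{n-r}$. $\|\cdot\|$ is the Euclidean norm, $\|\cdot\|_1$ the $\ell^1$ norm, $\|\cdot\|_0$ the number of non-zero entries. $V^{(r)}(\theta) := n^{r-1}\|D^{(r)}\theta\|_1$. Estimator: $\hat{\theta}^{(r)}_V := \operatorname{argmin}_{\theta \in \mathbb{R}^n}\{\frac12\|Y-\theta\|^2 : \|D^{(r)}\theta\|_1 \le V n^{1-r}\}$. Risk: $R(\hat\theta,\theta^* ) := \frac1n \mathbb{E}_{\theta^*}\|\hat\theta-\theta^*\|^2$. Knots and signs: an index $2\le j\le n-r+1$ is an $r$th order knot of $\theta$ if $(D^{(r-1)}\theta)_{j-1}\ne (D^{(r-1)}\theta)_j$; its sign is $+1$ if $(D^{(r-1)}\theta)_{j-1} < (D^{(r-1)}\theta)_j$ and $-1$ otherwise. The number of knots is $k=\|D^{(r)}\theta\|_0$. Let $2\le j_1<\dots<j_k\le n-r+1$ be all the $r$th order knots of $\theta$ with signs $s_1,\dots,s_k\in\{-1,1\}$, and $s_0=s_{k+1}=0$. Let $n_0 := j_1+r-2$, $n_i := j_{i+1}-j_i$ for $1\le i\le k-1$, $n_k := n-r+2-j_k$. Minimum length condition with constant $c\in(0,1]$: $n_i\ge \frac{cn}{k+1}$ for every $0\le i\le k$ with $s_i\ne s_{i+1}$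 (this is vacuous when $k=0$). The paper assumes $n\ge 2r$ throughout. *)

theory Defs
  imports "HOL-Probability.Probability"
begin

text \<open>
  A vector of \<open>\<real>\<^sup>n\<close> is an element of \<open>{1..n} \<rightarrow>\<^sub>E UNIV\<close>: a function on \<open>nat\<close> with
  entries at the indices \<open>1, \<dots>, n\<close> and the value \<open>undefined\<close> elsewhere, so that equality of
  such functions is equality of vectors.  The Euclidean norm is \<open>L2_set\<close> over \<open>{1..n}\<close>.
\<close>

abbreviation Rn :: "nat \<Rightarrow> (nat \<Rightarrow> real) set" where
  "Rn n \<equiv> {1..n} \<rightarrow>\<^sub>E UNIV"

definition l1_norm :: "nat \<Rightarrow> (nat \<Rightarrow> real) \<Rightarrow> real" where
  "l1_norm m v = (\<Sum>i\<in>{1..m}. \<bar>v i\<bar>)"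

definition l0_norm :: "nat \<Rightarrow> (nat \<Rightarrow> real) \<Rightarrow> nat" where
  "l0_norm m v = card {i \<in> {1..m}. v i \<noteq> 0}"

definition diff_op :: "(nat \<Rightarrow> real) \<Rightarrow> nat \<Rightarrow> real" where
  "diff_op v = (\<lambda>i. v (i + 1) - v i)"

text \<open>
  For \<open>\<theta> \<in> \<real>\<^sup>n\<close> only the entries \<open>1, \<dots>, n - r\<close> of \<open>Dr r \<theta>\<close> are meaningful; they depend on
  the entries \<open>1, \<dots>, n\<close> of \<open>\<theta>\<close> only.
\<close>

definition Dr :: "nat \<Rightarrow> (nat \<Rightarrow> real) \<Rightarrow> nat \<Rightarrow> real" where
  "Dr r \<theta> = (diff_op ^^ r) \<theta>"

definition TV :: "nat \<Rightarrow> nat \<Rightarrow> (nat \<Rightarrow> real) \<Rightarrow> real" where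
  "TV r n \<theta> = real n ^ (r - 1) * l1_norm (n - r) (Dr r \<theta>)"


text \<open>
  The constraint set is closed, convex and, for \<open>V \<ge> 0\<close>, non-empty, so the minimiser exists and
  is unique: \<open>arg_min_on\<close> makes no actual choice.
\<close>

definition tf_estimator :: "nat \<Rightarrow> nat \<Rightarrow> real \<Rightarrow> (nat \<Rightarrow> real) \<Rightarrow> nat \<Rightarrow> real" where
  "tf_estimator r n V y =
     arg_min_on (\<lambda>\<theta>. 1 / 2 * (L2_set (\<lambda>i. y i - \<theta> i) {1..n})\<^sup>2)
       {\<theta> \<in> Rn n. l1_norm (n - r) (Dr r \<theta>) \<le> V * real n powi (1 - int r)}"

text \<open>The law \<open>N\<^sub>n(\<theta>, \<sigma>\<^sup>2 I\<^sub>n)\<close>; the parameter \<open>\<sigma>\<close> is the standard deviation.\<close>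

definition gaussian_vec :: "nat \<Rightarrow> (nat \<Rightarrow> real) \<Rightarrow> real \<Rightarrow> (nat \<Rightarrow> real) measure" where
  "gaussian_vec n \<theta> \<sigma> =
     (\<Pi>\<^sub>M i\<in>{1..n}. density lborel (\<lambda>x. ennreal (normal_density (\<theta> i) \<sigma> x)))"

text \<open>
  The integrand is integrable, as a metric projection is 1-Lipschitz: the default value \<open>0\<close> of the
  Bochner integral plays no role.
\<close>

definition risk :: "nat \<Rightarrow> nat \<Rightarrow> real \<Rightarrow> real \<Rightarrow> (nat \<Rightarrow> real) \<Rightarrow> real" where
  "risk r n \<sigma> V \<theta> =
     1 / real n * (\<integral>y. (L2_set (\<lambda>i. tf_estimator r n V y i - \<theta> i) {1..n})\<^sup>2
                      \<partial>gaussian_vec n \<theta> \<sigma>)"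


definition knots :: "nat \<Rightarrow> nat \<Rightarrow> (nat \<Rightarrow> real) \<Rightarrow> nat set" where
  "knots r n \<theta> = {j. 2 \<le> j \<and> j \<le> n - r + 1 \<and> Dr (r - 1) \<theta> (j - 1) \<noteq> Dr (r - 1) \<theta> j}"

lemma card_knots:
  assumes "r \<ge> 1"
  shows "card (knots r n \<theta>) = l0_norm (n - r) (Dr r \<theta>)"
proof -
  obtain q where q: "r = Suc q" using assms by (cases r) auto
  have "knots r n \<theta> = Suc ` {i \<in> {1..n - r}. Dr r \<theta> i \<noteq> 0}"
  proof (intro equalityI subsetI)
    fix j assume "j \<in> knots r n \<theta>"
    then have "j - 1 \<in> {i \<in> {1..n - r}. Dr r \<theta> i \<noteq> 0}" "j = Suc (j - 1)"
      by (auto simp: knots_def Dr_def diff_op_def q)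
    then show "j \<in> Suc ` {i \<in> {1..n - r}. Dr r \<theta> i \<noteq> 0}" by blast
  qed (auto simp: knots_def Dr_def diff_op_def q)
  then show ?thesis by (simp add: l0_norm_def card_image)
qed

text \<open>The \<open>i\<close>-th smallest knot, for \<open>1 \<le> i \<le> k\<close> where \<open>k\<close> is the number of knots.\<close>

definition knot :: "nat \<Rightarrow> nat \<Rightarrow> (nat \<Rightarrow> real) \<Rightarrow> nat \<Rightarrow> nat" where
  "knot r n \<theta> i = sorted_list_of_set (knots r n \<theta>) ! (i - 1)"

definition knot_sign :: "nat \<Rightarrow> nat \<Rightarrow> (nat \<Rightarrow> real) \<Rightarrow> nat \<Rightarrow> int" where
  "knot_sign r n \<theta> i =
     (if 1 \<le> i \<and> i \<le> card (knots r n \<theta>) then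
        let j = knot r n \<theta> i in if Dr (r - 1) \<theta> (j - 1) < Dr (r - 1) \<theta> j then 1 else - 1
      else 0)"

text \<open>
  None of the subtractions truncates when \<open>1 \<le> r \<le> n\<close> and there is at least one knot.
  Without knots the value is irrelevant: then \<open>s\<^sub>0 = s\<^sub>1 = 0\<close> and the condition below is vacuous.
\<close>

definition seg_length :: "nat \<Rightarrow> nat \<Rightarrow> (nat \<Rightarrow> real) \<Rightarrow> nat \<Rightarrow> nat" where
  "seg_length r n \<theta> i =
     (let j = knot r n \<theta>; k = card (knots r n \<theta>) in
      if i = 0 then j 1 + r - 2
      else if i < k then j (i + 1) - j i
      else n - r + 2 - j k)"

definition min_length_condition :: "nat \<Rightarrow> nat \<Rightarrow> real \<Rightarrow> (nat \<Rightarrow> real) \<Rightarrow> bool" where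
  "min_length_condition r n c \<theta> \<longleftrightarrow>
     (let k = card (knots r n \<theta>) in
      \<forall>i \<le> k. knot_sign r n \<theta> i \<noteq> knot_sign r n \<theta> (i + 1) \<longrightarrow>
        real (seg_length r n \<theta> i) \<ge> c * real n / (real k + 1))"

end

theory Submission
  imports Defs
begin

text \<open>
  Write \<open>p = r - 1\<close>, \<open>z\<close> for the noise and \<open>\<mu> = n / (k + 1)\<close>; intervals of indices are written
  \<open>{a<..b}\<close>.  By scaling, let \<open>\<sigma> = 1\<close> in this sketch.

  The estimator is the metric projection of the data onto a convex set.  So for every feasible \<open>x\<close>,
  with \<open>u\<close> the difference of the estimator and \<open>x\<close>, its squared error is at most
  \<open>\<parallel>x - \<theta>\<parallel>\<^sup>2 + (2 \<langle>z, u\<rangle> - \<parallel>u\<parallel>\<^sup>2)\<close> (\<open>oracle_inequality\<close>).  For \<open>x\<close> one takes \<open>\<theta>\<close> itself if it is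
  feasible, and otherwise \<open>\<theta>\<close> with its derivative of order \<open>r\<close> scaled down until the constraint holds;
  this costs at most \<open>n (V - TV)\<^sup>2\<close> and keeps the derivative proportional to that of \<open>\<theta>\<close>
  (\<open>ex_comparison_point\<close>).  Since the estimator is feasible too, \<open>u\<close> lies, up to a slack
  proportional to the positive part of \<open>V - TV\<close>, in the cone of the directions in which the total variation at \<open>\<theta>\<close> does not increase
  (\<open>cone_form_le\<close>).  The point is to bound the expected supremum of \<open>2 \<langle>z, u\<rangle> - \<parallel>u\<parallel>\<^sup>2\<close> over this
  cone by a multiple of \<open>(k + 1) ln (e n / (k + 1))\<close>.

  Two facts combine.  The stochastic one is local: on an interval of length \<open>d\<close> the supremum over all \<open>u\<close>
  of \<open>2 \<langle>z, u\<rangle> - \<alpha> \<parallel>u\<parallel>\<^sup>2 - \<beta> \<surd>d \<parallel>D u\<parallel>\<^sub>1\<close> has bounded expectation, whatever \<open>d\<close>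
  (\<open>block_form_majorant\<close>).  The deterministic one says that \<open>{1..n}\<close> can be cut, independently of \<open>u\<close>
  and \<open>z\<close>, into \<open>O((k + 1) ln (e n / (k + 1)))\<close> blocks on which \<open>2 \<langle>z, u\<rangle> - \<parallel>u\<parallel>\<^sup>2\<close> is dominated
  by such local functionals, up to a constant per block and a multiple of the positive part of the form
  that defines the cone (\<open>cone_dominated\<close>).

  The deterministic fact is proved by subtracting \<open>\<mu> powr (r - 1/2)\<close> times that form, which is a sum
  over the segments between knots.  On a segment with equal signs at both ends the summand
  is the variation of the derivative of order \<open>p\<close> against that sign.  If it vanished, the derivative
  would be monotone and, as a vector of norm one cannot have a derivative larger than
  \<open>d powr (1/2 - r)\<close> throughout an interval of length \<open>d\<close> (\<open>Dr_somewhere_small\<close>), it would be of at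
  most that order at distance \<open>d\<close> from the ends.  Hence blocks that grow geometrically from both ends
  do (\<open>one_sign_segment_dominated\<close>).  A segment at whose ends the signs differ is long, by the
  minimum length condition, and can be cut into three parts with one sign each
  (\<open>two_sign_segment_dominated\<close>).
\<close>

section \<open>Discrete derivatives on intervals\<close>

lemma Dr_0 [simp]: "Dr 0 u = u"
  by (simp add: Dr_def)

lemma Dr_Suc: "Dr (Suc q) u x = Dr q u (x + 1) - Dr q u x"
  by (simp add: Dr_def diff_op_def)

lemma Dr_Suc_right: "Dr (Suc q) u = Dr q (diff_op u)"
  by (simp add: Dr_def funpow_swap1)

lemma Dr_add: "Dr q (\<lambda>i. u i + v i) x = Dr q u x + Dr q v x"
  by (induction q arbitrary: x) (simp_all add: Dr_Suc)

lemma Dr_scale: "Dr q (\<lambda>i. c * u i) x = c * Dr q u x"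
  by (induction q arbitrary: x) (simp_all add: Dr_Suc right_diff_distrib)

lemma Dr_uminus: "Dr q (\<lambda>i. - u i) x = - Dr q u x"
  using Dr_scale[of q "-1" u x] by simp

lemma Dr_diff: "Dr q (\<lambda>i. u i - v i) x = Dr q u x - Dr q v x"
  using Dr_add[of q u "\<lambda>i. - v i" x] by (simp add: Dr_uminus)

lemma Dr_cong:
  assumes "\<And>i. x \<le> i \<Longrightarrow> i \<le> x + q \<Longrightarrow> u i = v i"
  shows "Dr q u x = Dr q v x"
  using assms
proof (induction q arbitrary: x)
  case (Suc q)
  have "Dr q u (x + 1) = Dr q v (x + 1)" "Dr q u x = Dr q v x"
    using Suc.prems by (auto intro!: Suc.IH)
  then show ?case by (simp add: Dr_Suc)
qed auto

lemma abs_le_L2_set: "finite A \<Longrightarrow> i \<in> A \<Longrightarrow> \<bar>u i\<bar> \<le> L2_set u A"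
  using member_le_L2_set[of A i u] member_le_L2_set[of A i "\<lambda>i. - u i"]
  by (simp add: L2_set_def abs_le_iff)

lemma abs_Dr_le:
  assumes "a < x" "x + q \<le> b"
  shows "\<bar>Dr q u x\<bar> \<le> 2 ^ q * L2_set u {a<..b}"
  using assms
proof (induction q arbitrary: x)
  case 0
  then show ?case by (simp add: abs_le_L2_set)
next
  case (Suc q)
  have "\<bar>Dr q u (x + 1)\<bar> \<le> 2 ^ q * L2_set u {a<..b}" "\<bar>Dr q u x\<bar> \<le> 2 ^ q * L2_set u {a<..b}"
    using Suc.prems by (auto intro!: Suc.IH)
  then show ?case by (simp add: Dr_Suc)
qed

lemma L2_set_uminus: "L2_set (\<lambda>i. - u i) A = L2_set u A"
  by (simp add: L2_set_def)

lemma L2_set_mono_set: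
  "A \<subseteq> B \<Longrightarrow> finite B \<Longrightarrow> L2_set u A \<le> L2_set u B"
  unfolding L2_set_def by (intro real_sqrt_le_mono sum_mono2) auto

lemma L2_set_sq: "(L2_set u A)\<^sup>2 = (\<Sum>i\<in>A. (u i)\<^sup>2)"
  by (simp add: L2_set_def sum_nonneg)

text \<open>The function \<open>x \<mapsto> x powr (p + 1/2)\<close>, the factor by which the \<open>p\<close>-th derivative of a vector
  of norm one on an interval of length \<open>x\<close> has to be rescaled.\<close>

definition halfpow :: "nat \<Rightarrow> real \<Rightarrow> real" where
  "halfpow p x = x ^ p * sqrt x"

lemma halfpow_nonneg: "0 \<le> x \<Longrightarrow> 0 \<le> halfpow p x"
  by (simp add: halfpow_def)

lemma halfpow_pos: "0 < x \<Longrightarrow> 0 < halfpow p x"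
  by (simp add: halfpow_def)

lemma halfpow_mono: "0 \<le> x \<Longrightarrow> x \<le> y \<Longrightarrow> halfpow p x \<le> halfpow p y"
  unfolding halfpow_def by (intro mult_mono power_mono) auto

lemma halfpow_mult: "halfpow p (x * y) = halfpow p x * halfpow p y"
  by (simp add: halfpow_def power_mult_distrib real_sqrt_mult)

lemma exists_small_entry:
  assumes "a < b"
  shows "\<exists>x\<in>{a<..b}. \<bar>u x\<bar> * sqrt (real (b - a)) \<le> L2_set u {a<..b}"
proof (rule ccontr)
  assume "\<not> ?thesis"
  then have *: "L2_set u {a<..b} < \<bar>u x\<bar> * sqrt (real (b - a))" if "x \<in> {a<..b}" for x
    using that by force
  let ?m = "L2_set u {a<..b} / sqrt (real (b - a))"
  have s: "sqrt (real (b - a)) > 0" using assms by simp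
  have "(\<Sum>x\<in>{a<..b}. ?m\<^sup>2) < (\<Sum>x\<in>{a<..b}. (u x)\<^sup>2)"
  proof (rule sum_strict_mono)
    show "{a<..b} \<noteq> {}" using assms by simp
    fix x assume "x \<in> {a<..b}"
    from *[OF this] have "?m < \<bar>u x\<bar>" using s by (simp add: field_simps)
    moreover have "0 \<le> ?m" by simp
    ultimately have "?m\<^sup>2 < \<bar>u x\<bar>\<^sup>2" by (intro power_strict_mono) auto
    then show "?m\<^sup>2 < (u x)\<^sup>2" by simp
  qed simp
  moreover have "(\<Sum>x\<in>{a<..b}. ?m\<^sup>2) = (L2_set u {a<..b})\<^sup>2"
    using assms by (simp add: power_divide)
  ultimately show False by (simp add: L2_set_sq)
qed

text \<open>If \<open>Dr (Suc q) u \<ge> A > 0\<close> throughout, then between the outer thirds of the interval \<open>Dr q u\<close>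
  rises by at least \<open>A\<close> times a fixed fraction of the length; but in the right third it is somewhere
  not too large and in the left third somewhere not too small, by induction.  Intervals with fewer
  than \<open>3 (q + 1)\<close> points only affect the constant.\<close>

lemma Dr_somewhere_small:
  "\<exists>C\<ge>1. \<forall>u a b. a + q < b \<longrightarrow>
     (\<exists>x. a < x \<and> x + q \<le> b \<and> Dr q u x * halfpow q (real (b - a)) \<le> C * L2_set u {a<..b})"
proof (induction q)
  case 0
  have "\<exists>x. a < x \<and> x \<le> b \<and> u x * sqrt (real (b - a)) \<le> L2_set u {a<..b}" if "a < b" for u a b
  proof -
    obtain x where x: "x \<in> {a<..b}" "\<bar>u x\<bar> * sqrt (real (b - a)) \<le> L2_set u {a<..b}"
      using exists_small_entry[OF \<open>a < b\<close>] by blast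
    have "u x * sqrt (real (b - a)) \<le> \<bar>u x\<bar> * sqrt (real (b - a))"
      by (intro mult_right_mono) auto
    with x(2) have "u x * sqrt (real (b - a)) \<le> L2_set u {a<..b}" by (rule order_trans[rotated])
    with x(1) show ?thesis by (intro exI[of _ x]) simp
  qed
  then show ?case by (intro exI[of _ 1]) (auto simp: halfpow_def)
next
  case (Suc q)
  then obtain C where C: "C \<ge> 1" and
    IH: "\<And>u a b. a + q < b \<Longrightarrow> \<exists>x. a < x \<and> x + q \<le> b \<and>
           Dr q u x * halfpow q (real (b - a)) \<le> C * L2_set u {a<..b}"
    by blast
  define C' where "C' = max (2 * C * 5 ^ (q + 2)) (2 ^ Suc q * halfpow (Suc q) (real (3 * (q + 1))))"
  have C': "C' \<ge> 1"
  proof -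
    have "(1::real) \<le> 5 ^ (q + 2)" by (rule one_le_power) simp
    then have "1 * 1 \<le> (2 * C) * 5 ^ (q + 2)" using C by (intro mult_mono) auto
    then show ?thesis unfolding C'_def by linarith
  qed
  have "\<exists>x. a < x \<and> x + Suc q \<le> b \<and>
           Dr (Suc q) u x * halfpow (Suc q) (real (b - a)) \<le> C' * L2_set u {a<..b}"
    if ab: "a + Suc q < b" for u a b
  proof (rule ccontr)
    assume "\<not> ?thesis"
    then have *: "C' * L2_set u {a<..b} < Dr (Suc q) u x * halfpow (Suc q) (real (b - a))"
      if "a < x" "x + Suc q \<le> b" for x using that by force
    let ?h = "halfpow (Suc q) (real (b - a))" and ?n = "L2_set u {a<..b}"
    have h: "?h > 0" using ab by (intro halfpow_pos) simp
    define A where "A = C' * ?n / ?h"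
    have A0: "A \<ge> 0" using C' h by (simp add: A_def)
    have A: "A < Dr (Suc q) u x" if "a < x" "x + Suc q \<le> b" for x
      using *[OF that] h by (simp add: A_def field_simps)
    show False
    proof (cases "b - a < 3 * (q + 1)")
      case True
      have "Dr (Suc q) u (a + 1) \<le> 2 ^ Suc q * ?n"
        using abs_Dr_le[of a "a + 1" "Suc q" b u] ab by linarith
      then have "Dr (Suc q) u (a + 1) * ?h \<le> 2 ^ Suc q * ?n * ?h"
        using h by (intro mult_right_mono) auto
      moreover have "C' * ?n < Dr (Suc q) u (a + 1) * ?h" using *[of "a + 1"] ab by simp
      ultimately have "C' * ?n < 2 ^ Suc q * ?n * ?h" by linarith
      also have "?h \<le> halfpow (Suc q) (real (3 * (q + 1)))"
        using True by (intro halfpow_mono) auto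
      then have "2 ^ Suc q * ?n * ?h \<le> 2 ^ Suc q * ?n * halfpow (Suc q) (real (3 * (q + 1)))"
        by (intro mult_left_mono) auto
      also have "\<dots> \<le> C' * ?n"
        using mult_right_mono[of "2 ^ Suc q * halfpow (Suc q) (real (3 * (q + 1)))" C' ?n]
        by (simp add: C'_def algebra_simps)
      finally show False by simp
    next
      case False
      define e where "e = (b - a) div 3"
      have l: "3 * (q + 1) \<le> b - a" using False by simp
      obtain s where s: "b - a = 3 * e + s" "s < 3"
        by (rule that[of "(b - a) mod 3"]) (simp_all add: e_def)
      have e1: "q + 1 \<le> e" using l s by simp
      then have e: "q + 1 \<le> e" "3 * e \<le> b - a" "b - a \<le> 5 * e" "e > 0" using s by simp_all
      define H where "H = halfpow q (real e)"
      have H: "H > 0" unfolding H_def using e by (intro halfpow_pos) simp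
      obtain x where x: "a < x" "x + q \<le> a + e" "- Dr q u x * H \<le> C * L2_set u {a<..a+e}"
        using IH[of a "a + e" "\<lambda>i. - u i"] e unfolding H_def
        by (auto simp: Dr_uminus L2_set_uminus)
      have be: "b - e + q < b" "b - (b - e) = e" using e ab by linarith+
      obtain y where y: "b - e < y" "y + q \<le> b" "Dr q u y * H \<le> C * L2_set u {b-e<..b}"
        using IH[of "b - e" b u, OF be(1)] unfolding H_def be(2) by blast
      have xy: "x \<le> y" "real e \<le> real (y - x)" using x y e by auto
      have "L2_set u {a<..a+e} \<le> ?n" "L2_set u {b-e<..b} \<le> ?n"
        using e by (auto intro!: L2_set_mono_set)
      then have "C * L2_set u {a<..a+e} \<le> C * ?n" "C * L2_set u {b-e<..b} \<le> C * ?n"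
        using C by auto
      with x y have up: "(Dr q u y - Dr q u x) * H \<le> 2 * C * ?n"
        by (simp add: left_diff_distrib)
      have "Dr q u (x + k) - Dr q u x \<ge> real k * A \<and> (k > 0 \<longrightarrow> Dr q u (x + k) - Dr q u x > real k * A)"
        if "x + k \<le> y" for k
        using that
      proof (induction k)
        case (Suc k)
        have "A < Dr (Suc q) u (x + k)" using Suc.prems x y by (intro A) auto
        with Suc show ?case by (simp add: Dr_Suc algebra_simps)
      qed simp
      from this[of "y - x"] have "real (y - x) * A < Dr q u y - Dr q u x" using xy e by simp
      moreover have "real e * A \<le> real (y - x) * A" using xy A0 by (intro mult_right_mono)
      ultimately have "(real e * A) * H < (Dr q u y - Dr q u x) * H"
        using H by (intro mult_strict_right_mono) auto
      with up have "A * (real e * H) < 2 * C * ?n" by (simp add: mult_ac)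
      moreover have "real e * H = halfpow (Suc q) (real e)" by (simp add: H_def halfpow_def)
      ultimately have Ae: "A * halfpow (Suc q) (real e) < 2 * C * ?n" by simp
      have "?h \<le> halfpow (Suc q) (5 * real e)" using e by (intro halfpow_mono) auto
      also have "\<dots> = halfpow (Suc q) 5 * halfpow (Suc q) (real e)" by (rule halfpow_mult)
      also have "halfpow (Suc q) 5 \<le> 5 ^ (q + 2)"
        using real_sqrt_le_mono[of 5 25] by (simp add: halfpow_def)
      finally have he: "?h \<le> 5 ^ (q + 2) * halfpow (Suc q) (real e)"
        using halfpow_nonneg[of "real e" "Suc q"] by (simp add: mult_right_mono)
      have "C' * ?n = A * ?h" using h by (simp add: A_def)
      also have "\<dots> \<le> A * (5 ^ (q + 2) * halfpow (Suc q) (real e))"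
        using he A0 by (intro mult_left_mono)
      also have "\<dots> = 5 ^ (q + 2) * (A * halfpow (Suc q) (real e))" by simp
      also have "\<dots> < 5 ^ (q + 2) * (2 * C * ?n)" using Ae by (intro mult_strict_left_mono) auto
      also have "\<dots> \<le> C' * ?n"
        using mult_right_mono[of "2 * C * 5 ^ (q + 2)" C' ?n] by (simp add: C'_def mult_ac)
      finally show False by simp
    qed
  qed
  with C' show ?case by blast
qed


lemma Dr_telescope: "x \<le> y \<Longrightarrow> (\<Sum>j\<in>{x..<y}. Dr (Suc q) u j) = Dr q u y - Dr q u x"
  using sum_Suc_diff'[of x y "Dr q u"] by (simp add: Dr_Suc)

definition l1_Dr :: "nat \<Rightarrow> (nat \<Rightarrow> real) \<Rightarrow> nat \<Rightarrow> nat \<Rightarrow> real" where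
  "l1_Dr q u a b = (\<Sum>j\<in>{a<..b - q}. \<bar>Dr q u j\<bar>)"

lemma l1_Dr_nonneg: "0 \<le> l1_Dr q u a b"
  by (simp add: l1_Dr_def sum_nonneg)

lemma Dr_dist_le_l1:
  assumes "a < x" "x + q \<le> b" "a < y" "y + q \<le> b"
  shows "\<bar>Dr q u y - Dr q u x\<bar> \<le> l1_Dr (Suc q) u a b"
proof -
  have *: "\<bar>Dr q u y - Dr q u x\<bar> \<le> l1_Dr (Suc q) u a b"
    if "a < x" "y + q \<le> b" "x \<le> y" for x y
  proof -
    have "\<bar>Dr q u y - Dr q u x\<bar> \<le> (\<Sum>j\<in>{x..<y}. \<bar>Dr (Suc q) u j\<bar>)"
      using Dr_telescope[OF \<open>x \<le> y\<close>, of q u] by (metis sum_abs)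
    also have "\<dots> \<le> l1_Dr (Suc q) u a b"
      unfolding l1_Dr_def using that by (intro sum_mono2) auto
    finally show ?thesis .
  qed
  show ?thesis
    using *[of x y] *[of y x] assms by (cases "x \<le> y") (auto simp: abs_minus_commute)
qed

lemma halfpow_Suc: "halfpow (Suc q) x = x * halfpow q x"
  by (simp add: halfpow_def)

text \<open>The derivative is small somewhere and oscillates by at most its variation.\<close>

lemma abs_Dr_le_L2_l1:
  "\<exists>C\<ge>1. \<forall>u a b x. a < x \<and> x + q \<le> b \<longrightarrow>
     \<bar>Dr q u x\<bar> * halfpow q (real (b - a))
       \<le> C * L2_set u {a<..b} + halfpow q (real (b - a)) * l1_Dr (Suc q) u a b"
proof -
  obtain C where C: "C \<ge> 1" and
    IH: "\<And>u a b. a + q < b \<Longrightarrow> \<exists>x. a < x \<and> x + q \<le> b \<and>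
           Dr q u x * halfpow q (real (b - a)) \<le> C * L2_set u {a<..b}"
    using Dr_somewhere_small[of q] by blast
  have up: "Dr q u x * halfpow q (real (b - a))
       \<le> C * L2_set u {a<..b} + halfpow q (real (b - a)) * l1_Dr (Suc q) u a b"
    if x: "a < x" "x + q \<le> b" for u a b x
  proof -
    let ?h = "halfpow q (real (b - a))"
    have h: "?h \<ge> 0" by (rule halfpow_nonneg) simp
    obtain y where y: "a < y" "y + q \<le> b" "Dr q u y * ?h \<le> C * L2_set u {a<..b}"
      using IH[of a b u] x by auto
    have "Dr q u x \<le> Dr q u y + l1_Dr (Suc q) u a b"
      using Dr_dist_le_l1[OF y(1,2) x, of u] by linarith
    then have "Dr q u x * ?h \<le> (Dr q u y + l1_Dr (Suc q) u a b) * ?h"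
      using h by (rule mult_right_mono)
    with y(3) show ?thesis by (simp add: algebra_simps)
  qed
  have "\<bar>Dr q u x\<bar> * halfpow q (real (b - a))
       \<le> C * L2_set u {a<..b} + halfpow q (real (b - a)) * l1_Dr (Suc q) u a b"
    if x: "a < x" "x + q \<le> b" for u a b x
    using up[OF x, of u] up[OF x, of "\<lambda>i. - u i"]
    by (cases "Dr q u x \<ge> 0") (auto simp: Dr_uminus L2_set_uminus l1_Dr_def)
  with C show ?thesis by blast
qed

text \<open>A discrete Gagliardo-Nirenberg inequality, obtained by iterating the pointwise bound over the
  orders.  It reduces the stochastic part of the argument to variation of order one.\<close>

lemma l1_Dr_1_le:
  "\<exists>C\<ge>1. \<forall>u a b. a + p < b \<longrightarrow>
     sqrt (real (b - a)) * l1_Dr 1 u a b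
       \<le> C * L2_set u {a<..b} + halfpow p (real (b - a)) * l1_Dr (Suc p) u a b"
proof (induction p)
  case 0
  then show ?case
    by (intro exI[of _ 1]) (auto simp: halfpow_def)
next
  case (Suc p)
  then obtain C where C: "C \<ge> 1" and
    IH: "\<And>u a b. a + p < b \<Longrightarrow> sqrt (real (b - a)) * l1_Dr 1 u a b
       \<le> C * L2_set u {a<..b} + halfpow p (real (b - a)) * l1_Dr (Suc p) u a b"
    by blast
  obtain C' where C': "C' \<ge> 1" and
    pt: "\<And>u a b x. a < x \<Longrightarrow> x + Suc p \<le> b \<Longrightarrow> \<bar>Dr (Suc p) u x\<bar> * halfpow (Suc p) (real (b - a))
       \<le> C' * L2_set u {a<..b} + halfpow (Suc p) (real (b - a)) * l1_Dr (Suc (Suc p)) u a b"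
    using abs_Dr_le_L2_l1[of "Suc p"] by blast
  have "sqrt (real (b - a)) * l1_Dr 1 u a b
       \<le> (C + C') * L2_set u {a<..b} + halfpow (Suc p) (real (b - a)) * l1_Dr (Suc (Suc p)) u a b"
    if ab: "a + Suc p < b" for u a b
  proof -
    let ?d = "real (b - a)"
    let ?B = "C' * L2_set u {a<..b} + halfpow (Suc p) ?d * l1_Dr (Suc (Suc p)) u a b"
    have d: "?d > 0" using ab by simp
    have B: "?B \<ge> 0"
      using C' by (intro add_nonneg_nonneg mult_nonneg_nonneg halfpow_nonneg l1_Dr_nonneg) auto
    have "halfpow p ?d * l1_Dr (Suc p) u a b = (\<Sum>x\<in>{a<..b - Suc p}. \<bar>Dr (Suc p) u x\<bar> * halfpow p ?d)"
      unfolding l1_Dr_def by (simp add: sum_distrib_left mult.commute)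
    also have "\<dots> \<le> (\<Sum>x\<in>{a<..b - Suc p}. ?B / ?d)"
    proof (rule sum_mono)
      fix x assume "x \<in> {a<..b - Suc p}"
      then have "\<bar>Dr (Suc p) u x\<bar> * halfpow (Suc p) ?d \<le> ?B" by (intro pt) auto
      then show "\<bar>Dr (Suc p) u x\<bar> * halfpow p ?d \<le> ?B / ?d"
        using d by (simp add: halfpow_Suc pos_le_divide_eq mult_ac)
    qed
    also have "\<dots> = real (b - Suc p - a) * (?B / ?d)" by simp
    also have "\<dots> \<le> ?d * (?B / ?d)" using B d by (intro mult_right_mono divide_nonneg_nonneg) auto
    also have "\<dots> = ?B" using d by simp
    finally show ?thesis using IH[of a b u] ab by (simp add: algebra_simps)
  qed
  moreover have "C + C' \<ge> 1" using C C' by simp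
  ultimately show ?case by blast
qed

section \<open>Block functionals and geometric partitions\<close>

text \<open>The penalty carries the factor \<open>sqrt (b - a)\<close> so that the three terms scale alike: for standard
  Gaussian \<open>z\<close> the supremum over \<open>u\<close> has bounded expectation, uniformly in the length.\<close>

definition block_form :: "real \<Rightarrow> real \<Rightarrow> (nat \<Rightarrow> real) \<Rightarrow> (nat \<Rightarrow> real) \<Rightarrow> nat \<times> nat \<Rightarrow> real" where
  "block_form \<alpha> \<beta> z u = (\<lambda>(a, b). 2 * (\<Sum>i\<in>{a<..b}. z i * u i) - \<alpha> * (\<Sum>i\<in>{a<..b}. (u i)\<^sup>2)
     - \<beta> * (sqrt (real (b - a)) * l1_Dr 1 u a b))"

text \<open>The blocks do not depend on \<open>z\<close> or \<open>u\<close>, so that expectations can be taken block by block.  One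
  number \<open>c\<close> bounds both the number of blocks and the remainder; this makes the notion additive.\<close>

definition block_dominated ::
  "nat \<Rightarrow> real \<Rightarrow> real \<Rightarrow> real \<Rightarrow> ((nat \<Rightarrow> real) \<Rightarrow> (nat \<Rightarrow> real) \<Rightarrow> real) \<Rightarrow> bool" where
  "block_dominated n \<alpha> \<beta> c F \<longleftrightarrow>
     (\<exists>xs. real (length xs) \<le> c \<and> (\<forall>(a, b)\<in>set xs. a < b \<and> b \<le> n) \<and>
        (\<forall>z u. F z u \<le> c + (\<Sum>x\<leftarrow>xs. block_form \<alpha> \<beta> z u x)))"

lemma block_form_mono:
  assumes "\<alpha>' \<le> \<alpha>" "\<beta>' \<le> \<beta>"
  shows "block_form \<alpha> \<beta> z u x \<le> block_form \<alpha>' \<beta>' z u x"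
proof -
  obtain a b where x: "x = (a, b)" by force
  have "\<alpha>' * (\<Sum>i\<in>{a<..b}. (u i)\<^sup>2) \<le> \<alpha> * (\<Sum>i\<in>{a<..b}. (u i)\<^sup>2)"
    using assms by (intro mult_right_mono sum_nonneg) auto
  moreover have "\<beta>' * (sqrt (real (b - a)) * l1_Dr 1 u a b) \<le> \<beta> * (sqrt (real (b - a)) * l1_Dr 1 u a b)"
    using assms by (intro mult_right_mono mult_nonneg_nonneg l1_Dr_nonneg) auto
  ultimately show ?thesis by (simp add: x block_form_def)
qed

lemma block_dominated_weaken:
  assumes "block_dominated n \<alpha> \<beta> c F" "\<alpha>' \<le> \<alpha>" "\<beta>' \<le> \<beta>" "c \<le> c'"
    and "\<And>z u. F' z u \<le> F z u"
  shows "block_dominated n \<alpha>' \<beta>' c' F'"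
proof -
  obtain xs where xs: "real (length xs) \<le> c" "\<forall>(a, b)\<in>set xs. a < b \<and> b \<le> n"
    "\<And>z u. F z u \<le> c + (\<Sum>x\<leftarrow>xs. block_form \<alpha> \<beta> z u x)"
    using assms(1) unfolding block_dominated_def by blast
  have "F' z u \<le> c' + (\<Sum>x\<leftarrow>xs. block_form \<alpha>' \<beta>' z u x)" for z u
  proof -
    have "(\<Sum>x\<leftarrow>xs. block_form \<alpha> \<beta> z u x) \<le> (\<Sum>x\<leftarrow>xs. block_form \<alpha>' \<beta>' z u x)"
      by (intro sum_list_mono block_form_mono assms)
    with xs(3)[of z u] assms(4) assms(5)[of z u] show ?thesis by linarith
  qed
  with xs assms(4) show ?thesis unfolding block_dominated_def by (intro exI[of _ xs]) auto
qed

lemma block_dominated_add: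
  assumes "block_dominated n \<alpha> \<beta> c F" "block_dominated n \<alpha> \<beta> c' F'"
  shows "block_dominated n \<alpha> \<beta> (c + c') (\<lambda>z u. F z u + F' z u)"
proof -
  obtain xs where xs: "real (length xs) \<le> c" "\<forall>(a, b)\<in>set xs. a < b \<and> b \<le> n"
    "\<And>z u. F z u \<le> c + (\<Sum>x\<leftarrow>xs. block_form \<alpha> \<beta> z u x)"
    using assms(1) unfolding block_dominated_def by blast
  obtain ys where ys: "real (length ys) \<le> c'" "\<forall>(a, b)\<in>set ys. a < b \<and> b \<le> n"
    "\<And>z u. F' z u \<le> c' + (\<Sum>x\<leftarrow>ys. block_form \<alpha> \<beta> z u x)"
    using assms(2) unfolding block_dominated_def by blast
  have "F z u + F' z u \<le> c + c' + (\<Sum>x\<leftarrow>xs @ ys. block_form \<alpha> \<beta> z u x)" for z u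
    using xs(3)[of z u] ys(3)[of z u] by simp
  then show ?thesis
    unfolding block_dominated_def using xs(1,2) ys(1,2) by (intro exI[of _ "xs @ ys"]) auto
qed

lemma block_dominated_sum:
  fixes k :: nat
  assumes "\<And>i. i < k \<Longrightarrow> block_dominated n \<alpha> \<beta> (c i) (F i)"
  shows "block_dominated n \<alpha> \<beta> (\<Sum>i<k. c i) (\<lambda>z u. \<Sum>i<k. F i z u)"
  using assms
proof (induction k)
  case 0
  then show ?case by (auto simp: block_dominated_def intro!: exI[of _ "[]"])
next
  case (Suc k)
  then show ?case using block_dominated_add[of n \<alpha> \<beta> "\<Sum>i<k. c i" "\<lambda>z u. \<Sum>i<k. F i z u" "c k" "F k"]
    by (simp add: add_ac)
qed

lemma sum_consecutive_intervals:
  fixes ps :: "nat \<Rightarrow> nat" and g :: "nat \<Rightarrow> real"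
  assumes "\<And>t. t < N \<Longrightarrow> ps t \<le> ps (Suc t)"
  shows "(\<Sum>t<N. \<Sum>j\<in>{ps t<..ps (Suc t)}. g j) = (\<Sum>j\<in>{ps 0<..ps N}. g j)"
  using assms
proof (induction N)
  case (Suc N)
  have "ps 0 \<le> ps m" if "m \<le> N" for m
    using that Suc.prems by (induction m) (auto intro: order_trans less_imp_le_nat)
  from this[of N] have "{ps 0<..ps (Suc N)} = {ps 0<..ps N} \<union> {ps N<..ps (Suc N)}"
    using Suc.prems[of N] by auto
  then have "(\<Sum>j\<in>{ps 0<..ps (Suc N)}. g j) = (\<Sum>j\<in>{ps 0<..ps N}. g j) + (\<Sum>j\<in>{ps N<..ps (Suc N)}. g j)"
    by (simp only:) (rule sum.union_disjoint, auto)
  with Suc show ?case by simp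
qed simp

text \<open>A partition of Whitney type: doubling the size at every step from both ends keeps each block about
  as long as its distance from the nearer end, and takes logarithmically many steps until the cap
  \<open>h\<close> is reached.\<close>

lemma geometric_block_sizes:
  assumes "1 \<le> d" "d \<le> h" "d \<le> m"
  shows "\<exists>N (sz :: nat \<Rightarrow> nat). 1 \<le> N \<and> (\<Sum>t<N. sz t) = m \<and> (\<forall>t<N. d \<le> sz t \<and> sz t \<le> 2 * h) \<and>
           sz 0 \<le> 2 * d \<and> sz (N - 1) \<le> 2 * d \<and>
           (\<forall>t. Suc t < N \<longrightarrow> sz t \<le> 4 * sz (Suc t) \<and> sz (Suc t) \<le> 4 * sz t) \<and>
           real N \<le> 2 + 2 * real m / real h + 2 * log 2 (real m / real d)"
  using assms
proof (induction m arbitrary: d rule: less_induct)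
  case (less m)
  have log0: "0 \<le> log 2 (real m / real d)" using less.prems by simp
  have q0: "0 \<le> 2 * real m / real h" by simp
  consider "m \<le> 2 * d" | "2 * d < m" "m \<le> 4 * d" | "4 * d < m" by linarith
  then show ?case
  proof cases
    case 1
    then show ?thesis using less.prems log0 q0
      by (intro exI[of _ 1] exI[of _ "\<lambda>_. m"]) auto
  next
    case 2
    let ?sz = "\<lambda>t. if t = 0 then m div 2 else m - m div 2"
    have "(\<Sum>t<2::nat. ?sz t) = m" by (simp add: numeral_2_eq_2)
    moreover have "d \<le> m div 2" "m div 2 \<le> 2 * d" "d \<le> m - m div 2" "m - m div 2 \<le> 2 * d"
      "m div 2 \<le> 4 * (m - m div 2)" "m - m div 2 \<le> 4 * (m div 2)"
      using 2 less.prems(1) by linarith+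
    ultimately show ?thesis using less.prems log0 q0
      by (intro exI[of _ 2] exI[of _ ?sz]) auto
  next
    case 3
    (* The outermost blocks get size d; the rest is cut recursively with ends between d' and 2 d'. *)
    define d' where "d' = min (2 * d) h"
    define m' where "m' = m - 2 * d"
    have d': "1 \<le> d'" "d' \<le> h" "d' \<le> m'" "d \<le> d'" "d' \<le> 2 * d" and m': "m' < m"
      using 3 less.prems by (auto simp: d'_def m'_def)
    obtain N sz where IH: "1 \<le> N" "(\<Sum>t<N. sz t) = m'" "\<forall>t<N. d' \<le> sz t \<and> sz t \<le> 2 * h"
      "sz 0 \<le> 2 * d'" "sz (N - 1) \<le> 2 * d'"
      "\<forall>t. Suc t < N \<longrightarrow> sz t \<le> 4 * sz (Suc t) \<and> sz (Suc t) \<le> 4 * sz t"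
      "real N \<le> 2 + 2 * real m' / real h + 2 * log 2 (real m' / real d')"
      using less.IH[OF m' d'(1-3)] by blast
    define sz' where "sz' t = (if t = 0 \<or> t = Suc N then d else sz (t - 1))" for t
    have "(\<Sum>t<Suc (Suc N). sz' t) = (\<Sum>t<Suc N. sz' t) + d" by (simp add: sz'_def)
    also have "(\<Sum>t<Suc N. sz' t) = d + (\<Sum>t<N. sz' (Suc t))"
      by (subst sum.lessThan_Suc_shift) (simp add: sz'_def)
    also have "(\<Sum>t<N. sz' (Suc t)) = (\<Sum>t<N. sz t)" by (intro sum.cong) (auto simp: sz'_def)
    finally have "(\<Sum>t<Suc (Suc N). sz' t) = m" using IH(2) 3 by (simp add: m'_def)
    moreover have "d \<le> sz' t \<and> sz' t \<le> 2 * h" if "t < Suc (Suc N)" for t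
    proof (cases "t = 0 \<or> t = Suc N")
      case False
      then have "t - 1 < N" using that by auto
      then have "d' \<le> sz (t - 1)" "sz (t - 1) \<le> 2 * h" using IH(3) by blast+
      moreover have "sz' t = sz (t - 1)" using False by (simp add: sz'_def)
      ultimately show ?thesis using d' by linarith
    qed (use less.prems in \<open>auto simp: sz'_def\<close>)
    moreover have "sz' t \<le> 4 * sz' (Suc t) \<and> sz' (Suc t) \<le> 4 * sz' t" if tN: "Suc t < Suc (Suc N)" for t
    proof -
      have ends: "d \<le> sz 0" "sz 0 \<le> 4 * d" "d \<le> sz (N - 1)" "sz (N - 1) \<le> 4 * d"
      proof -
        have "0 < N" "N - 1 < N" using IH(1) by auto
        then have "d' \<le> sz 0" "d' \<le> sz (N - 1)" using IH(3) by blast+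
        then show "d \<le> sz 0" "sz 0 \<le> 4 * d" "d \<le> sz (N - 1)" "sz (N - 1) \<le> 4 * d"
          using IH(4,5) d' by linarith+
      qed
      consider "t = 0" | "t > 0" "t = N" | "t > 0" "t < N" using tN by linarith
      then show ?thesis
      proof cases
        case 1
        then show ?thesis using IH(1) ends by (auto simp: sz'_def)
      next
        case 2
        then show ?thesis using ends by (auto simp: sz'_def)
      next
        case 3
        then obtain s where "t = Suc s" by (cases t) auto
        with 3 IH(6) show ?thesis by (simp add: sz'_def)
      qed
    qed
    moreover have "real (Suc (Suc N)) \<le> 2 + 2 * real m / real h + 2 * log 2 (real m / real d)"
    proof (cases "2 * d \<le> h")
      case True
      then have e: "d' = 2 * d" by (simp add: d'_def)
      have "log 2 (real m' / real d') = log 2 ((real m' / real d) / 2)" using e by (simp add: mult.commute)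
      also have "\<dots> = log 2 (real m' / real d) - 1"
        using d' less.prems by (subst log_divide) auto
      also have "log 2 (real m' / real d) \<le> log 2 (real m / real d)"
        using m' d' less.prems by (subst log_le_cancel_iff) (auto intro!: divide_right_mono)
      finally have "2 * log 2 (real m' / real d') \<le> 2 * log 2 (real m / real d) - 2" by simp
      moreover have "2 * real m' / real h \<le> 2 * real m / real h"
        using m' by (intro divide_right_mono) auto
      ultimately show ?thesis using IH(7) by simp
    next
      case False
      then have e: "d' = h" by (simp add: d'_def)
      have "real m' / real d' \<le> real m / real d"
        using m' d' less.prems by (intro frac_le) auto
      then have "log 2 (real m' / real d') \<le> log 2 (real m / real d)"
        using m' d' less.prems by (subst log_le_cancel_iff) auto
      moreover have "2 * real m' / real h \<le> 2 * real m / real h - 2"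
      proof -
        have "2 * real m' \<le> 2 * real m - 2 * real h"
          using False 3 by (simp add: m'_def of_nat_diff)
        then show ?thesis using less.prems by (simp add: field_simps)
      qed
      ultimately show ?thesis using IH(7) by simp
    qed
    ultimately show ?thesis
      by (intro exI[of _ "Suc (Suc N)"] exI[of _ sz']) (auto simp: sz'_def)
  qed
qed


text \<open>The factor \<open>s\<close> selects the direction in which the derivative is to be small; apply the
  unsigned version to \<open>s * u\<close>.\<close>

lemma Dr_signed_somewhere_small:
  "\<exists>C\<ge>1. \<forall>u a b s. \<bar>s\<bar> \<le> 1 \<and> a + q < b \<longrightarrow>
     (\<exists>x. a < x \<and> x + q \<le> b \<and> s * Dr q u x * halfpow q (real (b - a)) \<le> C * L2_set u {a<..b})"
proof -
  obtain C where C: "C \<ge> 1" and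
    *: "\<And>u a b. a + q < b \<Longrightarrow> \<exists>x. a < x \<and> x + q \<le> b \<and>
           Dr q u x * halfpow q (real (b - a)) \<le> C * L2_set u {a<..b}"
    using Dr_somewhere_small[of q] by blast
  have "\<exists>x. a < x \<and> x + q \<le> b \<and> s * Dr q u x * halfpow q (real (b - a)) \<le> C * L2_set u {a<..b}"
    if s: "\<bar>s\<bar> \<le> 1" and ab: "a + q < b" for u a b s
  proof -
    obtain x where x: "a < x" "x + q \<le> b"
      "s * Dr q u x * halfpow q (real (b - a)) \<le> C * L2_set (\<lambda>i. s * u i) {a<..b}"
      using *[OF ab, of "\<lambda>i. s * u i"] by (auto simp: Dr_scale)
    have "L2_set (\<lambda>i. s * u i) {a<..b} = \<bar>s\<bar> * L2_set u {a<..b}"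
      by (simp add: L2_set_def power_mult_distrib sum_distrib_left[symmetric] real_sqrt_mult)
    also have "\<dots> \<le> L2_set u {a<..b}" using s by (simp add: mult_left_le_one_le)
    finally have "C * L2_set (\<lambda>i. s * u i) {a<..b} \<le> C * L2_set u {a<..b}"
      using C by (intro mult_left_mono) auto
    with x show ?thesis by (meson order_trans)
  qed
  with C show ?thesis by blast
qed

section \<open>Segments on which the derivative has one sign up to a small excess\<close>

text \<open>For \<open>s = 1\<close> or \<open>s = -1\<close> this is twice the variation of \<open>Dr (q - 1) u\<close> on \<open>{a<..b}\<close> in the
  direction opposite to \<open>s\<close>, for \<open>s = 0\<close> it is the total variation.\<close>

definition excess :: "nat \<Rightarrow> real \<Rightarrow> (nat \<Rightarrow> real) \<Rightarrow> nat \<Rightarrow> nat \<Rightarrow> real" where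
  "excess q s u a b = (\<Sum>j\<in>{a<..b - q}. \<bar>Dr q u j\<bar> - s * Dr q u j)"

lemma excess_term_nonneg: "\<bar>s\<bar> \<le> 1 \<Longrightarrow> 0 \<le> \<bar>x\<bar> - s * (x::real)"
proof -
  assume "\<bar>s\<bar> \<le> 1"
  then have "\<bar>s\<bar> * \<bar>x\<bar> \<le> \<bar>x\<bar>" by (simp add: mult_left_le_one_le)
  moreover have "s * x \<le> \<bar>s\<bar> * \<bar>x\<bar>" by (metis abs_ge_self abs_mult)
  ultimately show ?thesis by linarith
qed

lemma excess_nonneg: "\<bar>s\<bar> \<le> 1 \<Longrightarrow> 0 \<le> excess q s u a b"
  unfolding excess_def by (intro sum_nonneg excess_term_nonneg)

text \<open>The sum over a block and its neighbours.  What a block costs is paid for by its neighbourhood;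
  as neighbourhoods overlap at most three times, summing over all blocks loses a constant factor.\<close>

definition nbhd_sum :: "nat \<Rightarrow> (nat \<Rightarrow> real) \<Rightarrow> nat \<Rightarrow> real" where
  "nbhd_sum N X t = (if t = 0 then 0 else X (t - 1)) + X t + (if Suc t < N then X (Suc t) else 0)"

lemma sum_nbhd_sum_le:
  assumes "\<And>t. 0 \<le> X t"
  shows "(\<Sum>t<N. nbhd_sum N X t) \<le> 3 * (\<Sum>t<N. X t)"
proof -
  have "(\<Sum>t<N. if t = 0 then 0 else X (t - 1)) \<le> (\<Sum>t<N. X t)"
  proof (cases N)
    case (Suc m)
    have "(\<Sum>t<Suc m. if t = 0 then 0 else X (t - 1)) = (\<Sum>t<m. X t)"
      by (subst sum.lessThan_Suc_shift) simp
    with Suc assms show ?thesis by simp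
  qed simp
  moreover have "(\<Sum>t<N. if Suc t < N then X (Suc t) else 0) \<le> (\<Sum>t<N. X t)"
  proof (cases N)
    case (Suc m)
    have "(\<Sum>t<Suc m. if Suc t < Suc m then X (Suc t) else 0) = (\<Sum>t<m. X (Suc t))" by simp
    also have "\<dots> \<le> (\<Sum>t<Suc m. X t)" using assms by (subst sum.lessThan_Suc_shift) simp
    finally show ?thesis using Suc by simp
  qed simp
  ultimately show ?thesis by (simp add: nbhd_sum_def sum.distrib)
qed

lemma nbhd_sum_nonneg: "(\<And>t. 0 \<le> X t) \<Longrightarrow> 0 \<le> nbhd_sum N X t"
  by (simp add: nbhd_sum_def)

lemma nbhd_sum_sq_le: "(nbhd_sum N X t)\<^sup>2 \<le> 3 * nbhd_sum N (\<lambda>t. (X t)\<^sup>2) t"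
proof -
  have *: "(x + y + z)\<^sup>2 \<le> 3 * (x\<^sup>2 + y\<^sup>2 + z\<^sup>2)" for x y z :: real
    using zero_le_power2[of "x - y"] zero_le_power2[of "x - z"] zero_le_power2[of "y - z"]
    by (simp add: power2_eq_square algebra_simps)
  show ?thesis unfolding nbhd_sum_def by (rule order_trans[OF *]) auto
qed

lemma young_le:
  fixes x y :: real
  assumes "e > 0"
  shows "x * y \<le> e * x\<^sup>2 + y\<^sup>2 / (4 * e)"
proof -
  have "0 \<le> (2 * e * x - y)\<^sup>2" by simp
  then have "4 * e * (x * y) \<le> 4 * e * (e * x\<^sup>2) + y\<^sup>2"
    by (simp add: power2_eq_square algebra_simps)
  with assms show ?thesis by (simp add: field_simps)
qed

lemma l1_Dr_1_short_le:
  assumes "a < b" "b - a < 4 * r"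
  shows "sqrt (real (b - a)) * l1_Dr 1 u a b \<le> real (16 * r\<^sup>2) * L2_set u {a<..b}"
proof -
  have r: "1 \<le> r" using assms by (cases r) auto
  have "l1_Dr 1 u a b \<le> (\<Sum>j\<in>{a<..b - 1}. 2 * L2_set u {a<..b})"
    unfolding l1_Dr_def
  proof (rule sum_mono)
    fix j assume "j \<in> {a<..b - 1}"
    then show "\<bar>Dr 1 u j\<bar> \<le> 2 * L2_set u {a<..b}"
      using abs_Dr_le[of a j 1 b u] by auto
  qed
  also have "\<dots> = real (b - 1 - a) * (2 * L2_set u {a<..b})" by simp
  also have "\<dots> \<le> real (4 * r) * (2 * L2_set u {a<..b})"
    using assms by (intro mult_right_mono) auto
  finally have 1: "l1_Dr 1 u a b \<le> real (8 * r) * L2_set u {a<..b}" by simp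
  have "real (b - a) \<le> (2 * real r)\<^sup>2"
  proof -
    have "real (b - a) \<le> 4 * real r" using assms by linarith
    also have "\<dots> \<le> 4 * (real r * real r)" using r by (simp add: mult_left_le)
    finally show ?thesis by (simp add: power2_eq_square)
  qed
  then have 2: "sqrt (real (b - a)) \<le> 2 * real r" by (intro real_le_lsqrt) auto
  have "sqrt (real (b - a)) * l1_Dr 1 u a b \<le> (2 * real r) * (real (8 * r) * L2_set u {a<..b})"
    using 1 2 by (intro mult_mono l1_Dr_nonneg) auto
  then show ?thesis by (simp add: power2_eq_square)
qed

text \<open>On a long block with comparable neighbours: in the left neighbour \<open>s * Dr p u\<close> is somewhere
  not too negative and in the right one somewhere not too positive; between two such points the
  variation of \<open>Dr p u\<close> is the excess plus the increment.\<close>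

lemma l1_Dr_le_excess:
  assumes C: "C \<ge> 1" and
    small: "\<And>u a b s. \<bar>s\<bar> \<le> 1 \<Longrightarrow> a + p < b \<Longrightarrow>
     \<exists>x. a < x \<and> x + p \<le> b \<and> s * Dr p u x * halfpow p (real (b - a)) \<le> C * L2_set u {a<..b}"
    and s: "\<bar>s\<bar> \<le> 1"
    and ord: "a0 + p < a1" "a1 < a2" "a2 + p < a3"
    and comp: "a2 - a1 \<le> 4 * (a1 - a0)" "a2 - a1 \<le> 4 * (a3 - a2)"
  shows "halfpow p (real (a2 - a1)) * l1_Dr (Suc p) u a1 a2
    \<le> halfpow p 4 * C * (L2_set u {a0<..a1} + L2_set u {a2<..a3})
       + halfpow p (real (a2 - a1)) * excess (Suc p) s u a0 a3"
proof -
  let ?h = "halfpow p (real (a2 - a1))" and ?D = "Dr (Suc p) u"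
  have h: "?h \<ge> 0" by (rule halfpow_nonneg) simp
  have scale: "s' * Dr p u x * ?h \<le> halfpow p 4 * C * L2_set u {a<..b}"
    if "s' * Dr p u x * halfpow p (real (b - a)) \<le> C * L2_set u {a<..b}" "a2 - a1 \<le> 4 * (b - a)"
    for s' x a b
  proof (cases "s' * Dr p u x \<ge> 0")
    case True
    have "?h \<le> halfpow p (4 * real (b - a))" using that by (intro halfpow_mono) auto
    also have "\<dots> = halfpow p 4 * halfpow p (real (b - a))" by (rule halfpow_mult)
    finally have "s' * Dr p u x * ?h \<le> s' * Dr p u x * (halfpow p 4 * halfpow p (real (b - a)))"
      using True by (intro mult_left_mono)
    also have "\<dots> = halfpow p 4 * (s' * Dr p u x * halfpow p (real (b - a)))" by simp
    also have "\<dots> \<le> halfpow p 4 * (C * L2_set u {a<..b})"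
      using that(1) by (intro mult_left_mono halfpow_nonneg) auto
    finally show ?thesis by simp
  next
    case False
    then have "s' * Dr p u x * ?h \<le> 0" using h mult_nonpos_nonneg[of "s' * Dr p u x" ?h] by simp
    also have "0 \<le> halfpow p 4 * C * L2_set u {a<..b}"
      using C by (intro mult_nonneg_nonneg halfpow_nonneg) auto
    finally show ?thesis .
  qed
  obtain x where x: "a0 < x" "x + p \<le> a1" "- s * Dr p u x * halfpow p (real (a1 - a0)) \<le> C * L2_set u {a0<..a1}"
    using small[of "- s" a0 a1 u] s ord by auto
  obtain y where y: "a2 < y" "y + p \<le> a3" "s * Dr p u y * halfpow p (real (a3 - a2)) \<le> C * L2_set u {a2<..a3}"
    using small[of s a2 a3 u] s ord by auto
  have xy: "x \<le> y" using x y ord by linarith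
  have "l1_Dr (Suc p) u a1 a2 \<le> (\<Sum>j\<in>{x..<y}. \<bar>?D j\<bar>)"
    unfolding l1_Dr_def using x y by (intro sum_mono2) auto
  also have "\<dots> = (\<Sum>j\<in>{x..<y}. \<bar>?D j\<bar> - s * ?D j) + s * (\<Sum>j\<in>{x..<y}. ?D j)"
    by (simp add: sum_subtractf sum_distrib_left)
  also have "(\<Sum>j\<in>{x..<y}. ?D j) = Dr p u y - Dr p u x" by (rule Dr_telescope[OF xy])
  also have "(\<Sum>j\<in>{x..<y}. \<bar>?D j\<bar> - s * ?D j) \<le> excess (Suc p) s u a0 a3"
    unfolding excess_def using x y s by (intro sum_mono2 excess_term_nonneg) auto
  finally have "l1_Dr (Suc p) u a1 a2 \<le> excess (Suc p) s u a0 a3 + s * (Dr p u y - Dr p u x)" by simp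
  then have "?h * l1_Dr (Suc p) u a1 a2 \<le> ?h * (excess (Suc p) s u a0 a3 + s * (Dr p u y - Dr p u x))"
    using h by (intro mult_left_mono)
  also have "\<dots> = ?h * excess (Suc p) s u a0 a3 + (s * Dr p u y * ?h + - s * Dr p u x * ?h)"
    by (simp add: algebra_simps)
  also have "s * Dr p u y * ?h + - s * Dr p u x * ?h
      \<le> halfpow p 4 * C * L2_set u {a2<..a3} + halfpow p 4 * C * L2_set u {a0<..a1}"
    using scale[OF y(3) comp(2)] scale[OF x(3) comp(1)] by linarith
  finally show ?thesis by (simp add: algebra_simps)
qed

lemma log2_le: "x \<ge> 1 \<Longrightarrow> log 2 x \<le> 2 * ln x"
proof -
  assume x: "x \<ge> (1::real)"
  have "ln 2 \<ge> (1/2::real)" using ln_2_less_1 ln2_ge_two_thirds by linarith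
  then have "ln x * 1 \<le> ln x * (2 * ln 2)" using x by (intro mult_left_mono) auto
  then show ?thesis by (simp add: log_def field_simps)
qed

text \<open>The blocks grow geometrically from both ends.  On a block with at least \<open>4 r\<close> points the rescaled
  variation of order \<open>r\<close>, hence also the one of order one, is at most the norm on the neighbouring
  blocks plus the rescaled excess there; on shorter blocks the norm
  suffices.  Block lengths are capped at \<open>2 \<mu>\<close>, so that the rescaling factor is at most a constant
  times the factor \<open>halfpow p \<mu>\<close> with which the excess may be subtracted.
  Beside the logarithm this needs about \<open>(b - a) / \<mu>\<close> blocks of maximal length.\<close>

lemma one_sign_segment_dominated:
  assumes \<alpha>: "\<alpha> > 0" and \<kappa>: "\<kappa> > 0"
  shows "\<exists>\<beta>>0. \<exists>C>0. \<forall>n a b s \<mu>. a < b \<and> b \<le> n \<and> \<bar>s\<bar> \<le> 1 \<and> \<mu> \<ge> 1 \<longrightarrow>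
    block_dominated n (\<alpha> / 2) \<beta> (C * (1 + ln (real (b - a)) + real (b - a) / \<mu>))
      (\<lambda>z u. 2 * (\<Sum>i\<in>{a<..b}. z i * u i) - \<alpha> * (\<Sum>i\<in>{a<..b}. (u i)\<^sup>2)
              - \<kappa> * halfpow p \<mu> * excess (Suc p) s u a b)"
proof -
  define r where "r = Suc p"
  obtain C1 where C1: "C1 \<ge> 1" and
    small: "\<And>u a b s. \<bar>s\<bar> \<le> 1 \<Longrightarrow> a + p < b \<Longrightarrow>
     \<exists>x. a < x \<and> x + p \<le> b \<and> s * Dr p u x * halfpow p (real (b - a)) \<le> C1 * L2_set u {a<..b}"
    using Dr_signed_somewhere_small[of p] by blast
  obtain C2 where C2: "C2 \<ge> 1" and
    gn: "\<And>u a b. a + p < b \<Longrightarrow> sqrt (real (b - a)) * l1_Dr 1 u a b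
       \<le> C2 * L2_set u {a<..b} + halfpow p (real (b - a)) * l1_Dr (Suc p) u a b"
    using l1_Dr_1_le[of p] by blast
  define C4 where "C4 = C2 + halfpow p 4 * C1 + real (16 * r\<^sup>2)"
  define C5 where "C5 = halfpow p 2"
  (* The factors 1/3 and 1/18 absorb the overlap of neighbourhoods: it costs 3 for the excess, and
     3 * 3 for the norm because of the square of a sum of three terms. *)
  define \<beta> where "\<beta> = \<kappa> / (3 * C5)"
  define K where "K = (\<beta> * C4)\<^sup>2 / (4 * (\<alpha> / 18))"
  define C where "C = 4 * (1 + K)"
  have h4: "halfpow p 4 * C1 \<ge> 0" using C1 by (intro mult_nonneg_nonneg halfpow_nonneg) auto
  have C4: "C4 \<ge> 0" "C2 \<le> C4" "real (16 * r\<^sup>2) \<le> C4" "halfpow p 4 * C1 \<le> C4"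
    using h4 C2 by (auto simp: C4_def)
  have C5: "C5 > 0" by (simp add: C5_def halfpow_pos)
  have \<beta>: "\<beta> > 0" using \<kappa> C5 by (simp add: \<beta>_def)
  have K: "K \<ge> 0" using \<alpha> by (simp add: K_def)
  have "block_dominated n (\<alpha> / 2) \<beta> (C * (1 + ln (real (b - a)) + real (b - a) / \<mu>))
      (\<lambda>z u. 2 * (\<Sum>i\<in>{a<..b}. z i * u i) - \<alpha> * (\<Sum>i\<in>{a<..b}. (u i)\<^sup>2)
              - \<kappa> * halfpow p \<mu> * excess (Suc p) s u a b)"
    if ab: "a < b" "b \<le> n" and s: "\<bar>s\<bar> \<le> 1" and \<mu>: "\<mu> \<ge> 1" for n a b s \<mu>
  proof -
    define m where "m = b - a"
    define h where "h = nat \<lfloor>\<mu>\<rfloor>"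
    have h: "1 \<le> h" "real h \<le> \<mu>" "\<mu> \<le> 2 * real h"
    proof -
      have f: "real h = of_int \<lfloor>\<mu>\<rfloor>" "1 \<le> \<lfloor>\<mu>\<rfloor>" using \<mu> unfolding h_def by auto
      then show "1 \<le> h" by linarith
      show "real h \<le> \<mu>" "\<mu> \<le> 2 * real h" unfolding f(1) using f(2) by linarith+
    qed
    have m: "1 \<le> m" using ab by (simp add: m_def)
    obtain N sz where sz: "1 \<le> N" "(\<Sum>t<N. sz t) = m" "\<forall>t<N. 1 \<le> sz t \<and> sz t \<le> 2 * h"
      "sz 0 \<le> 2 * 1" "sz (N - 1) \<le> 2 * 1"
      "\<forall>t. Suc t < N \<longrightarrow> sz t \<le> 4 * sz (Suc t) \<and> sz (Suc t) \<le> 4 * sz t"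
      "real N \<le> 2 + 2 * real m / real h + 2 * log 2 (real m / real 1)"
      using geometric_block_sizes[of 1 h m] h m by auto
    define ps where "ps t = a + (\<Sum>i<t. sz i)" for t
    have ps0: "ps 0 = a" and psN: "ps N = b" using sz(2) ab by (auto simp: ps_def m_def)
    have psS: "ps (Suc t) = ps t + sz t" for t by (simp add: ps_def)
    have ps_mono: "ps t \<le> ps t'" if "t \<le> t'" for t t'
      using that by (auto simp: ps_def intro!: sum_mono2)
    define V where "V u t = L2_set u {ps t<..ps (Suc t)}" for u t
    (* Derivatives of order r that reach beyond b do not belong to the segment. *)
    define g where "g u j = (if j + r \<le> b then \<bar>Dr r u j\<bar> - s * Dr r u j else 0)" for u j
    define A where "A u t = (\<Sum>j\<in>{ps t<..ps (Suc t)}. g u j)" for u t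
    have g0: "g u j \<ge> 0" for u j using excess_term_nonneg[OF s] by (simp add: g_def)
    have A0: "A u t \<ge> 0" for u t by (simp add: A_def g0 sum_nonneg)
    have V0: "V u t \<ge> 0" for u t by (simp add: V_def)
    have concat: "(\<Sum>t<N. \<Sum>j\<in>{ps t<..ps (Suc t)}. f j) = (\<Sum>j\<in>{a<..b}. f j)" for f :: "nat \<Rightarrow> real"
      using sum_consecutive_intervals[of N ps f] ps0 psN psS by simp
    have sumA: "(\<Sum>t<N. A u t) = excess r s u a b" for u
    proof -
      have "(\<Sum>t<N. A u t) = (\<Sum>j\<in>{a<..b}. g u j)" unfolding A_def by (rule concat)
      also have "\<dots> = (\<Sum>j\<in>{a<..b - r}. g u j)"
        by (rule sum.mono_neutral_right) (auto simp: g_def)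
      also have "\<dots> = excess r s u a b"
        unfolding excess_def by (intro sum.cong) (auto simp: g_def)
      finally show ?thesis .
    qed
    have block: "sqrt (real (sz t)) * l1_Dr 1 u (ps t) (ps (Suc t))
        \<le> C4 * nbhd_sum N (V u) t + C5 * halfpow p \<mu> * nbhd_sum N (A u) t" if t: "t < N" for u t
    proof (cases "sz t < 4 * r")
      case True
      have "sqrt (real (sz t)) * l1_Dr 1 u (ps t) (ps (Suc t)) \<le> real (16 * r\<^sup>2) * V u t"
        using l1_Dr_1_short_le[of "ps t" "ps (Suc t)" r u] True sz(3) t
        by (force simp: psS V_def)
      also have "\<dots> \<le> C4 * nbhd_sum N (V u) t"
        using C4(3) V0 by (intro mult_mono C4(1)) (auto simp: nbhd_sum_def)
      finally have "sqrt (real (sz t)) * l1_Dr 1 u (ps t) (ps (Suc t)) \<le> C4 * nbhd_sum N (V u) t" .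
      moreover have "0 \<le> C5 * halfpow p \<mu> * nbhd_sum N (A u) t"
        using C5 \<mu> A0 by (intro mult_nonneg_nonneg nbhd_sum_nonneg halfpow_nonneg) auto
      ultimately show ?thesis by simp
    next
      case False
      (* The two outermost blocks have at most two points, so a long block has both neighbours. *)
      have t0: "t \<noteq> 0"
      proof
        assume "t = 0"
        with sz(4) False show False by (simp add: r_def)
      qed
      have tN: "Suc t < N"
      proof (rule ccontr)
        assume "\<not> Suc t < N"
        then have "t = N - 1" using t by simp
        with sz(5) False show False by (simp add: r_def)
      qed
      obtain t' where t': "t = Suc t'" using t0 by (cases t) auto
      have c1: "sz t \<le> 4 * sz t'" using sz(6) t' t by auto
      have c2: "sz t \<le> 4 * sz (Suc t)" using sz(6) tN by auto
      have big: "p < sz t'" "p < sz (Suc t)" "0 < sz t" "p < sz t" using c1 c2 False by (auto simp: r_def)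
      have ex: "excess r s u (ps t') (ps (Suc (Suc t))) \<le> nbhd_sum N (A u) t"
      proof -
        have "ps (Suc (Suc t)) \<le> b" using ps_mono[of "Suc (Suc t)" N] tN psN by simp
        then have "excess r s u (ps t') (ps (Suc (Suc t))) \<le> (\<Sum>j\<in>{ps t'<..ps (Suc (Suc t)) - r}. g u j)"
          unfolding excess_def by (intro sum_mono) (auto simp: g_def)
        also have "\<dots> \<le> (\<Sum>j\<in>{ps t'<..ps (Suc (Suc t))}. g u j)"
          using g0 by (intro sum_mono2) auto
        also have "\<dots> = (\<Sum>i<3. \<Sum>j\<in>{ps (t' + i)<..ps (Suc (t' + i))}. g u j)"
          using sum_consecutive_intervals[of 3 "\<lambda>i. ps (t' + i)" "g u"] psS t'
          by (simp add: numeral_3_eq_3)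
        also have "\<dots> = nbhd_sum N (A u) t"
          using t' tN by (simp add: numeral_3_eq_3 nbhd_sum_def A_def)
        finally show ?thesis .
      qed
      have hs: "halfpow p (real (sz t)) \<le> C5 * halfpow p \<mu>"
      proof -
        have "real (sz t) \<le> 2 * \<mu>"
        proof -
          have "real (sz t) \<le> real (2 * h)" using sz(3) t by (simp only: of_nat_le_iff)
          with h show ?thesis by simp
        qed
        then have "halfpow p (real (sz t)) \<le> halfpow p (2 * \<mu>)" by (intro halfpow_mono) auto
        then show ?thesis by (simp add: halfpow_mult C5_def)
      qed
      have "halfpow p (real (ps (Suc t) - ps t)) * l1_Dr (Suc p) u (ps t) (ps (Suc t))
          \<le> halfpow p 4 * C1 * (L2_set u {ps t'<..ps t} + L2_set u {ps (Suc t)<..ps (Suc (Suc t))})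
            + halfpow p (real (ps (Suc t) - ps t)) * excess (Suc p) s u (ps t') (ps (Suc (Suc t)))"
        using big c1 c2 t'
        by (intro l1_Dr_le_excess[OF C1 small s]) (auto simp: psS)
      then have "halfpow p (real (sz t)) * l1_Dr (Suc p) u (ps t) (ps (Suc t))
          \<le> halfpow p 4 * C1 * (V u t' + V u (Suc t))
            + halfpow p (real (sz t)) * excess r s u (ps t') (ps (Suc (Suc t)))"
        by (simp add: psS V_def t' r_def)
      also have "halfpow p (real (sz t)) * excess r s u (ps t') (ps (Suc (Suc t)))
          \<le> C5 * halfpow p \<mu> * nbhd_sum N (A u) t"
        using hs ex C5 \<mu> by (intro mult_mono excess_nonneg[OF s] mult_nonneg_nonneg halfpow_nonneg) auto
      finally have 1: "halfpow p (real (sz t)) * l1_Dr (Suc p) u (ps t) (ps (Suc t))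
          \<le> halfpow p 4 * C1 * (V u t' + V u (Suc t)) + C5 * halfpow p \<mu> * nbhd_sum N (A u) t" by simp
      have 2: "sqrt (real (sz t)) * l1_Dr 1 u (ps t) (ps (Suc t))
          \<le> C2 * V u t + halfpow p (real (sz t)) * l1_Dr (Suc p) u (ps t) (ps (Suc t))"
        using gn[of "ps t" "ps (Suc t)" u] big by (simp add: psS V_def)
      have "C2 * V u t \<le> C4 * V u t" using C4 V0 by (intro mult_right_mono) auto
      moreover have "halfpow p 4 * C1 * (V u t' + V u (Suc t)) \<le> C4 * (V u t' + V u (Suc t))"
        using C4 V0 by (intro mult_right_mono) auto
      moreover have "C4 * nbhd_sum N (V u) t = C4 * V u t + C4 * (V u t' + V u (Suc t))"
        using t' tN by (simp add: nbhd_sum_def algebra_simps)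
      ultimately show ?thesis using 1 2 by linarith
    qed
    define xs where "xs = map (\<lambda>t. (ps t, ps (Suc t))) [0..<N]"
    define T where "T = 1 + ln (real m) + real m / \<mu>"
    have T: "0 \<le> T" using m \<mu> by (simp add: T_def)
    have NT: "real N \<le> 4 * T"
    proof -
      have "2 * real m / real h \<le> 4 * (real m / \<mu>)"
      proof -
        have "real m * \<mu> \<le> real m * (2 * real h)" using h by (intro mult_left_mono) auto
        then show ?thesis using h \<mu> by (simp add: field_simps)
      qed
      moreover have "log 2 (real m) \<le> 2 * ln (real m)" using m by (intro log2_le) auto
      moreover have "4 * T = 4 + 4 * ln (real m) + 4 * (real m / \<mu>)" by (simp add: T_def)
      ultimately show ?thesis using sz(7) by simp
    qed
    have CT: "C * T = 4 * T + 4 * T * K" by (simp add: C_def algebra_simps)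
    have "0 \<le> 4 * T * K" using T K by simp
    with NT have len: "real N \<le> C * T" unfolding CT by linarith
    have "real N * K \<le> 4 * T * K" using NT K by (rule mult_right_mono)
    with T have lenK: "real N * K \<le> C * T" unfolding CT by linarith
    have main: "2 * (\<Sum>i\<in>{a<..b}. z i * u i) - \<alpha> * (\<Sum>i\<in>{a<..b}. (u i)\<^sup>2)
              - \<kappa> * halfpow p \<mu> * excess r s u a b
        \<le> real N * K + (\<Sum>x\<leftarrow>xs. block_form (\<alpha> / 2) \<beta> z u x)" for z u
    proof -
      let ?W = "\<Sum>i\<in>{a<..b}. (u i)\<^sup>2" and ?L = "\<lambda>t. sqrt (real (sz t)) * l1_Dr 1 u (ps t) (ps (Suc t))"
      have VW: "(\<Sum>t<N. (V u t)\<^sup>2) = ?W" unfolding V_def L2_set_sq by (rule concat)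
      have "(\<Sum>x\<leftarrow>xs. block_form (\<alpha> / 2) \<beta> z u x) = (\<Sum>t<N. block_form (\<alpha> / 2) \<beta> z u (ps t, ps (Suc t)))"
        by (simp add: xs_def sum_list_distinct_conv_sum_set comp_def atLeast0LessThan)
      also have "\<dots> = 2 * (\<Sum>i\<in>{a<..b}. z i * u i) - \<alpha> / 2 * ?W - \<beta> * (\<Sum>t<N. ?L t)"
      proof -
        have "ps (Suc t) - ps t = sz t" for t by (simp add: psS)
        then have "block_form (\<alpha> / 2) \<beta> z u (ps t, ps (Suc t))
            = 2 * (\<Sum>i\<in>{ps t<..ps (Suc t)}. z i * u i) - \<alpha> / 2 * (\<Sum>i\<in>{ps t<..ps (Suc t)}. (u i)\<^sup>2) - \<beta> * ?L t" for t
          by (simp only: block_form_def split_conv)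
        then show ?thesis by (simp only: sum_subtractf sum_distrib_left[symmetric] concat)
      qed
      finally have eq: "(\<Sum>x\<leftarrow>xs. block_form (\<alpha> / 2) \<beta> z u x)
        = 2 * (\<Sum>i\<in>{a<..b}. z i * u i) - \<alpha> / 2 * ?W - \<beta> * (\<Sum>t<N. ?L t)" .
      have each: "\<beta> * ?L t \<le> \<alpha> / 18 * (3 * nbhd_sum N (\<lambda>t. (V u t)\<^sup>2) t) + K
          + \<kappa> * halfpow p \<mu> * (nbhd_sum N (A u) t / 3)" if "t < N" for t
      proof -
        have "\<beta> * ?L t \<le> \<beta> * (C4 * nbhd_sum N (V u) t + C5 * halfpow p \<mu> * nbhd_sum N (A u) t)"
          using block[OF that] \<beta> by (intro mult_left_mono) auto
        also have "\<dots> = nbhd_sum N (V u) t * (\<beta> * C4) + (\<beta> * C5) * halfpow p \<mu> * nbhd_sum N (A u) t"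
          by (simp add: algebra_simps)
        also have "\<beta> * C5 = \<kappa> / 3" using C5 by (simp add: \<beta>_def)
        also have "nbhd_sum N (V u) t * (\<beta> * C4) \<le> \<alpha> / 18 * (nbhd_sum N (V u) t)\<^sup>2 + K"
          unfolding K_def using \<alpha> by (intro young_le) auto
        also have "\<alpha> / 18 * (nbhd_sum N (V u) t)\<^sup>2 \<le> \<alpha> / 18 * (3 * nbhd_sum N (\<lambda>t. (V u t)\<^sup>2) t)"
          using \<alpha> by (intro mult_left_mono nbhd_sum_sq_le) auto
        finally show ?thesis by simp
      qed
      have "\<beta> * (\<Sum>t<N. ?L t) \<le> (\<Sum>t<N. \<alpha> / 18 * (3 * nbhd_sum N (\<lambda>t. (V u t)\<^sup>2) t) + K
          + \<kappa> * halfpow p \<mu> * (nbhd_sum N (A u) t / 3))"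
        unfolding sum_distrib_left by (intro sum_mono each) auto
      also have "\<dots> = \<alpha> / 6 * (\<Sum>t<N. nbhd_sum N (\<lambda>t. (V u t)\<^sup>2) t) + real N * K
          + \<kappa> * halfpow p \<mu> / 3 * (\<Sum>t<N. nbhd_sum N (A u) t)"
        by (simp add: sum.distrib sum_distrib_left)
      also have "\<alpha> / 6 * (\<Sum>t<N. nbhd_sum N (\<lambda>t. (V u t)\<^sup>2) t) \<le> \<alpha> / 6 * (3 * ?W)"
        using sum_nbhd_sum_le[of "\<lambda>t. (V u t)\<^sup>2" N] VW \<alpha> by (intro mult_left_mono) auto
      also have "\<kappa> * halfpow p \<mu> / 3 * (\<Sum>t<N. nbhd_sum N (A u) t) \<le> \<kappa> * halfpow p \<mu> / 3 * (3 * excess r s u a b)"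
        using sum_nbhd_sum_le[of "A u" N] A0 sumA \<kappa> \<mu>
        by (intro mult_left_mono divide_nonneg_nonneg mult_nonneg_nonneg halfpow_nonneg) auto
      finally have "\<beta> * (\<Sum>t<N. ?L t) \<le> \<alpha> / 2 * ?W + real N * K + \<kappa> * halfpow p \<mu> * excess r s u a b"
        by simp
      moreover have "\<alpha> * ?W = \<alpha> / 2 * ?W + \<alpha> / 2 * ?W" by simp
      ultimately show ?thesis using eq by linarith
    qed
    show ?thesis
      unfolding block_dominated_def
    proof (intro exI[of _ xs] conjI allI)
      show "real (length xs) \<le> C * (1 + ln (real (b - a)) + real (b - a) / \<mu>)"
        using len by (simp add: xs_def m_def T_def)
      show "\<forall>(c, d)\<in>set xs. c < d \<and> d \<le> n"
      proof -
        have "ps t < ps (Suc t) \<and> ps (Suc t) \<le> n" if "t < N" for t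
          using that sz(3) ps_mono[of "Suc t" N] psN ab by (force simp: psS)
        then show ?thesis by (auto simp: xs_def)
      qed
      show "2 * (\<Sum>i\<in>{a<..b}. z i * u i) - \<alpha> * (\<Sum>i\<in>{a<..b}. (u i)\<^sup>2)
              - \<kappa> * halfpow p \<mu> * excess (Suc p) s u a b
        \<le> C * (1 + ln (real (b - a)) + real (b - a) / \<mu>) + (\<Sum>x\<leftarrow>xs. block_form (\<alpha> / 2) \<beta> z u x)" for z u
        using main[of z u] lenK by (simp add: m_def r_def T_def)
    qed
  qed
  moreover have "C > 0" using K by (simp add: C_def)
  ultimately show ?thesis using \<beta> by blast
qed

section \<open>Segments at whose ends the sign changes\<close>

text \<open>The contribution of a segment to the form that defines the cone, in terms of the signs \<open>s\<close> and
  \<open>s'\<close> at its left and right end.\<close>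

definition boundary_form :: "nat \<Rightarrow> real \<Rightarrow> real \<Rightarrow> (nat \<Rightarrow> real) \<Rightarrow> nat \<Rightarrow> nat \<Rightarrow> real" where
  "boundary_form p s s' u a b = l1_Dr (Suc p) u a b + s * Dr p u (a + 1) - s' * Dr p u (b - p)"

text \<open>Between two cut points only the variation remains; outside of them the variation turns into
  excess, as the boundary terms move to the cut points.\<close>

lemma boundary_form_split:
  assumes "a < x" "x \<le> y" "y + p \<le> b"
  shows "boundary_form p s s' u a b =
    (\<Sum>j\<in>{a + 1..<x}. \<bar>Dr (Suc p) u j\<bar> - s * Dr (Suc p) u j) + (\<Sum>j\<in>{x..<y}. \<bar>Dr (Suc p) u j\<bar>)
    + (\<Sum>j\<in>{y..<b - p}. \<bar>Dr (Suc p) u j\<bar> - s' * Dr (Suc p) u j) + s * Dr p u x - s' * Dr p u y"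
proof -
  have "{a<..b - Suc p} = {a + 1..<b - p}" using assms by auto
  then have "l1_Dr (Suc p) u a b = (\<Sum>j\<in>{a + 1..<b - p}. \<bar>Dr (Suc p) u j\<bar>)"
    by (simp add: l1_Dr_def)
  also have "\<dots> = (\<Sum>j\<in>{a + 1..<x}. \<bar>Dr (Suc p) u j\<bar>) + (\<Sum>j\<in>{x..<y}. \<bar>Dr (Suc p) u j\<bar>)
      + (\<Sum>j\<in>{y..<b - p}. \<bar>Dr (Suc p) u j\<bar>)"
    using assms by (simp add: sum.atLeastLessThan_concat)
  finally have l1: "l1_Dr (Suc p) u a b = \<dots>" .
  have t: "(\<Sum>j\<in>{a + 1..<x}. Dr (Suc p) u j) = Dr p u x - Dr p u (a + 1)"
    "(\<Sum>j\<in>{y..<b - p}. Dr (Suc p) u j) = Dr p u (b - p) - Dr p u y"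
    using assms by (auto intro!: Dr_telescope)
  show ?thesis
    unfolding boundary_form_def l1 sum_subtractf sum_distrib_left[symmetric] t
    by (simp add: algebra_simps)
qed

lemma block_dominated_add_const:
  assumes "block_dominated n \<alpha> \<beta> c F" "0 \<le> K"
  shows "block_dominated n \<alpha> \<beta> (c + K) (\<lambda>z u. F z u + K)"
proof -
  have "block_dominated n \<alpha> \<beta> K (\<lambda>z u. K)"
    unfolding block_dominated_def using assms(2) by (intro exI[of _ "[]"]) auto
  from block_dominated_add[OF assms(1) this] show ?thesis .
qed

text \<open>Where the sign changes from \<open>s\<close> to \<open>s'\<close>, the segment is cut at fixed places into a left part
  with sign \<open>s\<close>, a middle part with sign \<open>0\<close> and a right part with sign \<open>s'\<close>.  Choosing \<open>x < y\<close>
  with \<open>s * Dr p u x\<close> not too negative and \<open>s' * Dr p u y\<close> not too positive, once both in the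
  middle part and once one in each outer part, shows that twice the boundary form is at least the sum
  of the three excesses up to an error that the length of the segment makes harmless.\<close>

lemma two_sign_segment_dominated:
  assumes \<alpha>: "\<alpha> > 0" and \<kappa>: "\<kappa> > 0" and c: "c > 0"
  shows "\<exists>\<beta>>0. \<exists>C>0. \<forall>n a b s s' \<mu>. b \<le> n \<and> \<bar>s\<bar> \<le> 1 \<and> \<bar>s'\<bar> \<le> 1 \<and> \<mu> \<ge> 1 \<and>
      a + 8 * Suc p \<le> b \<and> c * \<mu> \<le> real (b - a) \<longrightarrow>
    block_dominated n (\<alpha> / 4) \<beta> (C * (1 + ln (real (b - a)) + real (b - a) / \<mu>))
      (\<lambda>z u. 2 * (\<Sum>i\<in>{a<..b}. z i * u i) - \<alpha> * (\<Sum>i\<in>{a<..b}. (u i)\<^sup>2)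
              - \<kappa> * halfpow p \<mu> * boundary_form p s s' u a b)"
proof -
  obtain C1 where C1: "C1 \<ge> 1" and
    small: "\<And>u a b s. \<bar>s\<bar> \<le> 1 \<Longrightarrow> a + p < b \<Longrightarrow>
     \<exists>x. a < x \<and> x + p \<le> b \<and> s * Dr p u x * halfpow p (real (b - a)) \<le> C1 * L2_set u {a<..b}"
    using Dr_signed_somewhere_small[of p] by blast
  have half: "\<alpha> / 2 > 0" "\<kappa> / 2 > 0" using \<alpha> \<kappa> by simp_all
  obtain \<beta> C where \<beta>: "\<beta> > 0" and C: "C > 0" and
    one: "\<forall>n a b s \<mu>. a < b \<and> b \<le> n \<and> \<bar>s\<bar> \<le> 1 \<and> \<mu> \<ge> 1 \<longrightarrow>
    block_dominated n (\<alpha> / 2 / 2) \<beta> (C * (1 + ln (real (b - a)) + real (b - a) / \<mu>))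
      (\<lambda>z u. 2 * (\<Sum>i\<in>{a<..b}. z i * u i) - \<alpha> / 2 * (\<Sum>i\<in>{a<..b}. (u i)\<^sup>2)
              - \<kappa> / 2 * halfpow p \<mu> * excess (Suc p) s u a b)"
    using one_sign_segment_dominated[OF half, of p] by (elim exE conjE) (rule that)
  define C6 where "C6 = C1 / halfpow p (c / 8)"
  define K where "K = (2 * \<kappa> * C6)\<^sup>2 / (4 * (\<alpha> / 2))"
  have hc: "halfpow p (c / 8) > 0" using c by (intro halfpow_pos) auto
  have C6: "C6 \<ge> 0" using C1 hc by (simp add: C6_def)
  have K: "K \<ge> 0" using \<alpha> by (simp add: K_def)
  have "block_dominated n (\<alpha> / 4) \<beta> ((3 * C + K) * (1 + ln (real (b - a)) + real (b - a) / \<mu>))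
      (\<lambda>z u. 2 * (\<Sum>i\<in>{a<..b}. z i * u i) - \<alpha> * (\<Sum>i\<in>{a<..b}. (u i)\<^sup>2)
              - \<kappa> * halfpow p \<mu> * boundary_form p s s' u a b)"
    if b: "b \<le> n" and s: "\<bar>s\<bar> \<le> 1" "\<bar>s'\<bar> \<le> 1" and \<mu>: "\<mu> \<ge> 1"
      and long: "a + 8 * Suc p \<le> b" "c * \<mu> \<le> real (b - a)" for n a b s s' \<mu>
  proof -
    obtain e r where er: "b - a = 4 * e + r" "r < 4"
      by (rule that[of "(b - a) div 4" "(b - a) mod 4"]) simp_all
    define a1 a2 a3 where "a1 = a + e" and "a2 = a + 2 * e" and "a3 = a + 3 * e"
    have e: "2 * Suc p \<le> e" using er long by simp
    have be: "a + 4 * e \<le> b" using er long by simp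
    have "b - a \<le> 8 * e" using er e by simp
    then have "real (b - a) \<le> real (8 * e)" by (simp only: of_nat_le_iff)
    then have ee: "real (b - a) \<le> 8 * real e" by simp
    have ord: "a < a1" "a1 < a2" "a2 < a3" "a3 < b" "a + p < a1" "a1 + p < a2" "a2 + p < a3" "a3 + p < b"
      using e be by (auto simp: a1_def a2_def a3_def)
    let ?D = "Dr (Suc p)" and ?n = "\<lambda>u. L2_set u {a<..b}" and ?m = "halfpow p \<mu>"
    have m0: "?m > 0" using \<mu> by (intro halfpow_pos) auto
    have err: "\<sigma> * Dr p u x * ?m \<le> C6 * ?n u"
      if "\<sigma> * Dr p u x * halfpow p (real (b' - a')) \<le> C1 * L2_set u {a'<..b'}" "a' + e \<le> b'" "a \<le> a'" "b' \<le> b"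
      for \<sigma> u x a' b'
    proof (cases "\<sigma> * Dr p u x \<ge> 0")
      case True
      have "c / 8 * \<mu> \<le> real (b' - a')" using ee long that by simp
      then have "halfpow p (c / 8) * ?m \<le> halfpow p (real (b' - a'))"
        using c \<mu> unfolding halfpow_mult[symmetric] by (intro halfpow_mono) auto
      then have "\<sigma> * Dr p u x * (halfpow p (c / 8) * ?m) \<le> \<sigma> * Dr p u x * halfpow p (real (b' - a'))"
        using True by (intro mult_left_mono)
      also have "\<dots> \<le> C1 * L2_set u {a'<..b'}" by fact
      also have "\<dots> \<le> C1 * ?n u" using C1 that by (intro mult_left_mono L2_set_mono_set) auto
      finally have "(\<sigma> * Dr p u x * ?m) * halfpow p (c / 8) \<le> C1 * ?n u" by (simp add: mult_ac)
      then show ?thesis using hc by (simp add: C6_def pos_le_divide_eq)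
    next
      case False
      then have "\<sigma> * Dr p u x * ?m \<le> 0" using m0 mult_nonpos_nonneg[of "\<sigma> * Dr p u x" ?m] by simp
      also have "0 \<le> C6 * ?n u" using C6 by simp
      finally show ?thesis .
    qed
    have lower: "?m * (excess (Suc p) s u a a1 + excess (Suc p) 0 u a1 a3 + excess (Suc p) s' u a3 b)
        \<le> 2 * (?m * boundary_form p s s' u a b) + 4 * (C6 * ?n u)" for u
    proof -
      obtain x1 where x1: "a1 < x1" "x1 + p \<le> a2" "- s * Dr p u x1 * halfpow p (real (a2 - a1)) \<le> C1 * L2_set u {a1<..a2}"
        using small[of "- s" a1 a2 u] s ord by auto
      obtain y1 where y1: "a2 < y1" "y1 + p \<le> a3" "s' * Dr p u y1 * halfpow p (real (a3 - a2)) \<le> C1 * L2_set u {a2<..a3}"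
        using small[of "s'" a2 a3 u] s ord by auto
      obtain x2 where x2: "a < x2" "x2 + p \<le> a1" "- s * Dr p u x2 * halfpow p (real (a1 - a)) \<le> C1 * L2_set u {a<..a1}"
        using small[of "- s" a a1 u] s ord by auto
      obtain y2 where y2: "a3 < y2" "y2 + p \<le> b" "s' * Dr p u y2 * halfpow p (real (b - a3)) \<le> C1 * L2_set u {a3<..b}"
        using small[of "s'" a3 b u] s ord by auto
      have errs: "- s * Dr p u x1 * ?m \<le> C6 * ?n u" "s' * Dr p u y1 * ?m \<le> C6 * ?n u"
        "- s * Dr p u x2 * ?m \<le> C6 * ?n u" "s' * Dr p u y2 * ?m \<le> C6 * ?n u"
        using err[OF x1(3)] err[OF y1(3)] err[OF x2(3)] err[OF y2(3)] be
        by (simp_all add: a1_def a2_def a3_def)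
      let ?E = "boundary_form p s s' u a b"
      have "excess (Suc p) s u a a1 \<le> (\<Sum>j\<in>{a + 1..<x1}. \<bar>?D u j\<bar> - s * ?D u j)"
        unfolding excess_def using x1 s by (intro sum_mono2 excess_term_nonneg) auto
      moreover have "excess (Suc p) s' u a3 b \<le> (\<Sum>j\<in>{y1..<b - p}. \<bar>?D u j\<bar> - s' * ?D u j)"
        unfolding excess_def using y1 s by (intro sum_mono2 excess_term_nonneg) auto
      moreover have "0 \<le> (\<Sum>j\<in>{x1..<y1}. \<bar>?D u j\<bar>)" by (simp add: sum_nonneg)
      moreover have "a < x1" "x1 \<le> y1" "y1 + p \<le> b" using x1 y1 ord by linarith+
      moreover note boundary_form_split[OF this, of s s' u]
      ultimately have 1: "excess (Suc p) s u a a1 + excess (Suc p) s' u a3 b + s * Dr p u x1 - s' * Dr p u y1 \<le> ?E"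
        by linarith
      have "excess (Suc p) 0 u a1 a3 \<le> (\<Sum>j\<in>{x2..<y2}. \<bar>?D u j\<bar>)"
        unfolding excess_def using x2 y2 by (auto intro!: sum_mono2)
      moreover have "0 \<le> (\<Sum>j\<in>{a + 1..<x2}. \<bar>?D u j\<bar> - s * ?D u j)"
        "0 \<le> (\<Sum>j\<in>{y2..<b - p}. \<bar>?D u j\<bar> - s' * ?D u j)"
        using s by (intro sum_nonneg excess_term_nonneg; simp)+
      moreover have "a < x2" "x2 \<le> y2" "y2 + p \<le> b" using x2 y2 ord by linarith+
      moreover note boundary_form_split[OF this, of s s' u]
      ultimately have 2: "excess (Suc p) 0 u a1 a3 + s * Dr p u x2 - s' * Dr p u y2 \<le> ?E"
        by linarith
      have "?m * (excess (Suc p) s u a a1 + excess (Suc p) s' u a3 b + s * Dr p u x1 - s' * Dr p u y1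
          + (excess (Suc p) 0 u a1 a3 + s * Dr p u x2 - s' * Dr p u y2)) \<le> ?m * (2 * ?E)"
        using 1 2 m0 by (intro mult_left_mono) auto
      with errs show ?thesis by (simp add: algebra_simps)
    qed
    let ?T = "1 + ln (real (b - a)) + real (b - a) / \<mu>"
    have T: "1 \<le> ?T" using long \<mu> by simp
    have part: "block_dominated n (\<alpha> / 4) \<beta> (C * ?T)
      (\<lambda>z u. 2 * (\<Sum>i\<in>{a'<..b'}. z i * u i) - \<alpha> / 2 * (\<Sum>i\<in>{a'<..b'}. (u i)\<^sup>2)
              - \<kappa> / 2 * halfpow p \<mu> * excess (Suc p) \<sigma> u a' b')"
      if "a' < b'" "a \<le> a'" "b' \<le> b" "\<bar>\<sigma>\<bar> \<le> 1" for a' b' \<sigma>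
    proof (rule block_dominated_weaken)
      show "block_dominated n (\<alpha> / 2 / 2) \<beta> (C * (1 + ln (real (b' - a')) + real (b' - a') / \<mu>))
      (\<lambda>z u. 2 * (\<Sum>i\<in>{a'<..b'}. z i * u i) - \<alpha> / 2 * (\<Sum>i\<in>{a'<..b'}. (u i)\<^sup>2)
              - \<kappa> / 2 * halfpow p \<mu> * excess (Suc p) \<sigma> u a' b')"
        using that b \<mu> by (intro one[rule_format]) auto
      have "ln (real (b' - a')) \<le> ln (real (b - a))" using that by simp
      moreover have "real (b' - a') / \<mu> \<le> real (b - a) / \<mu>" using that \<mu> by (intro divide_right_mono) auto
      ultimately show "C * (1 + ln (real (b' - a')) + real (b' - a') / \<mu>) \<le> C * ?T"
        using C by (intro mult_left_mono) auto
    qed auto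
    have "block_dominated n (\<alpha> / 4) \<beta> (C * ?T + C * ?T + C * ?T + K)
      (\<lambda>z u. (2 * (\<Sum>i\<in>{a<..a1}. z i * u i) - \<alpha> / 2 * (\<Sum>i\<in>{a<..a1}. (u i)\<^sup>2)
              - \<kappa> / 2 * halfpow p \<mu> * excess (Suc p) s u a a1)
           + (2 * (\<Sum>i\<in>{a1<..a3}. z i * u i) - \<alpha> / 2 * (\<Sum>i\<in>{a1<..a3}. (u i)\<^sup>2)
              - \<kappa> / 2 * halfpow p \<mu> * excess (Suc p) 0 u a1 a3)
           + (2 * (\<Sum>i\<in>{a3<..b}. z i * u i) - \<alpha> / 2 * (\<Sum>i\<in>{a3<..b}. (u i)\<^sup>2)
              - \<kappa> / 2 * halfpow p \<mu> * excess (Suc p) s' u a3 b) + K)" (is "block_dominated _ _ _ _ ?F")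
      using ord s K by (intro block_dominated_add_const block_dominated_add part) auto
    then show ?thesis
    proof (rule block_dominated_weaken)
      have "K * 1 \<le> K * ?T" using K T by (intro mult_left_mono)
      then show "C * ?T + C * ?T + C * ?T + K \<le> (3 * C + K) * ?T" by (simp add: distrib_right)
      fix z u
      have cut: "(\<Sum>i\<in>{a<..b}. f i) = (\<Sum>i\<in>{a<..a1}. f i) + (\<Sum>i\<in>{a1<..a3}. f i) + (\<Sum>i\<in>{a3<..b}. f i)"
        for f :: "nat \<Rightarrow> real"
      proof -
        have "{a<..b} = ({a<..a1} \<union> {a1<..a3}) \<union> {a3<..b}" using ord by auto
        also have "sum f \<dots> = sum f ({a<..a1} \<union> {a1<..a3}) + sum f {a3<..b}"
          using ord by (intro sum.union_disjoint) auto
        also have "sum f ({a<..a1} \<union> {a1<..a3}) = sum f {a<..a1} + sum f {a1<..a3}"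
          by (intro sum.union_disjoint) auto
        finally show ?thesis .
      qed
      have "?n u * (2 * \<kappa> * C6) \<le> \<alpha> / 2 * (?n u)\<^sup>2 + K"
        unfolding K_def using \<alpha> by (intro young_le) auto
      then have y: "2 * (\<kappa> * C6 * ?n u) \<le> \<alpha> / 2 * (\<Sum>i\<in>{a<..b}. (u i)\<^sup>2) + K"
        by (simp add: L2_set_sq mult_ac)
      have "\<kappa> / 2 * (?m * (excess (Suc p) s u a a1 + excess (Suc p) 0 u a1 a3 + excess (Suc p) s' u a3 b))
        \<le> \<kappa> / 2 * (2 * (?m * boundary_form p s s' u a b) + 4 * (C6 * ?n u))"
        using lower[of u] \<kappa> by (intro mult_left_mono) auto
      then have l: "\<kappa> / 2 * ?m * excess (Suc p) s u a a1 + \<kappa> / 2 * ?m * excess (Suc p) 0 u a1 a3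
          + \<kappa> / 2 * ?m * excess (Suc p) s' u a3 b
        \<le> \<kappa> * ?m * boundary_form p s s' u a b + 2 * (\<kappa> * C6 * ?n u)"
        by (simp add: algebra_simps)
      have a: "\<alpha> * x = \<alpha> / 2 * x + \<alpha> / 2 * x" for x by simp
      have a': "\<alpha> / 2 * (\<Sum>i\<in>{a<..b}. (u i)\<^sup>2) = \<alpha> / 2 * (\<Sum>i\<in>{a<..a1}. (u i)\<^sup>2)
          + \<alpha> / 2 * (\<Sum>i\<in>{a1<..a3}. (u i)\<^sup>2) + \<alpha> / 2 * (\<Sum>i\<in>{a3<..b}. (u i)\<^sup>2)"
        by (subst cut) (simp only: distrib_left)
      show "2 * (\<Sum>i\<in>{a<..b}. z i * u i) - \<alpha> * (\<Sum>i\<in>{a<..b}. (u i)\<^sup>2)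
              - \<kappa> * halfpow p \<mu> * boundary_form p s s' u a b \<le> ?F z u"
        using y l a[of "\<Sum>i\<in>{a<..b}. (u i)\<^sup>2"] a' cut[of "\<lambda>i. z i * u i"] by linarith
    qed auto
  qed
  moreover have "3 * C + K > 0" using C K by simp
  ultimately show ?thesis using \<beta> by blast
qed

section \<open>The cone of feasible directions\<close>

text \<open>Here \<open>g 1 < \<dots> < g k\<close> are the indices at which \<open>Dr (p + 1)\<close> of a vector does not vanish, \<open>s i\<close> is
  its sign at \<open>g i\<close>, and \<open>g 0 = 0\<close>, \<open>g (k + 1) = n - p\<close>, \<open>s 0 = s (k + 1) = 0\<close> are conventions.
  The form is a lower bound for the change of the total variation in direction \<open>u\<close>.\<close>

definition cone_form :: "nat \<Rightarrow> nat \<Rightarrow> (nat \<Rightarrow> nat) \<Rightarrow> (nat \<Rightarrow> real) \<Rightarrow> (nat \<Rightarrow> real) \<Rightarrow> real" where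
  "cone_form p k g s u =
     (\<Sum>i<Suc k. (\<Sum>j\<in>{g i<..<g (Suc i)}. \<bar>Dr (Suc p) u j\<bar>) + s i * Dr (Suc p) u (g i))"

text \<open>Segment \<open>i\<close> consists of the entries of \<open>u\<close> in
  \<open>{segment_end p g i<..segment_end p g (i + 1)}\<close>.  As \<open>Dr p u j\<close> uses the entries
  \<open>j, \<dots>, j + p\<close>, the last value of \<open>Dr p u\<close> in a segment ends \<open>p\<close> entries later.\<close>

definition segment_end :: "nat \<Rightarrow> (nat \<Rightarrow> nat) \<Rightarrow> nat \<Rightarrow> nat" where
  "segment_end p g i = (if i = 0 then 0 else g i + p)"

text \<open>Summation by parts at the knots.\<close>

lemma cone_form_by_segments:
  assumes "s 0 = 0" "s (Suc k) = 0"
  shows "cone_form p k g s u =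
    (\<Sum>i<Suc k. (\<Sum>j\<in>{g i<..<g (Suc i)}. \<bar>Dr (Suc p) u j\<bar>)
       + s i * Dr p u (g i + 1) - s (Suc i) * Dr p u (g (Suc i)))"
proof -
  have "(\<Sum>i<m. s i * Dr p u (g i + 1) - s (Suc i) * Dr p u (g (Suc i)))
      = (\<Sum>i<m. s i * Dr (Suc p) u (g i)) - s m * Dr p u (g m)" for m
    by (induction m) (simp_all add: assms Dr_Suc right_diff_distrib)
  from this[of "Suc k"] show ?thesis
    using assms by (simp add: cone_form_def sum.distrib sum_subtractf)
qed

lemma excess_le_segment:
  assumes "g i < g (Suc i)" "\<bar>s\<bar> \<le> 1" "g 0 = 0"
  shows "excess (Suc p) s u (segment_end p g i) (segment_end p g (Suc i))
    \<le> (\<Sum>j\<in>{g i<..<g (Suc i)}. \<bar>Dr (Suc p) u j\<bar>) + s * Dr p u (g i + 1) - s * Dr p u (g (Suc i))"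
proof -
  have sub: "{segment_end p g i<..segment_end p g (Suc i) - Suc p} \<subseteq> {g i + 1..<g (Suc i)}"
    using assms(1,3) by (cases "i = 0") (auto simp: segment_end_def)
  have "excess (Suc p) s u (segment_end p g i) (segment_end p g (Suc i))
      \<le> (\<Sum>j\<in>{g i + 1..<g (Suc i)}. \<bar>Dr (Suc p) u j\<bar> - s * Dr (Suc p) u j)"
    unfolding excess_def using assms sub
    by (intro sum_mono2 excess_term_nonneg) auto
  also have "\<dots> = (\<Sum>j\<in>{g i + 1..<g (Suc i)}. \<bar>Dr (Suc p) u j\<bar>) - s * (Dr p u (g (Suc i)) - Dr p u (g i + 1))"
    using assms Dr_telescope[of "g i + 1" "g (Suc i)" p u] by (simp add: sum_subtractf sum_distrib_left[symmetric])
  also have "{g i + 1..<g (Suc i)} = {g i<..<g (Suc i)}" by auto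
  finally show ?thesis by (simp add: algebra_simps)
qed

lemma boundary_form_le_segment:
  assumes "segment_end p g i + p < segment_end p g (Suc i)" "\<bar>s\<bar> \<le> 1" "g 0 = 0"
  shows "boundary_form p s s' u (segment_end p g i) (segment_end p g (Suc i))
    \<le> (\<Sum>j\<in>{g i<..<g (Suc i)}. \<bar>Dr (Suc p) u j\<bar>) + s * Dr p u (g i + 1) - s' * Dr p u (g (Suc i))"
proof -
  let ?D = "Dr (Suc p) u" and ?c = "segment_end p g i"
  have gc: "g i \<le> ?c" "?c < g (Suc i)" using assms by (auto simp: segment_end_def split: if_splits)
  have e: "{?c<..g (Suc i) + p - Suc p} = {?c + 1..<g (Suc i)}" using gc by auto
  have f: "{g i<..<g (Suc i)} = {g i + 1..<g (Suc i)}" by auto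
  have "0 \<le> (\<Sum>j\<in>{g i + 1..<?c + 1}. \<bar>?D j\<bar> - s * ?D j)"
    using assms by (intro sum_nonneg excess_term_nonneg) auto
  also have "\<dots> = (\<Sum>j\<in>{g i + 1..<?c + 1}. \<bar>?D j\<bar>) - s * (Dr p u (?c + 1) - Dr p u (g i + 1))"
    using gc Dr_telescope[of "g i + 1" "?c + 1" p u] by (simp add: sum_subtractf sum_distrib_left[symmetric])
  finally have 1: "0 \<le> (\<Sum>j\<in>{g i + 1..<?c + 1}. \<bar>?D j\<bar>) - s * (Dr p u (?c + 1) - Dr p u (g i + 1))" .
  have "(\<Sum>j\<in>{g i + 1..<?c + 1}. \<bar>?D j\<bar>) + (\<Sum>j\<in>{?c + 1..<g (Suc i)}. \<bar>?D j\<bar>) = (\<Sum>j\<in>{g i + 1..<g (Suc i)}. \<bar>?D j\<bar>)"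
    using gc by (intro sum.atLeastLessThan_concat) auto
  moreover have "boundary_form p s s' u ?c (segment_end p g (Suc i))
    = (\<Sum>j\<in>{?c + 1..<g (Suc i)}. \<bar>?D j\<bar>) + s * Dr p u (?c + 1) - s' * Dr p u (g (Suc i))"
    unfolding boundary_form_def l1_Dr_def using e by (simp add: segment_end_def)
  ultimately show ?thesis using 1 unfolding f by (simp add: algebra_simps)
qed

text \<open>Every segment is treated on its own.  The logarithms of the segment lengths add up to at most
  \<open>(k + 1) ln (n / (k + 1))\<close> by concavity.  The treatment of a change of sign asks for \<open>8 (p + 1)\<close>
  entries in the segment; if \<open>c \<mu>\<close> is too small to guarantee them, then \<open>n\<close> itself is at most a
  multiple of \<open>k + 1\<close> and single entries will do for blocks.\<close>

lemma cone_dominated: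
  assumes \<alpha>: "\<alpha> > 0" and \<kappa>: "\<kappa> > 0" and c: "c > 0"
  shows "\<exists>\<beta>>0. \<exists>C>0. \<forall>n k g s \<mu>. \<mu> = real n / real (k + 1) \<and> \<mu> \<ge> 1 \<and> p < n \<and> g 0 = 0 \<and> g (Suc k) = n - p \<and>
      (\<forall>i\<le>k. g i < g (Suc i)) \<and> (\<forall>i. \<bar>s i\<bar> \<le> 1) \<and> s 0 = 0 \<and> s (Suc k) = 0 \<and>
      (\<forall>i\<le>k. s i \<noteq> s (Suc i) \<longrightarrow> c * \<mu> \<le> real (segment_end p g (Suc i) - segment_end p g i)) \<longrightarrow>
    block_dominated n (\<alpha> / 4) \<beta> (C * (real (k + 1) * (1 + ln \<mu>)))
      (\<lambda>z u. 2 * (\<Sum>i\<in>{1..n}. z i * u i) - \<alpha> * (\<Sum>i\<in>{1..n}. (u i)\<^sup>2)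
              - \<kappa> * halfpow p \<mu> * max 0 (cone_form p k g s u))"
proof -
  obtain \<beta>1 C1 where 1: "\<beta>1 > 0" "C1 > 0" and
    one: "\<forall>n a b s \<mu>. a < b \<and> b \<le> n \<and> \<bar>s\<bar> \<le> 1 \<and> \<mu> \<ge> 1 \<longrightarrow>
    block_dominated n (\<alpha> / 2) \<beta>1 (C1 * (1 + ln (real (b - a)) + real (b - a) / \<mu>))
      (\<lambda>z u. 2 * (\<Sum>i\<in>{a<..b}. z i * u i) - \<alpha> * (\<Sum>i\<in>{a<..b}. (u i)\<^sup>2)
              - \<kappa> * halfpow p \<mu> * excess (Suc p) s u a b)"
    using one_sign_segment_dominated[OF \<alpha> \<kappa>, of p] by (elim exE conjE) (rule that)
  obtain \<beta>2 C2 where 2: "\<beta>2 > 0" "C2 > 0" and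
    two: "\<forall>n a b s s' \<mu>. b \<le> n \<and> \<bar>s\<bar> \<le> 1 \<and> \<bar>s'\<bar> \<le> 1 \<and> \<mu> \<ge> 1 \<and> a + 8 * Suc p \<le> b \<and>
      c * \<mu> \<le> real (b - a) \<longrightarrow>
    block_dominated n (\<alpha> / 4) \<beta>2 (C2 * (1 + ln (real (b - a)) + real (b - a) / \<mu>))
      (\<lambda>z u. 2 * (\<Sum>i\<in>{a<..b}. z i * u i) - \<alpha> * (\<Sum>i\<in>{a<..b}. (u i)\<^sup>2)
              - \<kappa> * halfpow p \<mu> * boundary_form p s s' u a b)"
    using two_sign_segment_dominated[OF \<alpha> \<kappa> c, of p] by (elim exE conjE) (rule that)
  define \<beta> where "\<beta> = min \<beta>1 \<beta>2"
  define C where "C = C1 + C2"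
  define C' where "C' = 2 * C + real (8 * Suc p) / c"
  have C: "C > 0" "C1 \<le> C" "C2 \<le> C" using 1 2 by (auto simp: C_def)
  have "block_dominated n (\<alpha> / 4) \<beta> (C' * (real (k + 1) * (1 + ln \<mu>)))
      (\<lambda>z u. 2 * (\<Sum>i\<in>{1..n}. z i * u i) - \<alpha> * (\<Sum>i\<in>{1..n}. (u i)\<^sup>2)
              - \<kappa> * halfpow p \<mu> * max 0 (cone_form p k g s u))"
    if \<mu>: "\<mu> = real n / real (k + 1)" "\<mu> \<ge> 1" and n: "p < n" and g: "g 0 = 0" "g (Suc k) = n - p"
      "\<forall>i\<le>k. g i < g (Suc i)" and s: "\<forall>i. \<bar>s i\<bar> \<le> 1" "s 0 = 0" "s (Suc k) = 0"
      and len: "\<forall>i\<le>k. s i \<noteq> s (Suc i) \<longrightarrow> c * \<mu> \<le> real (segment_end p g (Suc i) - segment_end p g i)"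
    for n k g s \<mu>
  proof -
    have n\<mu>: "real n = real (k + 1) * \<mu>" using \<mu> by simp
    have l0: "0 \<le> real (k + 1) * (1 + ln \<mu>)" "real (k + 1) \<le> real (k + 1) * (1 + ln \<mu>)"
      using \<mu>(2) by (simp_all add: mult_le_cancel_left1)
    have m0: "\<kappa> * halfpow p \<mu> \<ge> 0" using \<kappa> \<mu>(2) by (intro mult_nonneg_nonneg halfpow_nonneg) auto
    have iv: "{1..n} = {0<..n}" by auto
    show ?thesis
    proof (cases "c * \<mu> < real (8 * Suc p)")
      case True
      define xs where "xs = map (\<lambda>i. (i, Suc i)) [0..<n]"
      have "\<mu> \<le> real (8 * Suc p) / c" using True c by (simp add: field_simps)
      then have "real n \<le> real (k + 1) * (real (8 * Suc p) / c)" unfolding n\<mu> by (intro mult_left_mono) auto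
      also have "\<dots> \<le> (real (k + 1) * (1 + ln \<mu>)) * (real (8 * Suc p) / c)"
        using l0 c by (intro mult_right_mono) auto
      also have "\<dots> \<le> (real (k + 1) * (1 + ln \<mu>)) * C'"
        using l0 C by (intro mult_left_mono) (auto simp: C'_def)
      finally have nC: "real n \<le> C' * (real (k + 1) * (1 + ln \<mu>))" by (simp only: mult.commute)
      have "2 * (\<Sum>i\<in>{1..n}. z i * u i) - \<alpha> * (\<Sum>i\<in>{1..n}. (u i)\<^sup>2)
              - \<kappa> * halfpow p \<mu> * max 0 (cone_form p k g s u)
          \<le> C' * (real (k + 1) * (1 + ln \<mu>)) + (\<Sum>x\<leftarrow>xs. block_form (\<alpha> / 4) \<beta> z u x)" for z u
      proof -
        have single: "block_form (\<alpha> / 4) \<beta> z u (t, Suc t)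
            = 2 * (\<Sum>i\<in>{t<..Suc t}. z i * u i) - \<alpha> / 4 * (\<Sum>i\<in>{t<..Suc t}. (u i)\<^sup>2)" for t
          by (simp add: block_form_def l1_Dr_def)
        have "(\<Sum>x\<leftarrow>xs. block_form (\<alpha> / 4) \<beta> z u x) = (\<Sum>t<n. block_form (\<alpha> / 4) \<beta> z u (t, Suc t))"
          by (simp add: xs_def sum_list_distinct_conv_sum_set comp_def atLeast0LessThan)
        also have "\<dots> = 2 * (\<Sum>i\<in>{0<..n}. z i * u i) - \<alpha> / 4 * (\<Sum>i\<in>{0<..n}. (u i)\<^sup>2)"
          using sum_consecutive_intervals[of n "\<lambda>t. t"]
          by (simp only: single sum_subtractf sum_distrib_left[symmetric] le_add2 lessI less_imp_le_nat)
        finally have "(\<Sum>x\<leftarrow>xs. block_form (\<alpha> / 4) \<beta> z u x)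
          = 2 * (\<Sum>i\<in>{1..n}. z i * u i) - \<alpha> / 4 * (\<Sum>i\<in>{1..n}. (u i)\<^sup>2)" by (simp only: iv)
        moreover have "\<alpha> / 4 * (\<Sum>i\<in>{1..n}. (u i)\<^sup>2) \<le> \<alpha> * (\<Sum>i\<in>{1..n}. (u i)\<^sup>2)"
          using \<alpha> by (intro mult_right_mono sum_nonneg) auto
        moreover have "0 \<le> \<kappa> * halfpow p \<mu> * max 0 (cone_form p k g s u)"
          by (intro mult_nonneg_nonneg[OF m0]) simp
        ultimately show ?thesis using nC by linarith
      qed
      then show ?thesis unfolding block_dominated_def
        using nC by (intro exI[of _ xs]) (auto simp: xs_def)
    next
      case False
      have gk: "g i < g (Suc i)" if "i < Suc k" for i using that g by auto
      have mono: "segment_end p g i < segment_end p g (Suc i)" if "i < Suc k" for i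
        using gk[OF that] by (auto simp: segment_end_def)
      have cn: "segment_end p g (Suc k) = n" using g n by (simp add: segment_end_def)
      have c0: "segment_end p g 0 = 0" by (simp add: segment_end_def)
      have cle: "segment_end p g j \<le> n" if "j \<le> Suc k" for j
        using that
      proof (induction rule: inc_induct)
        case base
        then show ?case using cn by simp
      next
        case (step j)
        then show ?case using mono[of j] by simp
      qed
      define S where "S i u = (\<Sum>j\<in>{g i<..<g (Suc i)}. \<bar>Dr (Suc p) u j\<bar>)
          + s i * Dr p u (g i + 1) - s (Suc i) * Dr p u (g (Suc i))" for i u
      define m where "m i = real (segment_end p g (Suc i) - segment_end p g i)" for i
      have m1: "m i \<ge> 1" if "i < Suc k" for i using mono[OF that] by (simp add: m_def)
      have seg: "block_dominated n (\<alpha> / 4) \<beta> (C * (1 + ln (m i) + m i / \<mu>))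
        (\<lambda>z u. 2 * (\<Sum>j\<in>{segment_end p g i<..segment_end p g (Suc i)}. z j * u j)
            - \<alpha> * (\<Sum>j\<in>{segment_end p g i<..segment_end p g (Suc i)}. (u j)\<^sup>2) - \<kappa> * halfpow p \<mu> * S i u)"
        if i: "i < Suc k" for i
      proof -
        have T: "0 \<le> 1 + ln (m i) + m i / \<mu>" using m1[OF i] \<mu>(2) by simp
        show ?thesis
        proof (cases "s i = s (Suc i)")
          case True
          have "block_dominated n (\<alpha> / 2) \<beta>1 (C1 * (1 + ln (m i) + m i / \<mu>))
            (\<lambda>z u. 2 * (\<Sum>j\<in>{segment_end p g i<..segment_end p g (Suc i)}. z j * u j)
            - \<alpha> * (\<Sum>j\<in>{segment_end p g i<..segment_end p g (Suc i)}. (u j)\<^sup>2)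
            - \<kappa> * halfpow p \<mu> * excess (Suc p) (s i) u (segment_end p g i) (segment_end p g (Suc i)))"
            unfolding m_def using mono[OF i] i s \<mu>(2) cle[of "Suc i"] by (intro one[rule_format]) auto
          then show ?thesis
          proof (rule block_dominated_weaken)
            show "C1 * (1 + ln (m i) + m i / \<mu>) \<le> C * (1 + ln (m i) + m i / \<mu>)"
              using C T by (intro mult_right_mono) auto
            fix z u
            have "\<kappa> * halfpow p \<mu> * excess (Suc p) (s i) u (segment_end p g i) (segment_end p g (Suc i)) \<le> \<kappa> * halfpow p \<mu> * S i u"
              using excess_le_segment[of g i "s i" p u] gk[OF i] g(1) s True m0
              unfolding S_def by (intro mult_left_mono) auto
            then show "2 * (\<Sum>j\<in>{segment_end p g i<..segment_end p g (Suc i)}. z j * u j)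
            - \<alpha> * (\<Sum>j\<in>{segment_end p g i<..segment_end p g (Suc i)}. (u j)\<^sup>2) - \<kappa> * halfpow p \<mu> * S i u
              \<le> 2 * (\<Sum>j\<in>{segment_end p g i<..segment_end p g (Suc i)}. z j * u j)
            - \<alpha> * (\<Sum>j\<in>{segment_end p g i<..segment_end p g (Suc i)}. (u j)\<^sup>2)
            - \<kappa> * halfpow p \<mu> * excess (Suc p) (s i) u (segment_end p g i) (segment_end p g (Suc i))" by linarith
          qed (use \<alpha> in \<open>auto simp: \<beta>_def\<close>)
        next
          case ne: False
          then have "c * \<mu> \<le> m i" using len i by (auto simp: m_def)
          with False have "real (8 * Suc p) \<le> m i" by linarith
          then have long: "segment_end p g i + 8 * Suc p \<le> segment_end p g (Suc i)"
            unfolding m_def of_nat_le_iff using mono[OF i] by linarith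
          have "block_dominated n (\<alpha> / 4) \<beta>2 (C2 * (1 + ln (m i) + m i / \<mu>))
            (\<lambda>z u. 2 * (\<Sum>j\<in>{segment_end p g i<..segment_end p g (Suc i)}. z j * u j)
            - \<alpha> * (\<Sum>j\<in>{segment_end p g i<..segment_end p g (Suc i)}. (u j)\<^sup>2)
            - \<kappa> * halfpow p \<mu> * boundary_form p (s i) (s (Suc i)) u (segment_end p g i) (segment_end p g (Suc i)))"
            unfolding m_def using long i s \<mu>(2) cle[of "Suc i"] \<open>c * \<mu> \<le> m i\<close>
            by (intro two[rule_format]) (auto simp: m_def)
          then show ?thesis
          proof (rule block_dominated_weaken)
            show "C2 * (1 + ln (m i) + m i / \<mu>) \<le> C * (1 + ln (m i) + m i / \<mu>)"
              using C T by (intro mult_right_mono) auto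
            fix z u
            have "\<kappa> * halfpow p \<mu> * boundary_form p (s i) (s (Suc i)) u (segment_end p g i) (segment_end p g (Suc i))
                \<le> \<kappa> * halfpow p \<mu> * S i u"
              using boundary_form_le_segment[of p g i "s i" "s (Suc i)" u] s g(1) long m0
              unfolding S_def by (intro mult_left_mono) auto
            then show "2 * (\<Sum>j\<in>{segment_end p g i<..segment_end p g (Suc i)}. z j * u j)
            - \<alpha> * (\<Sum>j\<in>{segment_end p g i<..segment_end p g (Suc i)}. (u j)\<^sup>2) - \<kappa> * halfpow p \<mu> * S i u
              \<le> 2 * (\<Sum>j\<in>{segment_end p g i<..segment_end p g (Suc i)}. z j * u j)
            - \<alpha> * (\<Sum>j\<in>{segment_end p g i<..segment_end p g (Suc i)}. (u j)\<^sup>2)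
            - \<kappa> * halfpow p \<mu> * boundary_form p (s i) (s (Suc i)) u (segment_end p g i) (segment_end p g (Suc i))" by linarith
          qed (auto simp: \<beta>_def)
        qed
      qed
      have concat: "(\<Sum>i<Suc k. \<Sum>j\<in>{segment_end p g i<..segment_end p g (Suc i)}. f j) = (\<Sum>j\<in>{1..n}. f j)" for f :: "nat \<Rightarrow> real"
        using sum_consecutive_intervals[of "Suc k" "segment_end p g" f] mono unfolding iv cn c0
        by (simp only: less_imp_le_nat)
      have "block_dominated n (\<alpha> / 4) \<beta> (\<Sum>i<Suc k. C * (1 + ln (m i) + m i / \<mu>))
        (\<lambda>z u. \<Sum>i<Suc k. 2 * (\<Sum>j\<in>{segment_end p g i<..segment_end p g (Suc i)}. z j * u j)
            - \<alpha> * (\<Sum>j\<in>{segment_end p g i<..segment_end p g (Suc i)}. (u j)\<^sup>2) - \<kappa> * halfpow p \<mu> * S i u)"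
        by (rule block_dominated_sum) (rule seg)
      then show ?thesis
      proof (rule block_dominated_weaken)
        have "(\<Sum>i<Suc k. m i) = real n"
        proof -
          have "(\<Sum>i<Suc k. m i) = (\<Sum>i<Suc k. \<Sum>j\<in>{segment_end p g i<..segment_end p g (Suc i)}. 1)" by (simp add: m_def)
          also have "\<dots> = real n" using concat[of "\<lambda>_. 1"] by simp
          finally show ?thesis .
        qed
        then have summ: "(\<Sum>i<Suc k. m i / \<mu>) = real (k + 1)"
          using n\<mu> \<mu>(2) by (simp add: sum_divide_distrib[symmetric])
        have "(\<Sum>i<Suc k. 1 + ln (m i) + m i / \<mu>) \<le> (\<Sum>i<Suc k. ln \<mu> + 2 * (m i / \<mu>))"
        proof (rule sum_mono)
          fix i assume "i \<in> {..<Suc k}"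
          then have m: "m i \<ge> 1" by (intro m1) auto
          (* The tangent of the logarithm at \<mu>, the average of the segment lengths. *)
          have "ln (m i / \<mu>) \<le> m i / \<mu> - 1" using m \<mu>(2) by (intro ln_le_minus_one) auto
          then show "1 + ln (m i) + m i / \<mu> \<le> ln \<mu> + 2 * (m i / \<mu>)"
            using m \<mu>(2) by (simp add: ln_div)
        qed
        also have "\<dots> = real (k + 1) * ln \<mu> + 2 * real (k + 1)"
          by (simp only: sum.distrib sum_distrib_left[symmetric] summ sum_constant card_lessThan) simp
        also have "\<dots> \<le> 2 * (real (k + 1) * (1 + ln \<mu>))" using \<mu>(2) by (simp add: algebra_simps)
        finally have "C * (\<Sum>i<Suc k. 1 + ln (m i) + m i / \<mu>) \<le> C * (2 * (real (k + 1) * (1 + ln \<mu>)))"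
          using C by (intro mult_left_mono) auto
        also have "\<dots> = (2 * C) * (real (k + 1) * (1 + ln \<mu>))" by simp
        also have "\<dots> \<le> C' * (real (k + 1) * (1 + ln \<mu>))"
          using l0 c by (intro mult_right_mono) (auto simp: C'_def)
        finally show "(\<Sum>i<Suc k. C * (1 + ln (m i) + m i / \<mu>)) \<le> C' * (real (k + 1) * (1 + ln \<mu>))"
          by (simp only: sum_distrib_left)
        fix z u
        have "(\<Sum>i<Suc k. 2 * (\<Sum>j\<in>{segment_end p g i<..segment_end p g (Suc i)}. z j * u j)
            - \<alpha> * (\<Sum>j\<in>{segment_end p g i<..segment_end p g (Suc i)}. (u j)\<^sup>2) - \<kappa> * halfpow p \<mu> * S i u)
          = 2 * (\<Sum>i\<in>{1..n}. z i * u i) - \<alpha> * (\<Sum>i\<in>{1..n}. (u i)\<^sup>2) - \<kappa> * halfpow p \<mu> * (\<Sum>i<Suc k. S i u)"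
          by (simp only: sum_subtractf sum_distrib_left[symmetric] concat)
        also have "(\<Sum>i<Suc k. S i u) = cone_form p k g s u"
          unfolding S_def using cone_form_by_segments[of s k p g u] s by simp
        finally have eq: "(\<Sum>i<Suc k. 2 * (\<Sum>j\<in>{segment_end p g i<..segment_end p g (Suc i)}. z j * u j)
            - \<alpha> * (\<Sum>j\<in>{segment_end p g i<..segment_end p g (Suc i)}. (u j)\<^sup>2) - \<kappa> * halfpow p \<mu> * S i u)
          = 2 * (\<Sum>i\<in>{1..n}. z i * u i) - \<alpha> * (\<Sum>i\<in>{1..n}. (u i)\<^sup>2) - \<kappa> * halfpow p \<mu> * cone_form p k g s u" .
        have "\<kappa> * halfpow p \<mu> * cone_form p k g s u \<le> \<kappa> * halfpow p \<mu> * max 0 (cone_form p k g s u)"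
          using m0 by (intro mult_left_mono) auto
        then show "2 * (\<Sum>i\<in>{1..n}. z i * u i) - \<alpha> * (\<Sum>i\<in>{1..n}. (u i)\<^sup>2)
              - \<kappa> * halfpow p \<mu> * max 0 (cone_form p k g s u)
          \<le> (\<Sum>i<Suc k. 2 * (\<Sum>j\<in>{segment_end p g i<..segment_end p g (Suc i)}. z j * u j)
            - \<alpha> * (\<Sum>j\<in>{segment_end p g i<..segment_end p g (Suc i)}. (u j)\<^sup>2) - \<kappa> * halfpow p \<mu> * S i u)"
          unfolding eq by linarith
      qed auto
    qed
  qed
  note main = this
  have "C' > 0" using C c by (simp add: C'_def add_pos_nonneg)
  moreover have "\<beta> > 0" using 1 2 by (simp add: \<beta>_def)
  ultimately show ?thesis
    by (intro exI[of _ \<beta>] exI[of _ C'] conjI allI impI; (elim conjE)?) (assumption | rule main; assumption)+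
qed

section \<open>Gaussian noise on a block\<close>

locale std_gaussian_noise = prob_space M for M :: "'a measure" +
  fixes Z :: "nat \<Rightarrow> 'a \<Rightarrow> real" and n :: nat
  assumes indep: "indep_vars (\<lambda>_. borel) Z {1..n}"
    and std: "\<And>i. i \<in> {1..n} \<Longrightarrow> distributed M lborel (Z i) (\<lambda>x. ennreal (std_normal_density x))"
begin

definition partial_sum :: "nat \<Rightarrow> nat \<Rightarrow> 'a \<Rightarrow> real" where
  "partial_sum a j \<omega> = (\<Sum>i\<in>{a<..j}. Z i \<omega>)"

lemma partial_sum_moment_6:
  assumes "a < b" "b \<le> n"
  shows "integrable M (\<lambda>\<omega>. partial_sum a b \<omega> ^ 6)"
    and "expectation (\<lambda>\<omega>. partial_sum a b \<omega> ^ 6) = 15 * real (b - a) ^ 3"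
proof -
  let ?s = "sqrt (real (b - a))"
  have s: "0 < ?s" using assms by simp
  have sub: "{a<..b} \<subseteq> {1..n}" using assms by auto
  have "distributed M lborel (\<lambda>\<omega>. \<Sum>i\<in>{a<..b}. Z i \<omega>)
      (normal_density (\<Sum>i\<in>{a<..b}. 0) (sqrt (\<Sum>i\<in>{a<..b}. 1\<^sup>2)))"
    using assms sub by (intro sum_indep_normal indep_vars_subset[OF indep] std) auto
  then have D: "distributed M lborel (partial_sum a b) (normal_density 0 ?s)"
    by (simp add: partial_sum_def[abs_def])
  have *: "has_bochner_integral lborel (\<lambda>x. normal_density 0 ?s x * x ^ 6) (15 * real (b - a) ^ 3)"
  proof -
    have "fact (2 * 3) / ((2 / ?s\<^sup>2) ^ 3 * fact 3) = 15 * real (b - a) ^ 3"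
      using assms by (simp add: fact_numeral power_divide field_simps)
    then show ?thesis using normal_moment_even[OF s, of 0 3] by simp
  qed
  show "integrable M (\<lambda>\<omega>. partial_sum a b \<omega> ^ 6)"
    using distributed_integrable[OF D, of "\<lambda>x. x ^ 6"] * by (auto intro: integrable.intros)
  show "expectation (\<lambda>\<omega>. partial_sum a b \<omega> ^ 6) = 15 * real (b - a) ^ 3"
    using distributed_integral[OF D, of "\<lambda>x. x ^ 6"] has_bochner_integral_integral_eq[OF *] by simp
qed

end

lemma add_pow6_le: "(x + y) ^ 6 \<le> 3 / 2 * y ^ 6 + 16 ^ 6 * (x::real) ^ 6"
proof (cases "15 * \<bar>x\<bar> \<le> \<bar>y\<bar>")
  case True
  then have "\<bar>x + y\<bar> \<le> 16 / 15 * \<bar>y\<bar>" by linarith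
  then have "\<bar>x + y\<bar> ^ 6 \<le> (16 / 15 * \<bar>y\<bar>) ^ 6" by (intro power_mono) auto
  also have "\<dots> = (16 / 15) ^ 6 * y ^ 6" by (simp only: power_mult_distrib power_even_abs_numeral even_numeral)
  also have "\<dots> \<le> 3 / 2 * y ^ 6" by (intro mult_right_mono) (simp_all add: power_divide)
  finally have "(x + y) ^ 6 \<le> 3 / 2 * y ^ 6" by (simp only: power_even_abs_numeral even_numeral)
  then show ?thesis by (simp add: add_increasing2)
next
  case False
  then have "\<bar>x + y\<bar> \<le> 16 * \<bar>x\<bar>" by linarith
  then have "\<bar>x + y\<bar> ^ 6 \<le> (16 * \<bar>x\<bar>) ^ 6" by (intro power_mono) auto
  also have "\<dots> = 16 ^ 6 * x ^ 6" by (simp only: power_mult_distrib power_even_abs_numeral even_numeral)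
  finally have "(x + y) ^ 6 \<le> 16 ^ 6 * x ^ 6" by (simp only: power_even_abs_numeral even_numeral)
  then show ?thesis by (simp add: add_increasing)
qed

lemma balanced_split:
  fixes a b :: nat
  assumes "a + 2 \<le> b"
  obtains m where "a < m" "m < b" "b - a \<le> 3 * (m - a)" "b - a \<le> 3 * (b - m)"
proof -
  obtain e r where er: "b - a = 2 * e + r" "r < 2"
    by (rule that[of "(b - a) div 2" "(b - a) mod 2"]) simp_all
  show ?thesis by (rule that[of "a + e"]) (use er assms in auto)
qed

lemma balanced_powers_le:
  fixes x y d :: real
  assumes "x + y = d" "d \<le> 3 * x" "d \<le> 3 * y" "0 \<le> d"
  shows "x ^ 3 + y ^ 3 \<le> d ^ 3 / 3" "x\<^sup>2 + y\<^sup>2 \<le> 5 / 9 * d\<^sup>2"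
proof -
  have d: "d = x + y" using assms by simp
  have "0 \<le> (3 * x - d) * (3 * y - d)" using assms by (intro mult_nonneg_nonneg) auto
  then have xy: "2 * d\<^sup>2 \<le> 9 * (x * y)" by (simp add: d power2_eq_square algebra_simps)
  then show "x\<^sup>2 + y\<^sup>2 \<le> 5 / 9 * d\<^sup>2" by (simp add: d power2_eq_square algebra_simps)
  have "d * (2 * d\<^sup>2) \<le> d * (9 * (x * y))" using xy assms by (intro mult_left_mono)
  then show "x ^ 3 + y ^ 3 \<le> d ^ 3 / 3" by (simp add: d power2_eq_square power3_eq_cube algebra_simps)
qed

context std_gaussian_noise
begin

text \<open>Cut the interval in two: a partial sum that ends in the second half is the sum of the whole
  first half plus a partial sum of the second.  The recursion closes because the sum of cubes of the
  two halves is well below the cube of the whole: \<open>K = 30 * 16 ^ 6\<close> solves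
  \<open>K = 3 / 2 * (K / 3) + 15 * 16 ^ 6\<close>.  An integrable majorant stands in for the maximum.\<close>

lemma maximal_moment_6:
  assumes "a < b" "b \<le> n"
  shows "\<exists>G. integrable M G \<and> expectation G \<le> 30 * 16 ^ 6 * real (b - a) ^ 3 \<and>
    (\<forall>\<omega>\<in>space M. \<forall>j\<in>{a..b}. partial_sum a j \<omega> ^ 6 \<le> G \<omega>)"
  using assms
proof (induction "b - a" arbitrary: a b rule: less_induct)
  case less
  show ?case
  proof (cases "b = a + 1")
    case True
    have "partial_sum a j \<omega> ^ 6 \<le> partial_sum a b \<omega> ^ 6" if "j \<in> {a..b}" for j \<omega>
    proof -
      have "j = a \<or> j = b" using that True by auto
      then show ?thesis by (auto simp: partial_sum_def)
    qed
    then show ?thesis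
      using partial_sum_moment_6[OF less.prems] True
      by (intro exI[of _ "\<lambda>\<omega>. partial_sum a b \<omega> ^ 6"]) auto
  next
    case False
    obtain m where m: "a < m" "m < b" "b - a \<le> 3 * (m - a)" "b - a \<le> 3 * (b - m)"
      using balanced_split[of a b] False less.prems by auto
    obtain G1 where G1: "integrable M G1" "expectation G1 \<le> 30 * 16 ^ 6 * real (m - a) ^ 3"
      "\<And>\<omega> j. \<omega> \<in> space M \<Longrightarrow> j \<in> {a..m} \<Longrightarrow> partial_sum a j \<omega> ^ 6 \<le> G1 \<omega>"
    proof -
      have "m - a < b - a" "a < m" "m \<le> n" using m less.prems by linarith+
      from less.hyps[OF this] show ?thesis by (blast intro: that)
    qed
    obtain G2 where G2: "integrable M G2" "expectation G2 \<le> 30 * 16 ^ 6 * real (b - m) ^ 3"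
      "\<And>\<omega> j. \<omega> \<in> space M \<Longrightarrow> j \<in> {m..b} \<Longrightarrow> partial_sum m j \<omega> ^ 6 \<le> G2 \<omega>"
    proof -
      have "b - m < b - a" "m < b" "b \<le> n" using m less.prems by linarith+
      from less.hyps[OF this] show ?thesis by (blast intro: that)
    qed
    have X: "integrable M (\<lambda>\<omega>. partial_sum a m \<omega> ^ 6)"
      "expectation (\<lambda>\<omega>. partial_sum a m \<omega> ^ 6) = 15 * real (m - a) ^ 3"
      using partial_sum_moment_6[of a m] m less.prems by auto
    define G where "G \<omega> = 3 / 2 * (G1 \<omega> + G2 \<omega>) + 16 ^ 6 * partial_sum a m \<omega> ^ 6" for \<omega>
    have pos: "0 \<le> G1 \<omega>" "0 \<le> G2 \<omega>" if "\<omega> \<in> space M" for \<omega>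
      using G1(3)[OF that, of a] G2(3)[OF that, of m] m by (auto simp: partial_sum_def)
    have "partial_sum a j \<omega> ^ 6 \<le> G \<omega>" if "\<omega> \<in> space M" "j \<in> {a..b}" for j \<omega>
    proof (cases "j \<le> m")
      case True
      then have "partial_sum a j \<omega> ^ 6 \<le> G1 \<omega>" using G1(3) that by auto
      moreover have "G1 \<omega> + 0 \<le> 3 / 2 * (G1 \<omega> + G2 \<omega>) + 16 ^ 6 * partial_sum a m \<omega> ^ 6"
        using pos[OF that(1)] by (intro add_mono) auto
      ultimately show ?thesis unfolding G_def by simp
    next
      case False
      then have "{a<..j} = {a<..m} \<union> {m<..j}" using m by auto
      then have "partial_sum a j \<omega> = partial_sum a m \<omega> + partial_sum m j \<omega>"
        unfolding partial_sum_def by (simp only:) (rule sum.union_disjoint, auto)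
      then have "partial_sum a j \<omega> ^ 6 \<le> 3 / 2 * partial_sum m j \<omega> ^ 6 + 16 ^ 6 * partial_sum a m \<omega> ^ 6"
        by (simp only: add_pow6_le)
      also have "3 / 2 * partial_sum m j \<omega> ^ 6 \<le> 3 / 2 * (G1 \<omega> + G2 \<omega>)"
        using G2(3)[of \<omega> j] False that pos[OF that(1)] by auto
      finally show ?thesis unfolding G_def by simp
    qed
    moreover have "integrable M G" unfolding G_def[abs_def] using G1 G2 X by auto
    moreover have "expectation G \<le> 30 * 16 ^ 6 * real (b - a) ^ 3"
    proof -
      have ab: "real (m - a) + real (b - m) = real (b - a)" using m by (simp add: of_nat_diff)
      have cubes: "real (m - a) ^ 3 + real (b - m) ^ 3 \<le> real (b - a) ^ 3 / 3"
        using m by (intro balanced_powers_le[OF ab]) linarith+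
      have "expectation G = 3 / 2 * (expectation G1 + expectation G2) + 16 ^ 6 * (15 * real (m - a) ^ 3)"
        unfolding G_def[abs_def] using G1 G2 X by simp
      also have "\<dots> \<le> 3 / 2 * (30 * 16 ^ 6 * (real (m - a) ^ 3 + real (b - m) ^ 3))
          + 16 ^ 6 * (15 * real (b - a) ^ 3)"
      proof -
        have "real (m - a) ^ 3 \<le> real (b - a) ^ 3" using m by (intro power_mono) auto
        moreover have "expectation G1 + expectation G2 \<le> 30 * 16 ^ 6 * (real (m - a) ^ 3 + real (b - m) ^ 3)"
          using add_mono[OF G1(2) G2(2)] by (simp only: distrib_left)
        ultimately show ?thesis by (intro add_mono mult_left_mono) auto
      qed
      also have "\<dots> \<le> 30 * 16 ^ 6 * real (b - a) ^ 3" using cubes by simp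
      finally show ?thesis .
    qed
    ultimately show ?thesis by blast
  qed
qed

end

lemma l1_Dr_1_eq: "l1_Dr 1 u a b = (\<Sum>j\<in>{a<..<b}. \<bar>u (j + 1) - u j\<bar>)"
proof -
  have "{a<..b - 1} = {a<..<b}" by auto
  then show ?thesis by (simp add: l1_Dr_def Dr_Suc)
qed

lemma abel_summation_le:
  fixes z u :: "nat \<Rightarrow> real"
  assumes "a < b" "\<And>j. j \<in> {a..b} \<Longrightarrow> \<bar>\<Sum>i\<in>{a<..j}. z i\<bar> \<le> w"
  shows "\<bar>\<Sum>i\<in>{a<..b}. z i * u i\<bar> \<le> w * (\<bar>u b\<bar> + l1_Dr 1 u a b)"
proof -
  let ?P = "\<lambda>j. \<Sum>i\<in>{a<..j}. z i"
  have abel: "(\<Sum>i\<in>{a<..a + Suc k}. z i * u i)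
      = ?P (a + Suc k) * u (a + Suc k) - (\<Sum>j\<in>{a<..<a + Suc k}. ?P j * (u (j + 1) - u j))" for k
  proof (induction k)
    case 0
    have "{a<..a + Suc 0} = {a + 1}" "{a<..<a + Suc 0} = {}" by auto
    then show ?case by simp
  next
    case (Suc k)
    have "{a<..a + Suc (Suc k)} = insert (a + Suc (Suc k)) {a<..a + Suc k}"
      "{a<..<a + Suc (Suc k)} = insert (a + Suc k) {a<..<a + Suc k}" by auto
    with Suc show ?case by (simp add: algebra_simps)
  qed
  obtain k where k: "b = a + Suc k" using assms(1) less_iff_Suc_add by auto
  have "\<bar>\<Sum>i\<in>{a<..b}. z i * u i\<bar> \<le> \<bar>?P b * u b\<bar> + \<bar>\<Sum>j\<in>{a<..<b}. ?P j * (u (j + 1) - u j)\<bar>"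
    unfolding k abel by (rule abs_triangle_ineq4)
  also have "\<bar>?P b * u b\<bar> \<le> w * \<bar>u b\<bar>"
    using assms unfolding abs_mult by (intro mult_right_mono) auto
  also have "\<bar>\<Sum>j\<in>{a<..<b}. ?P j * (u (j + 1) - u j)\<bar> \<le> (\<Sum>j\<in>{a<..<b}. \<bar>?P j * (u (j + 1) - u j)\<bar>)"
    by (rule sum_abs)
  also have "\<dots> \<le> (\<Sum>j\<in>{a<..<b}. w * \<bar>u (j + 1) - u j\<bar>)"
    unfolding abs_mult using assms(2) by (intro sum_mono mult_right_mono) auto
  also have "\<dots> = w * l1_Dr 1 u a b" by (simp only: l1_Dr_1_eq sum_distrib_left)
  finally show ?thesis by (simp add: distrib_left)
qed

lemma l1_Dr_1_split:
  assumes "a < m" "m < b"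
  shows "l1_Dr 1 u a m + l1_Dr 1 u m b \<le> l1_Dr 1 u a b"
proof -
  have "l1_Dr 1 u a m + l1_Dr 1 u m b = (\<Sum>j\<in>{a<..<m} \<union> {m<..<b}. \<bar>u (j + 1) - u j\<bar>)"
    unfolding l1_Dr_1_eq by (rule sum.union_disjoint[symmetric]) auto
  also have "\<dots> \<le> l1_Dr 1 u a b" unfolding l1_Dr_1_eq using assms by (intro sum_mono2) auto
  finally show ?thesis .
qed

text \<open>If all partial sums on the block are small against the penalty \<open>\<beta>\<close> on the variation, the
  block behaves as if \<open>u\<close> were constant: by Abel summation the noise acts on the differences of \<open>u\<close>
  through its partial sums.\<close>

lemma tame_block_le:
  fixes z u :: "nat \<Rightarrow> real"
  assumes "a < b" "\<And>j. j \<in> {a..b} \<Longrightarrow> \<bar>\<Sum>i\<in>{a<..j}. z i\<bar> \<le> w" "4 * w \<le> \<beta>" "0 < \<alpha>"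
  shows "2 * (\<Sum>i\<in>{a<..b}. z i * u i) - \<alpha> * (\<Sum>i\<in>{a<..b}. (u i)\<^sup>2) - \<beta> * l1_Dr 1 u a b
    \<le> w\<^sup>2 / (\<alpha> * real (b - a))"
proof -
  let ?s = "sqrt (real (b - a))" and ?n = "L2_set u {a<..b}" and ?l = "l1_Dr 1 u a b"
  have s: "?s > 0" using assms by simp
  have w: "0 \<le> w" using assms(2)[of a] assms(1) by auto
  obtain x where x: "x \<in> {a<..b}" "\<bar>u x\<bar> * ?s \<le> ?n"
    using exists_small_entry[OF assms(1)] by blast
  have "\<bar>u b - u x\<bar> \<le> ?l"
    using Dr_dist_le_l1[of a x 0 b b u] x assms(1) by simp
  moreover have "\<bar>u x\<bar> \<le> ?n / ?s" using x(2) s by (simp add: field_simps)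
  ultimately have "\<bar>u b\<bar> + ?l \<le> ?n / ?s + 2 * ?l" by linarith
  then have "w * (\<bar>u b\<bar> + ?l) \<le> w * (?n / ?s + 2 * ?l)" using w by (intro mult_left_mono)
  then have "2 * (\<Sum>i\<in>{a<..b}. z i * u i) \<le> 2 * (w * (?n / ?s + 2 * ?l))"
    using abel_summation_le[OF assms(1,2), of u] by linarith
  also have "\<dots> = ?n * (2 * w / ?s) + (4 * w) * ?l" by (simp add: algebra_simps)
  also have "(4 * w) * ?l \<le> \<beta> * ?l" using assms(3) by (intro mult_right_mono l1_Dr_nonneg)
  also have "?n * (2 * w / ?s) \<le> \<alpha> * ?n\<^sup>2 + (2 * w / ?s)\<^sup>2 / (4 * \<alpha>)"
    using assms(4) by (rule young_le)
  also have "(2 * w / ?s)\<^sup>2 / (4 * \<alpha>) = w\<^sup>2 / (\<alpha> * real (b - a))"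
    using assms by (simp add: power_divide power_mult_distrib)
  finally show ?thesis by (simp add: L2_set_sq)
qed

lemma third_length_le:
  fixes d x \<alpha> v :: real
  assumes "0 < d" "d \<le> 3 * x" "0 < \<alpha>" "0 \<le> v"
  shows "v / (\<alpha> * x) \<le> 3 * (v / (\<alpha> * d))"
proof -
  have "v / (\<alpha> * (3 * x)) \<le> v / (\<alpha> * d)"
    using assms by (intro divide_left_mono mult_left_mono mult_pos_pos) auto
  then show ?thesis by simp
qed

context std_gaussian_noise
begin

text \<open>A block with a partial sum above the threshold \<open>\<beta> / 4\<close> is cut in two, and so on.  That this
  happens is rare enough, by the sixth moment, for the expected total cost of all the resulting blocks
  to stay bounded when \<open>\<beta>\<close> is of the order of the square root of the length: a cut at \<open>w > \<beta> / 4\<close>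
  costs at most \<open>15 w\<^sup>2 \<le> 15 w\<^sup>2 (4 w / \<beta>) ^ 4\<close>, up to the common factor, and \<open>15 * 4 ^ 4 = 3840\<close>.
  As the squares of the lengths of the two parts add up to at most \<open>5 / 9\<close> of the square, the cost of
  all further cuts is a geometric series with sum \<open>9 / 4 * 3840 = 8640\<close>.\<close>

lemma adaptive_bisection:
  assumes "a < b" "b \<le> n" "0 < \<alpha>" "0 < \<beta>"
  shows "\<exists>Q. integrable M Q \<and>
    expectation Q \<le> 8640 * (30 * 16 ^ 6) * (real (b - a))\<^sup>2 / (\<alpha> * \<beta> ^ 4) \<and>
    (\<forall>\<omega>\<in>space M. 0 \<le> Q \<omega> \<and> (\<forall>u w. (\<forall>j\<in>{a..b}. \<bar>partial_sum a j \<omega>\<bar> \<le> w) \<longrightarrow>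
      2 * (\<Sum>i\<in>{a<..b}. Z i \<omega> * u i) - \<alpha> * (\<Sum>i\<in>{a<..b}. (u i)\<^sup>2) - \<beta> * l1_Dr 1 u a b
        \<le> w\<^sup>2 / (\<alpha> * real (b - a)) + Q \<omega>))"
  using assms(1,2)
proof (induction "b - a" arbitrary: a b rule: less_induct)
  case less
  show ?case
  proof (cases "b = a + 1")
    case True
    have "2 * (\<Sum>i\<in>{a<..b}. Z i \<omega> * u i) - \<alpha> * (\<Sum>i\<in>{a<..b}. (u i)\<^sup>2) - \<beta> * l1_Dr 1 u a b
        \<le> w\<^sup>2 / (\<alpha> * real (b - a))" if w: "\<forall>j\<in>{a..b}. \<bar>partial_sum a j \<omega>\<bar> \<le> w" for u w \<omega>
    proof -
      have iv: "{a<..b} = {b}" "l1_Dr 1 u a b = 0" using True by (auto simp: l1_Dr_def)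
      have "\<bar>partial_sum a b \<omega>\<bar> \<le> w" using w True by auto
      then have "\<bar>Z b \<omega>\<bar> \<le> w" by (simp add: partial_sum_def iv)
      then have "(Z b \<omega>)\<^sup>2 \<le> w\<^sup>2" by (simp add: abs_le_square_iff[symmetric])
      moreover have "u b * (2 * Z b \<omega>) \<le> \<alpha> * (u b)\<^sup>2 + (2 * Z b \<omega>)\<^sup>2 / (4 * \<alpha>)"
        using \<open>0 < \<alpha>\<close> by (rule young_le)
      moreover have "(2 * Z b \<omega>)\<^sup>2 / (4 * \<alpha>) = (Z b \<omega>)\<^sup>2 / \<alpha>" by (simp add: power_mult_distrib)
      moreover have "(Z b \<omega>)\<^sup>2 / \<alpha> \<le> w\<^sup>2 / \<alpha>" using calculation(1) \<open>0 < \<alpha>\<close> by (intro divide_right_mono) auto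
      ultimately show ?thesis unfolding iv using True by (simp add: mult_ac)
    qed
    then show ?thesis using assms by (intro exI[of _ "\<lambda>_. 0"]) auto
  next
    case False
    obtain m where m: "a < m" "m < b" "b - a \<le> 3 * (m - a)" "b - a \<le> 3 * (b - m)"
      using balanced_split[of a b] False less.prems by auto
    have m': "real (b - a) \<le> 3 * real (m - a)" "real (b - a) \<le> 3 * real (b - m)" using m by linarith+
    let ?d = "real (b - a)" and ?K = "8640 * (30 * 16 ^ 6) :: real"
    obtain Q1 where Q1: "integrable M Q1" "expectation Q1 \<le> ?K * (real (m - a))\<^sup>2 / (\<alpha> * \<beta> ^ 4)"
      "\<forall>\<omega>\<in>space M. 0 \<le> Q1 \<omega> \<and> (\<forall>u w. (\<forall>j\<in>{a..m}. \<bar>partial_sum a j \<omega>\<bar> \<le> w) \<longrightarrow>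
      2 * (\<Sum>i\<in>{a<..m}. Z i \<omega> * u i) - \<alpha> * (\<Sum>i\<in>{a<..m}. (u i)\<^sup>2) - \<beta> * l1_Dr 1 u a m
        \<le> w\<^sup>2 / (\<alpha> * real (m - a)) + Q1 \<omega>)"
    proof -
      have "m - a < b - a" "a < m" "m \<le> n" using m less.prems by linarith+
      from less.hyps[OF this] show ?thesis by (elim exE conjE) (rule that)
    qed
    obtain Q2 where Q2: "integrable M Q2" "expectation Q2 \<le> ?K * (real (b - m))\<^sup>2 / (\<alpha> * \<beta> ^ 4)"
      "\<forall>\<omega>\<in>space M. 0 \<le> Q2 \<omega> \<and> (\<forall>u w. (\<forall>j\<in>{m..b}. \<bar>partial_sum m j \<omega>\<bar> \<le> w) \<longrightarrow>
      2 * (\<Sum>i\<in>{m<..b}. Z i \<omega> * u i) - \<alpha> * (\<Sum>i\<in>{m<..b}. (u i)\<^sup>2) - \<beta> * l1_Dr 1 u m b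
        \<le> w\<^sup>2 / (\<alpha> * real (b - m)) + Q2 \<omega>)"
    proof -
      have "b - m < b - a" "m < b" "b \<le> n" using m less.prems by linarith+
      from less.hyps[OF this] show ?thesis by (elim exE conjE) (rule that)
    qed
    obtain G where G: "integrable M G" "expectation G \<le> 30 * 16 ^ 6 * ?d ^ 3"
      "\<And>\<omega> j. \<omega> \<in> space M \<Longrightarrow> j \<in> {a..b} \<Longrightarrow> partial_sum a j \<omega> ^ 6 \<le> G \<omega>"
      using maximal_moment_6[OF less.prems] by blast
    have d: "?d > 0" using less.prems by simp
    have k0: "0 < \<alpha> * ?d * \<beta> ^ 4" using d assms by simp
    define Q where "Q \<omega> = 3840 / (\<alpha> * ?d * \<beta> ^ 4) * G \<omega> + (Q1 \<omega> + Q2 \<omega>)" for \<omega>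
    have G0: "0 \<le> G \<omega>" if "\<omega> \<in> space M" for \<omega> using G(3)[OF that, of a] less.prems by (auto simp: partial_sum_def)
    have Q0: "0 \<le> Q \<omega>" if "\<omega> \<in> space M" for \<omega>
    proof -
      have "0 \<le> 3840 / (\<alpha> * ?d * \<beta> ^ 4)" by (rule divide_nonneg_pos[OF _ k0]) simp
      then show ?thesis
        unfolding Q_def using G0[OF that] Q1(3) Q2(3) that by (intro add_nonneg_nonneg mult_nonneg_nonneg) auto
    qed
    have "2 * (\<Sum>i\<in>{a<..b}. Z i \<omega> * u i) - \<alpha> * (\<Sum>i\<in>{a<..b}. (u i)\<^sup>2) - \<beta> * l1_Dr 1 u a b
        \<le> w\<^sup>2 / (\<alpha> * ?d) + Q \<omega>" (is "?L \<le> _")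
      if \<omega>: "\<omega> \<in> space M" and w: "\<forall>j\<in>{a..b}. \<bar>partial_sum a j \<omega>\<bar> \<le> w" for \<omega> u w
    proof -
      (* The given bound w may be far too large; the majorant G controls the exact maximum. *)
      define v where "v = Max ((\<lambda>j. \<bar>partial_sum a j \<omega>\<bar>) ` {a..b})"
      have v: "\<bar>partial_sum a j \<omega>\<bar> \<le> v" if "j \<in> {a..b}" for j
        unfolding v_def using that by (intro Max_ge) auto
      have "v \<in> (\<lambda>j. \<bar>partial_sum a j \<omega>\<bar>) ` {a..b}"
        unfolding v_def using less.prems by (intro Max_in) auto
      then obtain j where j: "j \<in> {a..b}" "v = \<bar>partial_sum a j \<omega>\<bar>" by auto
      have vw: "v \<le> w" "0 \<le> v" and vG: "v ^ 6 \<le> G \<omega>"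
        using w j G(3)[OF \<omega> j(1)] by (auto simp: power_even_abs_numeral)
      show ?thesis
      proof (cases "4 * v \<le> \<beta>")
        case True
        have "?L \<le> v\<^sup>2 / (\<alpha> * ?d)"
          using v less.prems True assms by (intro tame_block_le) (auto simp: partial_sum_def)
        also have "\<dots> \<le> w\<^sup>2 / (\<alpha> * ?d)" using vw d assms by (intro divide_right_mono power_mono) auto
        finally show ?thesis by (rule add_increasing2[OF Q0[OF \<omega>]])
      next
        case False
        have iv: "{a<..b} = {a<..m} \<union> {m<..b}" using m by auto
        have cut: "sum f {a<..b} = sum f {a<..m} + sum f {m<..b}" for f :: "nat \<Rightarrow> real"
          unfolding iv by (rule sum.union_disjoint) auto
        have b2: "\<forall>j\<in>{m..b}. \<bar>partial_sum m j \<omega>\<bar> \<le> 2 * v"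
        proof
          fix j assume j: "j \<in> {m..b}"
          then have "{a<..j} = {a<..m} \<union> {m<..j}" using m by auto
          then have "partial_sum a j \<omega> = partial_sum a m \<omega> + partial_sum m j \<omega>"
            unfolding partial_sum_def by (simp only:) (rule sum.union_disjoint, auto)
          then show "\<bar>partial_sum m j \<omega>\<bar> \<le> 2 * v" using v[of j] v[of m] j m by auto
        qed
        have b1: "\<forall>j\<in>{a..m}. \<bar>partial_sum a j \<omega>\<bar> \<le> v" using v m by auto
        have "2 * (\<Sum>i\<in>{a<..m}. Z i \<omega> * u i) - \<alpha> * (\<Sum>i\<in>{a<..m}. (u i)\<^sup>2) - \<beta> * l1_Dr 1 u a m
          \<le> v\<^sup>2 / (\<alpha> * real (m - a)) + Q1 \<omega>" using Q1(3) \<omega> b1 by blast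
        moreover have "2 * (\<Sum>i\<in>{m<..b}. Z i \<omega> * u i) - \<alpha> * (\<Sum>i\<in>{m<..b}. (u i)\<^sup>2) - \<beta> * l1_Dr 1 u m b
          \<le> (2 * v)\<^sup>2 / (\<alpha> * real (b - m)) + Q2 \<omega>" using Q2(3) \<omega> b2 by blast
        moreover have "\<beta> * (l1_Dr 1 u a m + l1_Dr 1 u m b) \<le> \<beta> * l1_Dr 1 u a b"
          using l1_Dr_1_split[OF m(1,2)] assms by (intro mult_left_mono) auto
        moreover have "v\<^sup>2 / (\<alpha> * real (m - a)) \<le> 3 * (v\<^sup>2 / (\<alpha> * ?d))"
          using m'(1) d assms(3) by (intro third_length_le) auto
        moreover have "(2 * v)\<^sup>2 / (\<alpha> * real (b - m)) \<le> 12 * (v\<^sup>2 / (\<alpha> * ?d))"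
        proof -
          have "(2 * v)\<^sup>2 / (\<alpha> * real (b - m)) \<le> 3 * ((2 * v)\<^sup>2 / (\<alpha> * ?d))"
            using m'(2) d assms(3) by (intro third_length_le) auto
          then show ?thesis by (simp add: power_mult_distrib)
        qed
        moreover have "15 * (v\<^sup>2 / (\<alpha> * ?d)) \<le> 3840 / (\<alpha> * ?d * \<beta> ^ 4) * G \<omega>"
        proof -
          have "\<beta> ^ 4 \<le> (4 * v) ^ 4" using False assms by (intro power_mono) auto
          then have "v\<^sup>2 * \<beta> ^ 4 \<le> v\<^sup>2 * (4 * v) ^ 4" by (intro mult_left_mono) auto
          also have "\<dots> = 256 * v ^ 6" by (simp add: power_mult_distrib power_add[symmetric])
          also have "\<dots> \<le> 256 * G \<omega>" using vG by simp
          finally have "v\<^sup>2 * \<beta> ^ 4 \<le> 256 * G \<omega>" .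
          then have "15 * (v\<^sup>2 * \<beta> ^ 4) / (\<alpha> * ?d * \<beta> ^ 4) \<le> 15 * (256 * G \<omega>) / (\<alpha> * ?d * \<beta> ^ 4)"
            using k0 by (intro divide_right_mono mult_left_mono less_imp_le[OF k0]) auto
          moreover have "15 * (v\<^sup>2 * \<beta> ^ 4) / (\<alpha> * ?d * \<beta> ^ 4) = 15 * (v\<^sup>2 / (\<alpha> * ?d))"
            using assms by simp
          ultimately show ?thesis by simp
        qed
        moreover have "0 \<le> w\<^sup>2 / (\<alpha> * ?d)" using d assms by simp
        ultimately show ?thesis unfolding Q_def cut by (simp only: distrib_left)
      qed
    qed
    moreover have "integrable M Q" unfolding Q_def[abs_def] using G Q1 Q2 by auto
    moreover have "expectation Q \<le> ?K * ?d\<^sup>2 / (\<alpha> * \<beta> ^ 4)"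
    proof -
      have ab: "real (m - a) + real (b - m) = ?d" using m by (simp add: of_nat_diff)
      have squares: "(real (m - a))\<^sup>2 + (real (b - m))\<^sup>2 \<le> 5 / 9 * ?d\<^sup>2"
        using m' by (intro balanced_powers_le[OF ab]) auto
      have "expectation Q = 3840 / (\<alpha> * ?d * \<beta> ^ 4) * expectation G + (expectation Q1 + expectation Q2)"
        unfolding Q_def[abs_def] using G Q1 Q2 by simp
      also have "3840 / (\<alpha> * ?d * \<beta> ^ 4) * expectation G \<le> 3840 / (\<alpha> * ?d * \<beta> ^ 4) * (30 * 16 ^ 6 * ?d ^ 3)"
        by (rule mult_left_mono[OF G(2) divide_nonneg_pos[OF _ k0]]) simp
      also have "3840 / (\<alpha> * ?d * \<beta> ^ 4) * (30 * 16 ^ 6 * ?d ^ 3) = 4 / 9 * (?K * ?d\<^sup>2 / (\<alpha> * \<beta> ^ 4))"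
        using d by (simp add: power2_eq_square power3_eq_cube)
      also have "expectation Q1 + expectation Q2
          \<le> ?K * ((real (m - a))\<^sup>2 + (real (b - m))\<^sup>2) / (\<alpha> * \<beta> ^ 4)"
        using Q1(2) Q2(2) by (simp add: distrib_left add_divide_distrib)
      also have "\<dots> \<le> ?K * (5 / 9 * ?d\<^sup>2) / (\<alpha> * \<beta> ^ 4)"
        using squares assms by (intro divide_right_mono mult_left_mono) auto
      finally show ?thesis by simp
    qed
    ultimately show ?thesis using Q0 by (intro exI[of _ Q]) blast
  qed
qed

end

definition block_cost :: "real \<Rightarrow> real \<Rightarrow> real" where
  "block_cost \<alpha> \<beta> = (1 + 30 * 16 ^ 6) / \<alpha> + 8640 * (30 * 16 ^ 6) / (\<alpha> * \<beta> ^ 4)"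

context std_gaussian_noise
begin

lemma block_form_majorant:
  assumes "a < b" "b \<le> n" "0 < \<alpha>" "0 < \<beta>"
  shows "\<exists>G. integrable M G \<and> expectation G \<le> block_cost \<alpha> \<beta> \<and>
    (\<forall>\<omega>\<in>space M. \<forall>u. block_form \<alpha> \<beta> (\<lambda>i. Z i \<omega>) u (a, b) \<le> G \<omega>)"
proof -
  let ?d = "real (b - a)"
  have d: "?d > 0" using assms by simp
  define \<beta>' where "\<beta>' = \<beta> * sqrt ?d"
  have \<beta>': "0 < \<beta>'" "\<beta>' ^ 4 = \<beta> ^ 4 * ?d\<^sup>2"
  proof -
    show "0 < \<beta>'" using assms d by (simp add: \<beta>'_def)
    have "sqrt ?d ^ 4 = ((sqrt ?d)\<^sup>2)\<^sup>2" by (simp only: power_mult[symmetric]) simp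
    then show "\<beta>' ^ 4 = \<beta> ^ 4 * ?d\<^sup>2" by (simp add: \<beta>'_def power_mult_distrib)
  qed
  obtain G where G: "integrable M G" "expectation G \<le> 30 * 16 ^ 6 * ?d ^ 3"
    "\<And>\<omega> j. \<omega> \<in> space M \<Longrightarrow> j \<in> {a..b} \<Longrightarrow> partial_sum a j \<omega> ^ 6 \<le> G \<omega>"
    using maximal_moment_6[OF assms(1,2)] by blast
  obtain Q where Q: "integrable M Q" "expectation Q \<le> 8640 * (30 * 16 ^ 6) * ?d\<^sup>2 / (\<alpha> * \<beta>' ^ 4)"
    "\<forall>\<omega>\<in>space M. 0 \<le> Q \<omega> \<and> (\<forall>u w. (\<forall>j\<in>{a..b}. \<bar>partial_sum a j \<omega>\<bar> \<le> w) \<longrightarrow>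
      2 * (\<Sum>i\<in>{a<..b}. Z i \<omega> * u i) - \<alpha> * (\<Sum>i\<in>{a<..b}. (u i)\<^sup>2) - \<beta>' * l1_Dr 1 u a b
        \<le> w\<^sup>2 / (\<alpha> * real (b - a)) + Q \<omega>)"
    using adaptive_bisection[OF assms(1-3) \<beta>'(1)] by blast
  define H where "H \<omega> = (1 + G \<omega> / ?d ^ 3) / \<alpha> + Q \<omega>" for \<omega>
  have "block_form \<alpha> \<beta> (\<lambda>i. Z i \<omega>) u (a, b) \<le> H \<omega>" if \<omega>: "\<omega> \<in> space M" for \<omega> u
  proof -
    define v where "v = Max ((\<lambda>j. \<bar>partial_sum a j \<omega>\<bar>) ` {a..b})"
    have v: "\<forall>j\<in>{a..b}. \<bar>partial_sum a j \<omega>\<bar> \<le> v"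
      unfolding v_def by (intro ballI Max_ge) auto
    have "v \<in> (\<lambda>j. \<bar>partial_sum a j \<omega>\<bar>) ` {a..b}"
      unfolding v_def using assms by (intro Max_in) auto
    then obtain j where j: "j \<in> {a..b}" "v = \<bar>partial_sum a j \<omega>\<bar>" by auto
    have vG: "v ^ 6 \<le> G \<omega>" using j G(3)[OF \<omega> j(1)] by (auto simp: power_even_abs_numeral)
    have cube: "x \<le> 1 + x ^ 3" if "0 \<le> x" for x :: real
    proof (cases "x \<le> 1")
      case False
      then have "x ^ 1 \<le> x ^ 3" by (intro power_increasing) auto
      then show ?thesis by simp
    qed (use that in \<open>simp add: add_increasing2\<close>)
    have "v\<^sup>2 / ?d \<le> 1 + (v\<^sup>2 / ?d) ^ 3" using d by (intro cube) auto
    also have "(v\<^sup>2 / ?d) ^ 3 = v ^ 6 / ?d ^ 3" by (simp add: power_divide power_mult[symmetric])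
    also have "\<dots> \<le> G \<omega> / ?d ^ 3" using vG d by (intro divide_right_mono) auto
    finally have "v\<^sup>2 / ?d / \<alpha> \<le> (1 + G \<omega> / ?d ^ 3) / \<alpha>" using assms by (intro divide_right_mono) auto
    also have "v\<^sup>2 / ?d / \<alpha> = v\<^sup>2 / (\<alpha> * ?d)" by (simp add: mult.commute)
    finally have "v\<^sup>2 / (\<alpha> * ?d) + Q \<omega> \<le> H \<omega>" unfolding H_def by (rule add_right_mono)
    moreover have "block_form \<alpha> \<beta> (\<lambda>i. Z i \<omega>) u (a, b) \<le> v\<^sup>2 / (\<alpha> * ?d) + Q \<omega>"
      using Q(3) \<omega> v by (auto simp: block_form_def \<beta>'_def mult.assoc)
    ultimately show ?thesis by (rule order_trans[rotated])
  qed
  moreover have "integrable M H" unfolding H_def[abs_def] using G Q by auto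
  moreover have "expectation H \<le> block_cost \<alpha> \<beta>"
  proof -
    have "expectation H = (1 + expectation G / ?d ^ 3) / \<alpha> + expectation Q"
      unfolding H_def[abs_def] using G Q by (simp add: prob_space)
    also have "expectation G / ?d ^ 3 \<le> 30 * 16 ^ 6" using G(2) d by (simp add: pos_divide_le_eq)
    then have "(1 + expectation G / ?d ^ 3) / \<alpha> \<le> (1 + 30 * 16 ^ 6) / \<alpha>"
      using assms by (intro divide_right_mono) auto
    also have "expectation Q \<le> 8640 * (30 * 16 ^ 6) / (\<alpha> * \<beta> ^ 4)"
      using Q(2) d unfolding \<beta>'(2) by (simp add: field_simps)
    finally show ?thesis by (simp add: block_cost_def)
  qed
  ultimately show ?thesis by blast
qed

lemma block_dominated_majorant:
  assumes "block_dominated n \<alpha> \<beta> c F" "0 < \<alpha>" "0 < \<beta>"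
  shows "\<exists>G. integrable M G \<and> expectation G \<le> c * (1 + block_cost \<alpha> \<beta>) \<and>
    (\<forall>\<omega>\<in>space M. \<forall>u. F (\<lambda>i. Z i \<omega>) u \<le> G \<omega>)"
proof -
  obtain xs where xs: "real (length xs) \<le> c" "\<forall>(a, b)\<in>set xs. a < b \<and> b \<le> n"
    "\<And>z u. F z u \<le> c + (\<Sum>x\<leftarrow>xs. block_form \<alpha> \<beta> z u x)"
    using assms(1) unfolding block_dominated_def by blast
  have "\<exists>G. integrable M G \<and> expectation G \<le> real (length xs) * block_cost \<alpha> \<beta> \<and>
    (\<forall>\<omega>\<in>space M. \<forall>u. (\<Sum>x\<leftarrow>xs. block_form \<alpha> \<beta> (\<lambda>i. Z i \<omega>) u x) \<le> G \<omega>)"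
    using xs(2)
  proof (induction xs)
    case Nil
    then show ?case by (intro exI[of _ "\<lambda>_. 0"]) auto
  next
    case (Cons x xs)
    obtain a b where x: "x = (a, b)" by force
    obtain G where G: "integrable M G" "expectation G \<le> real (length xs) * block_cost \<alpha> \<beta>"
      "\<forall>\<omega>\<in>space M. \<forall>u. (\<Sum>x\<leftarrow>xs. block_form \<alpha> \<beta> (\<lambda>i. Z i \<omega>) u x) \<le> G \<omega>"
      using Cons by auto
    obtain H where H: "integrable M H" "expectation H \<le> block_cost \<alpha> \<beta>"
      "\<forall>\<omega>\<in>space M. \<forall>u. block_form \<alpha> \<beta> (\<lambda>i. Z i \<omega>) u (a, b) \<le> H \<omega>"
      using block_form_majorant[of a b \<alpha> \<beta>] Cons.prems assms x by auto
    show ?case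
      using G H by (intro exI[of _ "\<lambda>\<omega>. H \<omega> + G \<omega>"]) (auto simp: x distrib_right intro!: add_mono)
  qed
  then obtain G where G: "integrable M G" "expectation G \<le> real (length xs) * block_cost \<alpha> \<beta>"
    "\<forall>\<omega>\<in>space M. \<forall>u. (\<Sum>x\<leftarrow>xs. block_form \<alpha> \<beta> (\<lambda>i. Z i \<omega>) u x) \<le> G \<omega>" by blast
  have "block_cost \<alpha> \<beta> \<ge> 0" using assms by (simp add: block_cost_def)
  then have "real (length xs) * block_cost \<alpha> \<beta> \<le> c * block_cost \<alpha> \<beta>"
    using xs(1) by (intro mult_right_mono)
  then have "expectation (\<lambda>\<omega>. c + G \<omega>) \<le> c * (1 + block_cost \<alpha> \<beta>)"
    using G by (simp add: prob_space distrib_left)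
  moreover have "F (\<lambda>i. Z i \<omega>) u \<le> c + G \<omega>" if "\<omega> \<in> space M" for \<omega> u
  proof -
    have "(\<Sum>x\<leftarrow>xs. block_form \<alpha> \<beta> (\<lambda>i. Z i \<omega>) u x) \<le> G \<omega>" using G(3) that by blast
    with xs(3)[of "\<lambda>i. Z i \<omega>" u] show ?thesis by linarith
  qed
  ultimately show ?thesis using G by (intro exI[of _ "\<lambda>\<omega>. c + G \<omega>"]) auto
qed

end

section \<open>The estimator as a metric projection\<close>

definition tv_ball :: "nat \<Rightarrow> nat \<Rightarrow> real \<Rightarrow> (nat \<Rightarrow> real) set" where
  "tv_ball r n c = {\<theta> \<in> Rn n. l1_norm (n - r) (Dr r \<theta>) \<le> c}"

definition sqdist :: "nat \<Rightarrow> (nat \<Rightarrow> real) \<Rightarrow> (nat \<Rightarrow> real) \<Rightarrow> real" where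
  "sqdist n x y = (\<Sum>i\<in>{1..n}. (x i - y i)\<^sup>2)"

lemma sqdist_L2: "(L2_set (\<lambda>i. x i - y i) {1..n})\<^sup>2 = sqdist n x y"
  by (simp add: sqdist_def L2_set_sq)

lemma continuous_on_coordinate [continuous_intros]:
  "continuous_on S (\<lambda>\<theta> :: nat \<Rightarrow> real. \<theta> i)"
  by (rule continuous_on_subset[OF continuous_on_product_coordinates]) simp

lemma continuous_on_Dr [continuous_intros]: "continuous_on S (\<lambda>\<theta>. Dr r \<theta> j)"
  by (induction r arbitrary: j) (auto simp: Dr_Suc intro!: continuous_intros)

lemma compact_box: "compact (PiE UNIV (\<lambda>i::nat. if i \<in> {1..n} then {l i..h i :: real} else {undefined}))"
proof -
  have "compactin (product_topology (\<lambda>_. euclidean) UNIV)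
      (PiE UNIV (\<lambda>i::nat. if i \<in> {1..n} then {l i..h i :: real} else {undefined}))"
    by (subst compactin_PiE) auto
  then show ?thesis by (simp add: euclidean_product_topology)
qed

lemma Dr_restrict: "1 \<le> j \<Longrightarrow> j \<le> n - r \<Longrightarrow> Dr r (restrict x {1..n}) j = Dr r x j"
  by (rule Dr_cong) auto

lemma l1_norm_Dr_restrict: "l1_norm (n - r) (Dr r (restrict x {1..n})) = l1_norm (n - r) (Dr r x)"
  unfolding l1_norm_def by (rule sum.cong[OF refl], subst Dr_restrict) auto

text \<open>Minimise over the points of the constraint set that are as near as the zero vector; they form a
  compact set in the product topology, where the entries outside of \<open>{1..n}\<close> are all \<open>undefined\<close>.\<close>

lemma ex_nearest_point:
  assumes "0 \<le> c"
  shows "\<exists>x\<in>tv_ball r n c. \<forall>x'\<in>tv_ball r n c. sqdist n y x \<le> sqdist n y x'"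
proof -
  define zero where "zero = restrict (\<lambda>_. 0::real) {1..n}"
  have Dr0: "Dr r (\<lambda>_. 0::real) j = 0" for j by (induction r arbitrary: j) (simp_all add: Dr_Suc)
  have "l1_norm (n - r) (Dr r zero) = 0"
    unfolding zero_def l1_norm_Dr_restrict by (simp add: l1_norm_def Dr0)
  then have zero: "zero \<in> tv_ball r n c"
    using assms by (simp add: tv_ball_def) (simp add: zero_def)
  define R where "R = sqrt (sqdist n y zero)"
  define B where "B = PiE UNIV (\<lambda>i::nat. if i \<in> {1..n} then {y i - R..y i + R} else {undefined})"
  define S where "S = B \<inter> {\<theta>. l1_norm (n - r) (Dr r \<theta>) \<le> c}"
  have inB: "x \<in> B" if x: "x \<in> Rn n" "sqdist n y x \<le> sqdist n y zero" for x
  proof -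
    have "\<bar>y i - x i\<bar> \<le> R" if "i \<in> {1..n}" for i
    proof -
      have "(y i - x i)\<^sup>2 \<le> sqdist n y x" unfolding sqdist_def using that by (intro member_le_sum) auto
      then have "(y i - x i)\<^sup>2 \<le> sqdist n y zero" using x by linarith
      then show ?thesis unfolding R_def by (metis real_sqrt_abs real_sqrt_le_iff)
    qed
    then have "x i \<in> {y i - R..y i + R}" if "i \<in> {1..n}" for i using that by (force simp: abs_le_iff)
    moreover have "x i = undefined" if "i \<notin> {1..n}" for i using x(1) that by (rule PiE_arb)
    ultimately show ?thesis unfolding B_def by (auto simp: PiE_iff)
  qed
  have BR: "x \<in> Rn n" if "x \<in> B" for x
  proof (rule PiE_I)
    fix i assume "i \<notin> {1..n}"
    then show "x i = undefined" using that unfolding B_def by (auto simp: PiE_iff split: if_splits dest!: spec[of _ i])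
  qed simp
  have "closed {\<theta>. l1_norm (n - r) (Dr r \<theta>) \<le> c}"
    unfolding l1_norm_def by (intro closed_Collect_le continuous_intros)
  then have "compact S" unfolding S_def B_def by (intro compact_Int_closed compact_box)
  moreover have "S \<noteq> {}" using zero inB[of zero] by (auto simp: S_def tv_ball_def)
  moreover have "continuous_on S (sqdist n y)" unfolding sqdist_def by (intro continuous_intros)
  ultimately obtain x where x: "x \<in> S" "\<And>x'. x' \<in> S \<Longrightarrow> sqdist n y x \<le> sqdist n y x'"
    using continuous_attains_inf[of S "sqdist n y"] by blast
  have xz: "sqdist n y x \<le> sqdist n y zero" using zero inB[of zero] by (intro x(2)) (auto simp: S_def tv_ball_def)
  have "sqdist n y x \<le> sqdist n y x'" if "x' \<in> tv_ball r n c" for x'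
  proof (cases "sqdist n y x' \<le> sqdist n y zero")
    case True
    then show ?thesis using that inB by (intro x(2)) (auto simp: S_def tv_ball_def)
  qed (use xz in linarith)
  moreover have "x \<in> tv_ball r n c" using x(1) BR by (auto simp: S_def tv_ball_def)
  ultimately show ?thesis by blast
qed

lemma tf_estimator_nearest:
  fixes r n V y
  defines "c \<equiv> V * real n powi (1 - int r)"
  assumes "0 \<le> V"
  shows "tf_estimator r n V y \<in> tv_ball r n c"
    and "x \<in> tv_ball r n c \<Longrightarrow> sqdist n y (tf_estimator r n V y) \<le> sqdist n y x"
proof -
  let ?f = "\<lambda>\<theta>. 1 / 2 * (L2_set (\<lambda>i. y i - \<theta> i) {1..n})\<^sup>2"
  have f: "?f = (\<lambda>\<theta>. 1 / 2 * sqdist n y \<theta>)" by (simp only: sqdist_L2)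
  have "0 \<le> c" using assms by (simp add: c_def)
  then obtain x0 where x0: "x0 \<in> tv_ball r n c" "\<And>x. x \<in> tv_ball r n c \<Longrightarrow> sqdist n y x0 \<le> sqdist n y x"
    using ex_nearest_point by blast
  then have "is_arg_min ?f (\<lambda>x. x \<in> tv_ball r n c) x0"
    unfolding f by (auto simp: is_arg_min_def not_less)
  then have "is_arg_min ?f (\<lambda>x. x \<in> tv_ball r n c) (arg_min ?f (\<lambda>x. x \<in> tv_ball r n c))"
    unfolding arg_min_def by (rule someI[of "is_arg_min ?f (\<lambda>x. x \<in> tv_ball r n c)"])
  moreover have "tf_estimator r n V y = arg_min ?f (\<lambda>x. x \<in> tv_ball r n c)"
    by (simp add: tf_estimator_def arg_min_on_def tv_ball_def c_def)
  ultimately have "is_arg_min ?f (\<lambda>x. x \<in> tv_ball r n c) (tf_estimator r n V y)" by simp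
  then show "tf_estimator r n V y \<in> tv_ball r n c"
    and "x \<in> tv_ball r n c \<Longrightarrow> sqdist n y (tf_estimator r n V y) \<le> sqdist n y x"
    unfolding f by (auto simp: is_arg_min_def not_less)
qed

lemma tv_ball_convex:
  assumes "x \<in> tv_ball r n c" "x' \<in> tv_ball r n c" "0 \<le> t" "t \<le> 1"
  shows "restrict (\<lambda>i. (1 - t) * x i + t * x' i) {1..n} \<in> tv_ball r n c"
proof -
  have "l1_norm (n - r) (Dr r (\<lambda>i. (1 - t) * x i + t * x' i))
      \<le> (1 - t) * l1_norm (n - r) (Dr r x) + t * l1_norm (n - r) (Dr r x')"
    unfolding l1_norm_def sum_distrib_left sum.distrib[symmetric]
  proof (rule sum_mono)
    fix j
    have "\<bar>Dr r (\<lambda>i. (1 - t) * x i + t * x' i) j\<bar> \<le> \<bar>(1 - t) * Dr r x j\<bar> + \<bar>t * Dr r x' j\<bar>"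
      unfolding Dr_add Dr_scale by (rule abs_triangle_ineq)
    then show "\<bar>Dr r (\<lambda>i. (1 - t) * x i + t * x' i) j\<bar> \<le> (1 - t) * \<bar>Dr r x j\<bar> + t * \<bar>Dr r x' j\<bar>"
      using assms by (simp add: abs_mult)
  qed
  also have "\<dots> \<le> (1 - t) * c + t * c"
    using assms by (intro add_mono mult_left_mono) (auto simp: tv_ball_def)
  also have "\<dots> = c" by (simp add: algebra_simps)
  finally show ?thesis unfolding tv_ball_def mem_Collect_eq l1_norm_Dr_restrict by simp
qed

text \<open>The variational inequality of the projection onto a convex set, written out for an
  estimator and an arbitrary point \<open>x\<close> of the set.  This form keeps the constant one in front
  of \<open>sqdist n x \<theta>\<close>.\<close>

lemma oracle_inequality:
  fixes V y \<theta>
  assumes V: "0 \<le> V" and x: "x \<in> tv_ball r n (V * real n powi (1 - int r))"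
  defines "e \<equiv> tf_estimator r n V y"
  shows "sqdist n e \<theta> \<le> sqdist n x \<theta>
    + (2 * (\<Sum>i\<in>{1..n}. (y i - \<theta> i) * (e i - x i)) - (\<Sum>i\<in>{1..n}. (e i - x i)\<^sup>2))"
proof -
  note near = tf_estimator_nearest[OF V, where r = r and n = n and y = y, folded e_def]
  define b where "b = (\<Sum>i\<in>{1..n}. (y i - e i) * (e i - x i))"
  define q where "q = (\<Sum>i\<in>{1..n}. (e i - x i)\<^sup>2)"
  have q: "0 \<le> q" by (simp add: q_def sum_nonneg)
  have quad: "0 \<le> 2 * b + t * q" if t: "0 < t" "t \<le> 1" for t
  proof -
    have "sqdist n y e \<le> sqdist n y (restrict (\<lambda>i. (1 - t) * e i + t * x i) {1..n})"
      using near(1) x t by (intro near(2) tv_ball_convex) auto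
    also have "\<dots> = sqdist n y e + (\<Sum>i\<in>{1..n}. 2 * t * ((y i - e i) * (e i - x i)) + t * (t * (e i - x i)\<^sup>2))"
      unfolding sqdist_def sum.distrib[symmetric]
      by (intro sum.cong) (simp_all add: power2_eq_square algebra_simps)
    also have "\<dots> = sqdist n y e + t * (2 * b + t * q)"
      unfolding b_def q_def by (simp add: sum.distrib sum_distrib_left[symmetric] distrib_left)
    finally have "0 \<le> t * (2 * b + t * q)" by simp
    then show ?thesis using t by (simp add: zero_le_mult_iff)
  qed
  have b: "0 \<le> b"
  proof (rule ccontr)
    assume "\<not> 0 \<le> b"
    then have b: "b < 0" by simp
    (* A step so short that the quadratic term cannot outweigh the linear one. *)
    define t where "t = min 1 (- b / (q + 1))"
    have t: "0 < t" "t \<le> 1" using b q by (auto simp: t_def divide_neg_pos)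
    have "t * q \<le> (- b / (q + 1)) * q" using q by (intro mult_right_mono) (auto simp: t_def)
    also have "\<dots> \<le> - b" using b q by (simp add: field_simps)
    finally show False using quad[OF t] b by linarith
  qed
  have "sqdist n x \<theta> + (2 * (\<Sum>i\<in>{1..n}. (y i - \<theta> i) * (e i - x i)) - q) - sqdist n e \<theta> = 2 * b"
    unfolding sqdist_def q_def b_def sum_distrib_left sum_subtractf[symmetric] sum.distrib[symmetric]
    by (intro sum.cong) (simp_all add: power2_eq_square algebra_simps)
  with b show ?thesis by (simp add: q_def)
qed

section \<open>Iterated summation\<close>

definition cumsum :: "(nat \<Rightarrow> real) \<Rightarrow> nat \<Rightarrow> real" where
  "cumsum x i = (\<Sum>j<i. x j)"

lemma diff_op_cumsum: "diff_op (cumsum x) = x"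
  by (simp add: diff_op_def cumsum_def fun_eq_iff)

lemma Dr_cumsum: "Dr r ((cumsum ^^ r) x) = x"
  by (induction r) (simp_all add: Dr_Suc_right diff_op_cumsum)

text \<open>Each of \<open>r\<close> summations from zero initial data multiplies the bound by at most \<open>n\<close>, except for the
  first one, which turns the \<open>l1\<close> norm into a bound on the entries.\<close>

lemma ex_bounded_primitive:
  assumes "1 \<le> r"
  shows "\<exists>w. (\<forall>j. 1 \<le> j \<and> j \<le> n - r \<longrightarrow> Dr r w j = Dr r \<theta> j) \<and>
    (\<forall>i\<in>{1..n}. \<bar>w i\<bar> \<le> TV r n \<theta>)"
proof -
  define x where "x j = (if 1 \<le> j \<and> j \<le> n - r then Dr r \<theta> j else 0)" for j
  let ?L = "l1_norm (n - r) (Dr r \<theta>)"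
  have bound: "\<bar>(cumsum ^^ Suc q) x i\<bar> \<le> real n ^ q * ?L" if "i \<le> n" for q i
    using that
  proof (induction q arbitrary: i)
    case 0
    have "\<bar>cumsum x i\<bar> \<le> (\<Sum>j<i. \<bar>x j\<bar>)" unfolding cumsum_def by (rule sum_abs)
    also have "\<dots> \<le> (\<Sum>j\<in>{..<i} \<union> {1..n - r}. \<bar>x j\<bar>)" by (intro sum_mono2) auto
    also have "\<dots> = (\<Sum>j\<in>{1..n - r}. \<bar>x j\<bar>)" by (rule sum.mono_neutral_right) (auto simp: x_def)
    also have "\<dots> = ?L" unfolding l1_norm_def by (intro sum.cong) (auto simp: x_def)
    finally show ?case by simp
  next
    case (Suc q)
    have "\<bar>(cumsum ^^ Suc (Suc q)) x i\<bar> = \<bar>\<Sum>j<i. (cumsum ^^ Suc q) x j\<bar>" by (simp add: cumsum_def)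
    also have "\<dots> \<le> (\<Sum>j<i. \<bar>(cumsum ^^ Suc q) x j\<bar>)" by (rule sum_abs)
    also have "\<dots> \<le> (\<Sum>j<i. real n ^ q * ?L)" using Suc.prems by (intro sum_mono Suc.IH) auto
    also have "\<dots> = real i * (real n ^ q * ?L)" by simp
    also have "\<dots> \<le> real n * (real n ^ q * ?L)"
      using Suc.prems by (intro mult_right_mono) (auto simp: l1_norm_def sum_nonneg)
    finally show ?case by (simp add: mult.assoc)
  qed
  obtain p where p: "r = Suc p" using assms by (cases r) auto
  have "Dr r ((cumsum ^^ r) x) j = Dr r \<theta> j" if "1 \<le> j" "j \<le> n - r" for j
    using that by (simp add: Dr_cumsum x_def)
  moreover have "\<bar>(cumsum ^^ r) x i\<bar> \<le> TV r n \<theta>" if "i \<in> {1..n}" for i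
    using bound[of i p] that unfolding p TV_def by simp
  ultimately show ?thesis by blast
qed

section \<open>Knots and the cone at a given vector\<close>

text \<open>The index at which the derivative of order \<open>r\<close> does not vanish is one less than the knot.\<close>

definition knot_pos :: "nat \<Rightarrow> nat \<Rightarrow> (nat \<Rightarrow> real) \<Rightarrow> nat \<Rightarrow> nat" where
  "knot_pos r n \<theta> i =
     (if i = 0 then 0 else if i \<le> card (knots r n \<theta>) then knot r n \<theta> i - 1 else n - (r - 1))"

lemma finite_knots: "finite (knots r n \<theta>)"
  by (rule finite_subset[of _ "{..n - r + 1}"]) (auto simp: knots_def)

lemma knot_in_knots:
  assumes "1 \<le> i" "i \<le> card (knots r n \<theta>)"
  shows "knot r n \<theta> i \<in> knots r n \<theta>"
proof -
  have "sorted_list_of_set (knots r n \<theta>) ! (i - 1) \<in> set (sorted_list_of_set (knots r n \<theta>))"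
    using assms by (intro nth_mem) simp
  then show ?thesis by (simp add: knot_def finite_knots)
qed

lemma knot_less:
  assumes "1 \<le> i" "i < j" "j \<le> card (knots r n \<theta>)"
  shows "knot r n \<theta> i < knot r n \<theta> j"
  unfolding knot_def
  using sorted_wrt_nth_less[OF strict_sorted_list_of_set[of "knots r n \<theta>"], of "i - 1" "j - 1"] assms
  by simp

lemma ex_knot:
  assumes "j \<in> knots r n \<theta>"
  shows "\<exists>i. 1 \<le> i \<and> i \<le> card (knots r n \<theta>) \<and> knot r n \<theta> i = j"
proof -
  have "j \<in> set (sorted_list_of_set (knots r n \<theta>))" using assms by (simp add: finite_knots)
  then obtain i where "i < card (knots r n \<theta>)" "sorted_list_of_set (knots r n \<theta>) ! i = j"
    by (auto simp: in_set_conv_nth)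
  then show ?thesis by (intro exI[of _ "Suc i"]) (auto simp: knot_def)
qed

context
  fixes r n p :: nat and \<theta> :: "nat \<Rightarrow> real" and k :: nat
  assumes r: "r = Suc p" and n: "r \<le> n" and k: "k = card (knots r n \<theta>)"
begin

lemma knot_range: "1 \<le> i \<Longrightarrow> i \<le> k \<Longrightarrow> 2 \<le> knot r n \<theta> i \<and> knot r n \<theta> i \<le> n - r + 1"
  using knot_in_knots[of i r n \<theta>] by (auto simp: k knots_def)

lemma knot_pos_ends: "knot_pos r n \<theta> 0 = 0" "knot_pos r n \<theta> (Suc k) = n - p"
  by (simp_all add: knot_pos_def r k)

lemma knot_pos_inner: "1 \<le> i \<Longrightarrow> i \<le> k \<Longrightarrow> knot_pos r n \<theta> i = knot r n \<theta> i - 1"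
  by (simp add: knot_pos_def k)

lemma knot_pos_step:
  assumes "i \<le> k"
  shows "knot_pos r n \<theta> i < knot_pos r n \<theta> (Suc i)"
proof -
  consider "i = 0" "k = 0" | "i = 0" "1 \<le> k" | "1 \<le> i" "i < k" | "1 \<le> i" "i = k" using assms by linarith
  then show ?thesis
  proof cases
    case 1
    then show ?thesis using knot_pos_ends n r by simp
  next
    case 2
    then show ?thesis using knot_range[of 1] knot_pos_inner[of 1] knot_pos_ends by simp
  next
    case 3
    then have "knot r n \<theta> i < knot r n \<theta> (Suc i)" by (intro knot_less) (auto simp: k)
    moreover have "knot_pos r n \<theta> i = knot r n \<theta> i - 1" "knot_pos r n \<theta> (Suc i) = knot r n \<theta> (Suc i) - 1"
      using 3 by (simp_all add: knot_pos_inner)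
    ultimately show ?thesis using 3 knot_range[of i] by linarith
  next
    case 4
    then have "knot_pos r n \<theta> i = knot r n \<theta> i - 1" "knot_pos r n \<theta> (Suc i) = n - p"
      by (simp_all add: knot_pos_inner knot_pos_ends)
    then show ?thesis using 4 knot_range[of i] n r by linarith
  qed
qed

lemma knot_pos_less: "i < j \<Longrightarrow> j \<le> Suc k \<Longrightarrow> knot_pos r n \<theta> i < knot_pos r n \<theta> j"
proof (induction j)
  case (Suc j)
  then have "knot_pos r n \<theta> j < knot_pos r n \<theta> (Suc j)" by (intro knot_pos_step) auto
  with Suc show ?case by (cases "i = j") auto
qed simp

lemma Dr_between_knots:
  assumes "i \<le> k" "knot_pos r n \<theta> i < j" "j < knot_pos r n \<theta> (Suc i)"
  shows "Dr r \<theta> j = 0"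
proof (rule ccontr)
  assume nz: "Dr r \<theta> j \<noteq> 0"
  have "knot_pos r n \<theta> (Suc i) \<le> n - p"
    using knot_pos_less[of "Suc i" "Suc k"] assms(1) knot_pos_ends by (cases "i = k") auto
  then have "Suc j \<in> knots r n \<theta>"
    using nz assms r n by (auto simp: knots_def Dr_Suc)
  then obtain i' where i': "1 \<le> i'" "i' \<le> k" "knot r n \<theta> i' = Suc j" using ex_knot k by blast
  then have j: "knot_pos r n \<theta> i' = j" by (simp add: knot_pos_inner)
  show False
  proof (cases "i' \<le> i")
    case True
    then have "knot_pos r n \<theta> i' \<le> knot_pos r n \<theta> i"
      using knot_pos_less[of i' i] assms(1) by (cases "i' = i") auto
    with j assms show False by simp
  next
    case False
    then have "knot_pos r n \<theta> (Suc i) \<le> knot_pos r n \<theta> i'"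
      using knot_pos_less[of "Suc i" i'] i' by (cases "Suc i = i'") auto
    with j assms show False by simp
  qed
qed

lemma knot_sign_Dr:
  assumes "1 \<le> i" "i \<le> k"
  shows "real_of_int (knot_sign r n \<theta> i) * Dr r \<theta> (knot_pos r n \<theta> i) = \<bar>Dr r \<theta> (knot_pos r n \<theta> i)\<bar>"
proof -
  obtain j where j: "knot r n \<theta> i = Suc j" using knot_range[OF assms] by (cases "knot r n \<theta> i") auto
  have "knot_sign r n \<theta> i = (if Dr p \<theta> j < Dr p \<theta> (Suc j) then 1 else - 1)"
    using assms j by (simp add: knot_sign_def k r)
  moreover have "knot_pos r n \<theta> i = j" using assms j by (simp add: knot_pos_inner)
  ultimately show ?thesis by (simp add: r Dr_Suc)
qed

lemma seg_length_eq:
  assumes "i \<le> k" "1 \<le> k"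
  shows "segment_end p (knot_pos r n \<theta>) (Suc i) - segment_end p (knot_pos r n \<theta>) i = seg_length r n \<theta> i"
proof -
  consider "i = 0" | "1 \<le> i" "i < k" | "1 \<le> i" "i = k" using assms by linarith
  then show ?thesis
  proof cases
    case 1
    then show ?thesis
      using assms knot_range[of 1] knot_pos_inner[of 1] r by (simp add: segment_end_def seg_length_def Let_def)
  next
    case 2
    then have "knot r n \<theta> i < knot r n \<theta> (Suc i)" by (intro knot_less) (auto simp: k)
    then show ?thesis
      using 2 knot_range[of i] by (simp add: segment_end_def seg_length_def Let_def knot_pos_inner k[symmetric])
  next
    case 3
    have "seg_length r n \<theta> i = n - r + 2 - knot r n \<theta> i"
      using 3 by (simp add: seg_length_def Let_def k)
    moreover have "segment_end p (knot_pos r n \<theta>) (Suc i) = n"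
      using 3 knot_pos_ends n r by (simp add: segment_end_def)
    moreover have "segment_end p (knot_pos r n \<theta>) i = knot r n \<theta> i - 1 + p"
      using 3 by (simp add: segment_end_def knot_pos_inner)
    ultimately show ?thesis using 3 knot_range[of i] n r by linarith
  qed
qed

text \<open>Convexity of the absolute value: at a knot it lies above its tangent, which has slope the sign of
  the knot; elsewhere the derivative of \<open>x\<close> vanishes.  This covers \<open>t = 0\<close>, where \<open>x\<close> has no knots.\<close>

lemma cone_form_le:
  assumes t: "0 \<le> t" and x: "\<And>j. 1 \<le> j \<Longrightarrow> j \<le> n - r \<Longrightarrow> Dr r x j = t * Dr r \<theta> j"
  shows "cone_form p k (knot_pos r n \<theta>) (\<lambda>i. real_of_int (knot_sign r n \<theta> i)) (\<lambda>i. e i - x i)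
    \<le> l1_norm (n - r) (Dr r e) - t * l1_norm (n - r) (Dr r \<theta>)"
proof -
  let ?g = "knot_pos r n \<theta>" and ?s = "\<lambda>i. real_of_int (knot_sign r n \<theta> i)" and ?u = "\<lambda>i. e i - x i"
  define \<psi> where "\<psi> j = (if j = 0 then 0 else \<bar>Dr r e j\<bar> - t * \<bar>Dr r \<theta> j\<bar>)" for j
  have gn: "?g (Suc i) \<le> n - p" if "i \<le> k" for i
    using knot_pos_less[of "Suc i" "Suc k"] that knot_pos_ends by (cases "i = k") auto
  have "cone_form p k ?g ?s ?u \<le> (\<Sum>i<Suc k. \<Sum>j\<in>{?g i..<?g (Suc i)}. \<psi> j)"
    unfolding cone_form_def
  proof (rule sum_mono)
    fix i assume "i \<in> {..<Suc k}"
    then have i: "i \<le> k" by simp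
    have step: "?g i < ?g (Suc i)" by (rule knot_pos_step[OF i])
    have "{?g i..<?g (Suc i)} = insert (?g i) {?g i<..<?g (Suc i)}" using step by auto
    then have split: "(\<Sum>j\<in>{?g i..<?g (Suc i)}. \<psi> j) = \<psi> (?g i) + (\<Sum>j\<in>{?g i<..<?g (Suc i)}. \<psi> j)" by simp
    have "(\<Sum>j\<in>{?g i<..<?g (Suc i)}. \<bar>Dr (Suc p) ?u j\<bar>) = (\<Sum>j\<in>{?g i<..<?g (Suc i)}. \<psi> j)"
    proof (rule sum.cong[OF refl])
      fix j assume j: "j \<in> {?g i<..<?g (Suc i)}"
      then have "Dr r \<theta> j = 0" using Dr_between_knots[OF i] by auto
      moreover have "1 \<le> j" "j \<le> n - r" using j gn[OF i] r by auto
      ultimately show "\<bar>Dr (Suc p) ?u j\<bar> = \<psi> j"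
        using x[of j] by (simp add: \<psi>_def Dr_diff r[symmetric])
    qed
    moreover have "?s i * Dr (Suc p) ?u (?g i) \<le> \<psi> (?g i)"
    proof (cases "i = 0")
      case True
      then show ?thesis by (simp add: knot_sign_def \<psi>_def knot_pos_ends)
    next
      case False
      then have j: "1 \<le> ?g i" "?g i \<le> n - r" using knot_range[of i] i knot_pos_inner[of i] by auto
      have "?s i * Dr (Suc p) ?u (?g i) = ?s i * Dr r e (?g i) - t * (?s i * Dr r \<theta> (?g i))"
        unfolding r[symmetric] Dr_diff x[OF j] by (simp add: algebra_simps)
      also have "?s i * Dr r \<theta> (?g i) = \<bar>Dr r \<theta> (?g i)\<bar>" using False i by (intro knot_sign_Dr) auto
      also have "?s i * Dr r e (?g i) \<le> \<bar>Dr r e (?g i)\<bar>" by (auto simp: knot_sign_def Let_def)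
      finally show ?thesis using j by (simp add: \<psi>_def)
    qed
    ultimately show "(\<Sum>j\<in>{?g i<..<?g (Suc i)}. \<bar>Dr (Suc p) ?u j\<bar>) + ?s i * Dr (Suc p) ?u (?g i)
        \<le> (\<Sum>j\<in>{?g i..<?g (Suc i)}. \<psi> j)" unfolding split by linarith
  qed
  also have "\<dots> = (\<Sum>j\<in>{?g 0..<?g (Suc k)}. \<psi> j)"
  proof -
    have "(\<Sum>i<m. \<Sum>j\<in>{?g i..<?g (Suc i)}. \<psi> j) = (\<Sum>j\<in>{?g 0..<?g m}. \<psi> j)" if "m \<le> Suc k" for m
      using that
    proof (induction m)
      case (Suc m)
      have "?g 0 \<le> ?g m" "?g m \<le> ?g (Suc m)" using knot_pos_step[of m] Suc.prems knot_pos_ends by auto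
      with Suc show ?case by (simp add: sum.atLeastLessThan_concat)
    qed simp
    from this[OF order_refl] show ?thesis .
  qed
  also have "\<dots> = (\<Sum>j\<in>{1..n - r}. \<psi> j)"
    unfolding knot_pos_ends using n r by (intro sum.mono_neutral_right) (auto simp: \<psi>_def)
  also have "\<dots> = (\<Sum>j\<in>{1..n - r}. \<bar>Dr r e j\<bar> - t * \<bar>Dr r \<theta> j\<bar>)"
    by (intro sum.cong) (auto simp: \<psi>_def)
  also have "\<dots> = l1_norm (n - r) (Dr r e) - t * l1_norm (n - r) (Dr r \<theta>)"
    by (simp add: l1_norm_def sum_subtractf sum_distrib_left)
  finally show ?thesis .
qed

end

section \<open>The risk bound\<close>

lemma std_gaussian_noise_gaussian_vec:
  assumes n: "1 \<le> n" and \<sigma>: "0 < \<sigma>"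
  shows "std_gaussian_noise (gaussian_vec n \<theta> \<sigma>) (\<lambda>i y. (y i - \<theta> i) / \<sigma>) n"
proof -
  define D where "D i = density lborel (\<lambda>x. ennreal (normal_density (\<theta> i) \<sigma> x))" for i
  have D: "prob_space (D i)" for i unfolding D_def by (rule prob_space_normal_density[OF \<sigma>])
  have gv: "gaussian_vec n \<theta> \<sigma> = Pi\<^sub>M {1..n} D" unfolding gaussian_vec_def D_def by (rule refl)
  interpret prob_space "Pi\<^sub>M {1..n} D" by (rule prob_space_PiM[OF D])
  have comp: "distr (Pi\<^sub>M {1..n} D) (D i) (\<lambda>y. y i) = D i" if "i \<in> {1..n}" for i
    by (rule distr_PiM_component[OF D that])
  have "indep_vars D (\<lambda>i y. y i) {1..n}"
  proof (subst indep_vars_iff_distr_eq_PiM')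
    show "{1..n} \<noteq> {}" using n by simp
    show "(\<lambda>y. y i) \<in> Pi\<^sub>M {1..n} D \<rightarrow>\<^sub>M D i" if "i \<in> {1..n}" for i
      using that by (rule measurable_component_singleton)
    have "distr (Pi\<^sub>M {1..n} D) (Pi\<^sub>M {1..n} D) (\<lambda>x. \<lambda>i\<in>{1..n}. x i) = distr (Pi\<^sub>M {1..n} D) (Pi\<^sub>M {1..n} D) (\<lambda>x. x)"
    proof (rule distr_cong[OF refl refl])
      fix x assume "x \<in> space (Pi\<^sub>M {1..n} D)"
      then show "(\<lambda>i\<in>{1..n}. x i) = x" by (auto simp: space_PiM PiE_def extensional_restrict)
    qed
    also have "\<dots> = Pi\<^sub>M {1..n} D" by simp
    also have "\<dots> = Pi\<^sub>M {1..n} (\<lambda>i. distr (Pi\<^sub>M {1..n} D) (D i) (\<lambda>y. y i))"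
      using comp by (intro PiM_cong) auto
    finally show "distr (Pi\<^sub>M {1..n} D) (Pi\<^sub>M {1..n} D) (\<lambda>x. \<lambda>i\<in>{1..n}. x i)
      = Pi\<^sub>M {1..n} (\<lambda>i. distr (Pi\<^sub>M {1..n} D) (D i) (\<lambda>y. y i))" .
  qed
  then have indep: "indep_vars (\<lambda>_. borel) (\<lambda>i y. (y i - \<theta> i) / \<sigma>) {1..n}"
    by (rule indep_vars_compose2) (simp add: D_def)
  have "distributed (Pi\<^sub>M {1..n} D) lborel (\<lambda>y. (y i - \<theta> i) / \<sigma>) (\<lambda>x. ennreal (std_normal_density x))"
    if i: "i \<in> {1..n}" for i
  proof -
    have m: "(\<lambda>y. y i) \<in> Pi\<^sub>M {1..n} D \<rightarrow>\<^sub>M lborel"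
      using measurable_component_singleton[OF i, of D] by (simp add: D_def cong: measurable_cong_sets)
    have "distr (Pi\<^sub>M {1..n} D) lborel (\<lambda>y. y i) = distr (Pi\<^sub>M {1..n} D) (D i) (\<lambda>y. y i)"
      by (rule distr_cong) (auto simp: D_def)
    then have "distributed (Pi\<^sub>M {1..n} D) lborel (\<lambda>y. y i) (\<lambda>x. ennreal (normal_density (\<theta> i) \<sigma> x))"
      unfolding distributed_def using comp[OF i] m by (simp add: D_def)
    then show ?thesis by (simp only: normal_standard_normal_convert[OF \<sigma>])
  qed
  then show ?thesis
    unfolding gv std_gaussian_noise_def std_gaussian_noise_axioms_def
    using indep prob_space_axioms by blast
qed

lemma TV_constraint:
  assumes "1 \<le> r" "1 \<le> n"
  shows "l1_norm (n - r) (Dr r x) \<le> V * real n powi (1 - int r) \<longleftrightarrow> TV r n x \<le> V"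
    and "V * real n powi (1 - int r) = V / real n ^ (r - 1)"
proof -
  obtain p where p: "r = Suc p" using assms by (cases r) auto
  have n: "real n ^ p > 0" using assms by simp
  have "real n powi (1 - int r) = inverse (real n ^ p)"
    by (simp add: p power_int_minus)
  then show "V * real n powi (1 - int r) = V / real n ^ (r - 1)" by (simp add: p divide_inverse)
  then show "l1_norm (n - r) (Dr r x) \<le> V * real n powi (1 - int r) \<longleftrightarrow> TV r n x \<le> V"
    using n by (simp add: p TV_def pos_le_divide_eq mult.commute)
qed

text \<open>The point of the constraint set to which the estimator is compared: \<open>\<theta>\<close> itself if it is
  feasible, else \<open>\<theta>\<close> with its derivative scaled down.  The scaling keeps the derivative
  proportional to that of \<open>\<theta>\<close> and moves no entry by more than \<open>TV r n \<theta> - V\<close>.\<close>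

lemma ex_comparison_point:
  assumes r: "1 \<le> r" "r \<le> n" and \<theta>: "\<theta> \<in> Rn n" and V: "0 \<le> V"
  shows "\<exists>x\<in>tv_ball r n (V * real n powi (1 - int r)). \<exists>t\<ge>0.
    (\<forall>j. 1 \<le> j \<and> j \<le> n - r \<longrightarrow> Dr r x j = t * Dr r \<theta> j) \<and>
    t * TV r n \<theta> = min V (TV r n \<theta>) \<and> sqdist n x \<theta> \<le> real n * (TV r n \<theta> - min V (TV r n \<theta>))\<^sup>2"
proof (cases "TV r n \<theta> \<le> V")
  case True
  then have "\<theta> \<in> tv_ball r n (V * real n powi (1 - int r))"
    using \<theta> TV_constraint(1)[of r n \<theta> V] r by (simp add: tv_ball_def)
  then show ?thesis using True by (intro bexI[of _ \<theta>] exI[of _ 1]) (auto simp: sqdist_def)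
next
  case False
  define T where "T = TV r n \<theta>"
  have T: "0 < T" "V < T" using False V by (auto simp: T_def)
  obtain w where w: "\<And>j. 1 \<le> j \<Longrightarrow> j \<le> n - r \<Longrightarrow> Dr r w j = Dr r \<theta> j" "\<And>i. i \<in> {1..n} \<Longrightarrow> \<bar>w i\<bar> \<le> T"
    using ex_bounded_primitive[OF r(1), of n \<theta>] unfolding T_def by blast
  define t where "t = V / T"
  have t: "0 \<le> t" "t \<le> 1" "t * T = V" using T V by (auto simp: t_def)
  define x where "x = restrict (\<lambda>i. \<theta> i - (1 - t) * w i) {1..n}"
  have Dx: "Dr r x j = t * Dr r \<theta> j" if "1 \<le> j" "j \<le> n - r" for j
    unfolding x_def Dr_restrict[OF that] Dr_diff Dr_scale w(1)[OF that] by (simp add: algebra_simps)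
  have "l1_norm (n - r) (Dr r x) = t * l1_norm (n - r) (Dr r \<theta>)"
    unfolding l1_norm_def sum_distrib_left using Dx t by (intro sum.cong) (auto simp: abs_mult)
  then have "TV r n x = V" using t by (simp add: TV_def T_def mult.left_commute)
  then have "x \<in> tv_ball r n (V * real n powi (1 - int r))"
    using TV_constraint(1)[of r n x V] r by (simp add: tv_ball_def) (simp add: x_def)
  moreover have "sqdist n x \<theta> \<le> real n * (T - V)\<^sup>2"
  proof -
    have "sqdist n x \<theta> \<le> (\<Sum>i\<in>{1..n}. (T - V)\<^sup>2)"
      unfolding sqdist_def
    proof (rule sum_mono)
      fix i assume i: "i \<in> {1..n}"
      have "\<bar>x i - \<theta> i\<bar> = (1 - t) * \<bar>w i\<bar>" using i t by (simp add: x_def abs_mult)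
      also have "\<dots> \<le> (1 - t) * T" using w(2)[OF i] t by (intro mult_left_mono) auto
      also have "\<dots> = T - V" using t by (simp add: algebra_simps)
      finally have "\<bar>x i - \<theta> i\<bar>\<^sup>2 \<le> (T - V)\<^sup>2" by (intro power_mono) auto
      then show "(x i - \<theta> i)\<^sup>2 \<le> (T - V)\<^sup>2" by simp
    qed
    then show ?thesis by simp
  qed
  ultimately show ?thesis using False t Dx
    by (intro bexI[of _ x] exI[of _ t]) (auto simp: T_def[symmetric])
qed

lemma cone_form_scale:
  assumes "0 \<le> c"
  shows "cone_form p k g s (\<lambda>i. c * u i) = c * cone_form p k g s u"
  using assms by (simp add: cone_form_def Dr_scale abs_mult sum_distrib_left distrib_left mult_ac)

text \<open>The noise is divided by \<open>\<sigma>\<close>, and so is the direction; the cone form is homogeneous.  A slack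
  \<open>\<delta> = V - TV > 0\<close> costs \<open>\<sigma> \<surd>n \<delta> \<le> n \<delta>\<^sup>2 + \<sigma>\<^sup>2\<close>, and then the comparison point is \<open>\<theta>\<close> itself.  So one of
  the two errors vanishes, and \<open>(V - TV)\<^sup>2\<close> appears with the factor one.\<close>

lemma risk_bound:
  assumes r: "1 \<le> r" and c: "0 < c"
  shows "\<exists>K>0. \<forall>n \<sigma> V. \<forall>\<theta>\<in>Rn n. 2 * r \<le> n \<and> 0 < \<sigma> \<and> 0 \<le> V \<and> min_length_condition r n c \<theta> \<longrightarrow>
    risk r n \<sigma> V \<theta> \<le> (V - TV r n \<theta>)\<^sup>2
      + K * (\<sigma>\<^sup>2 * (real (l0_norm (n - r) (Dr r \<theta>)) + 1) / real n
             * ln (exp 1 * real n / (real (l0_norm (n - r) (Dr r \<theta>)) + 1)))"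
proof -
  obtain p where p: "r = Suc p" using r by (cases r) auto
  obtain \<beta> C where \<beta>: "\<beta> > 0" and C: "C > 0" and
    dom: "\<forall>n k g s \<mu>. \<mu> = real n / real (k + 1) \<and> \<mu> \<ge> 1 \<and> p < n \<and> g 0 = 0 \<and> g (Suc k) = n - p \<and>
      (\<forall>i\<le>k. g i < g (Suc i)) \<and> (\<forall>i. \<bar>s i\<bar> \<le> 1) \<and> s 0 = 0 \<and> s (Suc k) = 0 \<and>
      (\<forall>i\<le>k. s i \<noteq> s (Suc i) \<longrightarrow> c * \<mu> \<le> real (segment_end p g (Suc i) - segment_end p g i)) \<longrightarrow>
    block_dominated n (1 / 4) \<beta> (C * (real (k + 1) * (1 + ln \<mu>)))
      (\<lambda>z u. 2 * (\<Sum>i\<in>{1..n}. z i * u i) - 1 * (\<Sum>i\<in>{1..n}. (u i)\<^sup>2)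
              - 1 * halfpow p \<mu> * max 0 (cone_form p k g s u))"
    using cone_dominated[OF zero_less_one zero_less_one c, of p] by (elim exE conjE) (rule that)
  define C' where "C' = C * (1 + block_cost (1 / 4) \<beta>)"
  have "block_cost (1 / 4) \<beta> \<ge> 0" using \<beta> by (simp add: block_cost_def)
  then have C': "C' > 0" using C by (simp add: C'_def add_pos_nonneg)
  have "risk r n \<sigma> V \<theta> \<le> (V - TV r n \<theta>)\<^sup>2
      + (1 + C') * (\<sigma>\<^sup>2 * (real (l0_norm (n - r) (Dr r \<theta>)) + 1) / real n
             * ln (exp 1 * real n / (real (l0_norm (n - r) (Dr r \<theta>)) + 1)))"
    if \<theta>: "\<theta> \<in> Rn n" and n: "2 * r \<le> n" and \<sigma>: "0 < \<sigma>" and V: "0 \<le> V"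
      and ml: "min_length_condition r n c \<theta>" for n \<sigma> V \<theta>
  proof -
    define k where "k = card (knots r n \<theta>)"
    have kl: "l0_norm (n - r) (Dr r \<theta>) = k" using card_knots[OF r] by (simp add: k_def)
    have "k \<le> n - r" unfolding kl[symmetric] l0_norm_def
      by (rule order_trans[OF card_mono[of "{1..n - r}"]]) auto
    then have kn: "k + 1 \<le> n" "r \<le> n" "1 \<le> n" using n r by auto
    define \<mu> where "\<mu> = real n / real (k + 1)"
    have \<mu>: "1 \<le> \<mu>" using kn by (simp add: \<mu>_def)
    have \<mu>n: "\<mu> \<le> real n" by (simp add: \<mu>_def divide_le_eq mult_le_cancel_left1)
    define L where "L = real (k + 1) * (1 + ln \<mu>)"
    have L: "1 \<le> L"
    proof -
      have "1 * 1 \<le> real (k + 1) * (1 + ln \<mu>)" using \<mu> by (intro mult_mono) auto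
      then show ?thesis by (simp add: L_def)
    qed
    let ?g = "knot_pos r n \<theta>" and ?s = "\<lambda>i. real_of_int (knot_sign r n \<theta> i)" and ?m = "halfpow p \<mu>"
    have dominated: "block_dominated n (1 / 4) \<beta> (C * L)
      (\<lambda>z u. 2 * (\<Sum>i\<in>{1..n}. z i * u i) - 1 * (\<Sum>i\<in>{1..n}. (u i)\<^sup>2)
              - 1 * ?m * max 0 (cone_form p k ?g ?s u))"
      unfolding L_def
    proof (rule dom[rule_format], intro conjI allI impI)
      show "\<mu> = real n / real (k + 1)" by (rule \<mu>_def)
      show "p < n" using kn p by simp
      show "?g 0 = 0" "?g (Suc k) = n - p" using knot_pos_ends[OF p kn(2) k_def] by auto
      show "?g i < ?g (Suc i)" if "i \<le> k" for i by (rule knot_pos_step[OF p kn(2) k_def that])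
      show "\<bar>?s i\<bar> \<le> 1" for i by (simp add: knot_sign_def Let_def)
      show "?s 0 = 0" "?s (Suc k) = 0" by (simp_all add: knot_sign_def k_def)
      show "c * \<mu> \<le> real (segment_end p ?g (Suc i) - segment_end p ?g i)" if i: "i \<le> k" and ne: "?s i \<noteq> ?s (Suc i)" for i
      proof -
        have "1 \<le> k"
        proof (rule ccontr)
          assume "\<not> 1 \<le> k"
          then have "?s i = 0" "?s (Suc i) = 0" by (auto simp: knot_sign_def k_def)
          with ne show False by simp
        qed
        then have e: "segment_end p ?g (Suc i) - segment_end p ?g i = seg_length r n \<theta> i"
          by (rule seg_length_eq[OF p kn(2) k_def i])
        have "knot_sign r n \<theta> i \<noteq> knot_sign r n \<theta> (i + 1)" using ne by auto
        then have "c * real n / (real k + 1) \<le> real (seg_length r n \<theta> i)"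
          using ml i by (auto simp: min_length_condition_def Let_def k_def)
        then show ?thesis unfolding e by (simp add: \<mu>_def add.commute)
      qed
    qed (rule \<mu>)
    interpret std_gaussian_noise "gaussian_vec n \<theta> \<sigma>" "\<lambda>i y. (y i - \<theta> i) / \<sigma>" n
      by (rule std_gaussian_noise_gaussian_vec[OF kn(3) \<sigma>])
    obtain G where G: "integrable (gaussian_vec n \<theta> \<sigma>) G"
      "expectation G \<le> C * L * (1 + block_cost (1 / 4) \<beta>)"
      "\<forall>y\<in>space (gaussian_vec n \<theta> \<sigma>). \<forall>u. 2 * (\<Sum>i\<in>{1..n}. (y i - \<theta> i) / \<sigma> * u i) - 1 * (\<Sum>i\<in>{1..n}. (u i)\<^sup>2)
              - 1 * ?m * max 0 (cone_form p k ?g ?s u) \<le> G y"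
    proof -
      have "(0::real) < 1 / 4" by simp
      from block_dominated_majorant[OF dominated this \<beta>] show ?thesis by (elim exE conjE) (rule that)
    qed
    obtain x t where x: "x \<in> tv_ball r n (V * real n powi (1 - int r))" "0 \<le> t"
      "\<And>j. 1 \<le> j \<Longrightarrow> j \<le> n - r \<Longrightarrow> Dr r x j = t * Dr r \<theta> j"
      "t * TV r n \<theta> = min V (TV r n \<theta>)" "sqdist n x \<theta> \<le> real n * (TV r n \<theta> - min V (TV r n \<theta>))\<^sup>2"
      using ex_comparison_point[OF r kn(2) \<theta> V] by blast
    let ?e = "\<lambda>y. tf_estimator r n V y" and ?v = "(V - TV r n \<theta>)\<^sup>2"
    have point: "sqdist n (?e y) \<theta> \<le> real n * ?v + \<sigma>\<^sup>2 * (1 + G y)"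
      if y: "y \<in> space (gaussian_vec n \<theta> \<sigma>)" for y
    proof -
      let ?u = "\<lambda>i. ?e y i - x i"
      define \<delta> where "\<delta> = V - min V (TV r n \<theta>)"
      have \<delta>0: "0 \<le> \<delta>" by (simp add: \<delta>_def)
      have np: "real n ^ p > 0" using kn by simp
      have "cone_form p k ?g ?s ?u \<le> l1_norm (n - r) (Dr r (?e y)) - t * l1_norm (n - r) (Dr r \<theta>)"
        by (rule cone_form_le[OF p kn(2) k_def x(2,3)])
      also have "l1_norm (n - r) (Dr r (?e y)) \<le> V / real n ^ p"
        using tf_estimator_nearest(1)[OF V, of r n y] TV_constraint(2)[OF r kn(3), of V] by (simp add: tv_ball_def p)
      also have "t * l1_norm (n - r) (Dr r \<theta>) = (t * TV r n \<theta>) / real n ^ p"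
        using kn(3) by (simp add: TV_def p)
      also have "V / real n ^ p - t * TV r n \<theta> / real n ^ p = \<delta> / real n ^ p"
        unfolding x(4) by (simp add: \<delta>_def diff_divide_distrib)
      finally have cone: "max 0 (cone_form p k ?g ?s ?u) \<le> \<delta> / real n ^ p" using \<delta>0 np by simp
      have "?m * max 0 (cone_form p k ?g ?s ?u) \<le> halfpow p (real n) * (\<delta> / real n ^ p)"
        using cone \<mu> \<mu>n by (intro mult_mono halfpow_mono halfpow_nonneg) auto
      also have "\<dots> = sqrt (real n) * \<delta>" using np by (simp add: halfpow_def)
      finally have pen: "?m * max 0 (cone_form p k ?g ?s ?u) \<le> sqrt (real n) * \<delta>" .
      let ?S = "\<Sum>i\<in>{1..n}. (y i - \<theta> i) * ?u i" and ?Q = "\<Sum>i\<in>{1..n}. (?u i)\<^sup>2"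
      let ?w = "\<lambda>i. (1 / \<sigma>) * ?u i"
      have "2 * (\<Sum>i\<in>{1..n}. (y i - \<theta> i) / \<sigma> * ?w i) - 1 * (\<Sum>i\<in>{1..n}. (?w i)\<^sup>2)
              - 1 * ?m * max 0 (cone_form p k ?g ?s ?w) \<le> G y"
        by (rule G(3)[rule_format, OF y])
      moreover have "(\<Sum>i\<in>{1..n}. (y i - \<theta> i) / \<sigma> * ?w i) = ?S / \<sigma>\<^sup>2"
        unfolding sum_divide_distrib by (intro sum.cong) (auto simp: power2_eq_square)
      moreover have "(\<Sum>i\<in>{1..n}. (?w i)\<^sup>2) = ?Q / \<sigma>\<^sup>2"
        unfolding sum_divide_distrib by (intro sum.cong) (auto simp: power_divide)
      moreover have "max 0 (cone_form p k ?g ?s ?w) = max 0 (cone_form p k ?g ?s ?u) / \<sigma>"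
        using \<sigma> by (subst cone_form_scale) (auto simp: max_def field_simps)
      ultimately have "2 * (?S / \<sigma>\<^sup>2) - ?Q / \<sigma>\<^sup>2 - ?m * (max 0 (cone_form p k ?g ?s ?u) / \<sigma>) \<le> G y" by simp
      then have "\<sigma>\<^sup>2 * (2 * (?S / \<sigma>\<^sup>2) - ?Q / \<sigma>\<^sup>2 - ?m * (max 0 (cone_form p k ?g ?s ?u) / \<sigma>)) \<le> \<sigma>\<^sup>2 * G y"
        by (intro mult_left_mono) auto
      moreover have "\<sigma>\<^sup>2 * (2 * (?S / \<sigma>\<^sup>2) - ?Q / \<sigma>\<^sup>2 - ?m * (max 0 (cone_form p k ?g ?s ?u) / \<sigma>))
          = 2 * ?S - ?Q - \<sigma> * (?m * max 0 (cone_form p k ?g ?s ?u))"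
        using \<sigma> by (simp add: right_diff_distrib power2_eq_square)
      moreover have "\<sigma> * (?m * max 0 (cone_form p k ?g ?s ?u)) \<le> \<sigma> * (sqrt (real n) * \<delta>)"
        using pen \<sigma> by (intro mult_left_mono) auto
      moreover have "\<sigma> * (sqrt (real n) * \<delta>) \<le> real n * \<delta>\<^sup>2 + \<sigma>\<^sup>2"
      proof -
        have "(sqrt (real n) * \<delta>) * \<sigma> \<le> 1 * (sqrt (real n) * \<delta>)\<^sup>2 + \<sigma>\<^sup>2 / (4 * 1)"
          by (rule young_le) simp
        moreover have "0 \<le> \<sigma>\<^sup>2" by simp
        moreover have "(sqrt (real n) * \<delta>)\<^sup>2 = real n * \<delta>\<^sup>2" by (simp add: power_mult_distrib)
        moreover have "(sqrt (real n) * \<delta>) * \<sigma> = \<sigma> * (sqrt (real n) * \<delta>)" by (rule mult.commute)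
        ultimately show ?thesis by linarith
      qed
      moreover have "sqdist n (?e y) \<theta> \<le> sqdist n x \<theta> + (2 * ?S - ?Q)"
        by (rule oracle_inequality[OF V x(1)])
      moreover have "real n * \<delta>\<^sup>2 + real n * (TV r n \<theta> - min V (TV r n \<theta>))\<^sup>2 = real n * ?v"
        by (cases "V \<le> TV r n \<theta>") (auto simp: \<delta>_def min_def power2_commute)
      moreover have "\<sigma>\<^sup>2 * (1 + G y) = \<sigma>\<^sup>2 + \<sigma>\<^sup>2 * G y" by (simp add: distrib_left)
      ultimately show ?thesis using x(5) by linarith
    qed
    have bound0: "0 \<le> real n * ?v + \<sigma>\<^sup>2 * (1 + C' * L)"
      using C' L by (intro add_nonneg_nonneg mult_nonneg_nonneg) auto
    have "(\<integral>y. sqdist n (?e y) \<theta> \<partial>gaussian_vec n \<theta> \<sigma>) \<le> real n * ?v + \<sigma>\<^sup>2 * (1 + C' * L)"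
    proof (cases "integrable (gaussian_vec n \<theta> \<sigma>) (\<lambda>y. sqdist n (?e y) \<theta>)")
      case True
      have "(\<integral>y. sqdist n (?e y) \<theta> \<partial>gaussian_vec n \<theta> \<sigma>)
          \<le> (\<integral>y. real n * ?v + \<sigma>\<^sup>2 * (1 + G y) \<partial>gaussian_vec n \<theta> \<sigma>)"
        using True G(1) point by (intro integral_mono) auto
      also have "\<dots> = real n * ?v + \<sigma>\<^sup>2 * (1 + expectation G)"
        using G(1) by (simp add: prob_space)
      also have "\<dots> \<le> real n * ?v + \<sigma>\<^sup>2 * (1 + C' * L)"
        using G(2) by (intro add_left_mono mult_left_mono) (auto simp: C'_def mult_ac)
      finally show ?thesis .
    next
      (* The Bochner integral of a function that is not integrable is 0. *)
      case False
      then show ?thesis using bound0 by (simp add: not_integrable_integral_eq)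
    qed
    then have "1 / real n * (\<integral>y. sqdist n (?e y) \<theta> \<partial>gaussian_vec n \<theta> \<sigma>)
        \<le> 1 / real n * (real n * ?v + \<sigma>\<^sup>2 * (1 + C' * L))"
      by (intro mult_left_mono) auto
    then have "risk r n \<sigma> V \<theta> \<le> 1 / real n * (real n * ?v + \<sigma>\<^sup>2 * (1 + C' * L))"
      by (simp only: risk_def sqdist_L2)
    also have "\<dots> = ?v + \<sigma>\<^sup>2 / real n * (1 + C' * L)" using kn by (simp add: field_simps)
    also have "\<dots> \<le> ?v + \<sigma>\<^sup>2 / real n * ((1 + C') * L)"
      using L by (intro add_left_mono mult_left_mono) (auto simp: distrib_right)
    also have "\<sigma>\<^sup>2 / real n * ((1 + C') * L) = (1 + C') * (\<sigma>\<^sup>2 * (real k + 1) / real n * (1 + ln \<mu>))"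
      by (simp add: L_def)
    also have "1 + ln \<mu> = ln (exp 1 * real n / (real k + 1))"
    proof -
      have "exp 1 * real n / (real k + 1) = exp 1 * \<mu>" by (simp add: \<mu>_def)
      then show ?thesis using \<mu> by (simp add: ln_mult)
    qed
    finally show ?thesis unfolding kl .
  qed
  moreover have "1 + C' > 0" using C' by simp
  ultimately show ?thesis by blast
qed

theorem corollary2p3:
  fixes r :: nat
  assumes "r \<ge> 1"
  shows "\<exists>(C1 :: real \<Rightarrow> real) (C2 :: real \<Rightarrow> real \<Rightarrow> real).
    (\<forall>c. 0 < c \<and> c \<le> 1 \<longrightarrow> C1 c > 0) \<and>
    (\<forall>c C. 0 < c \<and> c \<le> 1 \<and> C > 0 \<longrightarrow> C2 c C > 0) \<and>
    (\<forall>(c :: real) (n :: nat) (\<sigma> :: real) (V :: real). \<forall>\<theta> \<in> Rn n.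
       0 < c \<and> c \<le> 1 \<and> n \<ge> 2 * r \<and> \<sigma> > 0 \<and> V \<ge> 0 \<and> min_length_condition r n c \<theta> \<longrightarrow>
       (let k = real (l0_norm (n - r) (Dr r \<theta>));
            rate = \<sigma>\<^sup>2 * (k + 1) / real n * ln (exp 1 * real n / (k + 1))
        in risk r n \<sigma> V \<theta> \<le> (V - TV r n \<theta>)\<^sup>2 + C1 c * rate \<and>
           (\<forall>C > 0. (V - TV r n \<theta>)\<^sup>2 \<le> C * rate \<longrightarrow> risk r n \<sigma> V \<theta> \<le> C2 c C * rate)))"
proof -
  define P where "P c K \<longleftrightarrow> K > 0 \<and> (\<forall>n \<sigma> V. \<forall>\<theta>\<in>Rn n. 2 * r \<le> n \<and> 0 < \<sigma> \<and> 0 \<le> V \<and> min_length_condition r n c \<theta> \<longrightarrow>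
    risk r n \<sigma> V \<theta> \<le> (V - TV r n \<theta>)\<^sup>2
      + K * (\<sigma>\<^sup>2 * (real (l0_norm (n - r) (Dr r \<theta>)) + 1) / real n
             * ln (exp 1 * real n / (real (l0_norm (n - r) (Dr r \<theta>)) + 1))))" for c K :: real
  define C1 where "C1 c = (SOME K. P c K)" for c
  have C1: "P c (C1 c)" if "0 < c" for c
  proof -
    have "\<exists>K. P c K" using risk_bound[OF assms that] unfolding P_def .
    then show ?thesis unfolding C1_def by (rule someI_ex)
  qed
  show ?thesis
  proof (intro exI[of _ C1] exI[of _ "\<lambda>c C. C + C1 c"] conjI allI ballI impI)
    fix c :: real assume "0 < c \<and> c \<le> 1"
    then show "C1 c > 0" using C1[of c] by (simp add: P_def)
  next
    fix c C :: real assume "0 < c \<and> c \<le> 1 \<and> C > 0"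
    then show "C + C1 c > 0" using C1[of c] by (simp add: P_def)
  next
    fix c \<sigma> V :: real and n :: nat and \<theta>
    assume \<theta>: "\<theta> \<in> Rn n" and
      a: "0 < c \<and> c \<le> 1 \<and> n \<ge> 2 * r \<and> \<sigma> > 0 \<and> V \<ge> 0 \<and> min_length_condition r n c \<theta>"
    define rate where "rate = \<sigma>\<^sup>2 * (real (l0_norm (n - r) (Dr r \<theta>)) + 1) / real n
      * ln (exp 1 * real n / (real (l0_norm (n - r) (Dr r \<theta>)) + 1))"
    have 1: "risk r n \<sigma> V \<theta> \<le> (V - TV r n \<theta>)\<^sup>2 + C1 c * rate"
      using C1[of c] a \<theta> unfolding P_def rate_def by blast
    then have 2: "risk r n \<sigma> V \<theta> \<le> (C + C1 c) * rate" if "(V - TV r n \<theta>)\<^sup>2 \<le> C * rate" for C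
      using that by (simp add: distrib_right)
    show "let k = real (l0_norm (n - r) (Dr r \<theta>));
            rate = \<sigma>\<^sup>2 * (k + 1) / real n * ln (exp 1 * real n / (k + 1))
        in risk r n \<sigma> V \<theta> \<le> (V - TV r n \<theta>)\<^sup>2 + C1 c * rate \<and>
           (\<forall>C > 0. (V - TV r n \<theta>)\<^sup>2 \<le> C * rate \<longrightarrow> risk r n \<sigma> V \<theta> \<le> (C + C1 c) * rate)"
      using 1 2 unfolding Let_def rate_def by blast
  qed
qed

end
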